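(* The space $d^1(\mathbb{R}^n)$ is continuously embedded into $bmo(\mathbb{R}^n)$, and there exists $C>0$ such that for every $1\le k\le n$ and every $u\in d^k(\mathbb{R}^n)$, $$\|u\|_{bmo}\le C\,\|u\|_{d^k}.$$
   Context: Notation: $\mathcal{D}(\mathbb{R}^n)$ is the space of compactly supported smooth functions, $\mathcal{D}'(\mathbb{R}^n)$ the space of distributions, and $\mathcal{D}^k(\mathbb{R}^n)$ the space of $k$-differential forms $\Phi=\sum_{|I|=k}\phi_I\,dx^I$ (sum over increasing multi-indices $I=(i_1<\dots<i_k)$) with components $\phi_I\in\mathcal{D}(\mathbb{R}^n)$. For such a form, $\|\Phi\|_{L^1_k}=\sum_{|I|=k}\|\phi_I\|_{L^1}$ and $\|\Phi\|_{\Upsilon^1_k(\mathbb{R}^n)}=\|\Phi\|_{L^1_k}+\|d\Phi\|_{L^1_{k+1}}$, where $d$ is the exterior derivative. For $1\le k\le n$, $d^k(\mathbb{R}^n)$ is the space of $u\in\mathcal{D}'(\mathbb{R}^n)$ with $$\|u\|_{d^k}:=\sup\Big\{\max_{|I|=k}|u(\phi_I)| : \Phi=\sum_{|I|=k}\phi_I dx^I\in\mathcal{D}^k(\mathbb{R}^n),\ \|\Phi\|_{\Upsilon^1_k(\mathbb{R}^n)}\le 1\Big\}<\infty.$$ $bmo(\mathbb{R}^n)$ (Goldberg's local BMO space) is the space of $f\in L^1_{loc}(\mathbb{R}^n)$ with $$\|f\|_{bmo}:=\sup_{l(Q)\le 1}\frac1{|Q|}\int_Q|f(x)-f_Q|\,dx+\sup_{l(Q)\ge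 1}\frac1{|Q|}\int_Q|f(x)|\,dx<\infty,$$ where $Q$ ranges over cubes with sides parallel to the axes, $l(Q)$ is the side-length, $|Q|$ the Lebesgue measure and $f_Q=\frac1{|Q|}\int_Q f$. Locally integrable functions are identified with the distributions they define. *)

theory Defs
  imports "HOL-Analysis.Analysis"
begin

text \<open>
  \<open>\<real>\<^sup>n\<close> is \<open>real ^ 'n\<close> with \<open>n = CARD('n)\<close>; the linear order on the index type \<open>'n\<close>
  gives the coordinates \<open>x\<^sub>1, \<dots>, x\<^sub>n\<close> their order, which determines the signs in the exterior
  derivative. By the Gelfand--Mazur theorem, the scalars \<open>'a\<close>, being a normed field over the reals and a Euclidean space, are
  \<open>real\<close> or \<open>complex\<close> up to isomorphism. Norms are \<open>ennreal\<close>-valued and defined for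
  all arguments; a space consists of the elements of finite norm.
\<close>

section \<open>Test functions and distributions\<close>

definition partial ::
  "'n::finite \<Rightarrow> (real ^ 'n \<Rightarrow> 'a::real_normed_vector) \<Rightarrow> real ^ 'n \<Rightarrow> 'a" where
  "partial i \<phi> x = frechet_derivative \<phi> (at x) (axis i 1)"

text \<open>Iterated partial derivatives are indexed by the list of directions, so each multi-index
  derivative occurs once for every ordering of its directions.\<close>

definition partials ::
  "'n::finite list \<Rightarrow> (real ^ 'n \<Rightarrow> 'a::real_normed_vector) \<Rightarrow> real ^ 'n \<Rightarrow> 'a" where
  "partials \<alpha> \<phi> = foldr partial \<alpha> \<phi>"

definition smooth :: "(real ^ 'n::finite \<Rightarrow> 'a::real_normed_vector) \<Rightarrow> bool" where
  "smooth \<phi> \<longleftrightarrow> (\<forall>\<alpha>. partials \<alpha> \<phi> differentiable_on UNIV)"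

definition tsupport :: "(real ^ 'n::finite \<Rightarrow> 'a::real_normed_vector) \<Rightarrow> (real ^ 'n) set" where
  "tsupport \<phi> = closure {x. \<phi> x \<noteq> 0}"

definition test_functions :: "(real ^ 'n::finite \<Rightarrow> 'a::real_normed_vector) set" where
  "test_functions = {\<phi>. smooth \<phi> \<and> compact (tsupport \<phi>)}"

text \<open>A distribution is a functional of which only the values on test functions matter: linear
  there, and continuous in the sense of the usual seminorm estimates on each compact set.\<close>

definition distributions ::
  "((real ^ 'n::finite \<Rightarrow> 'a::{real_normed_field,euclidean_space}) \<Rightarrow> 'a) set" where
  "distributions = {u.
     (\<forall>\<phi>\<in>test_functions. \<forall>\<psi>\<in>test_functions. u (\<lambda>x. \<phi> x + \<psi> x) = u \<phi> + u \<psi>) \<and>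
     (\<forall>c. \<forall>\<phi>\<in>test_functions. u (\<lambda>x. c * \<phi> x) = c * u \<phi>) \<and>
     (\<forall>K. compact K \<longrightarrow> (\<exists>C N. \<forall>\<phi>\<in>test_functions. tsupport \<phi> \<subseteq> K \<longrightarrow>
        norm (u \<phi>) \<le> C * (\<Sum>\<alpha> | length \<alpha> \<le> N. SUP x. norm (partials \<alpha> \<phi> x))))}"

section \<open>Differential forms and the spaces \<open>d\<^sup>k\<close>\<close>

text \<open>An increasing multi-index \<open>i\<^sub>1 < \<dots> < i\<^sub>k\<close> is encoded as the set \<open>{i\<^sub>1, \<dots>, i\<^sub>k}\<close>, and a
  form by its family of components, which vanish on index sets of the wrong size.\<close>

definition multi_indices :: "nat \<Rightarrow> 'n::finite set set" where
  "multi_indices k = {I. card I = k}"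

definition test_forms ::
  "nat \<Rightarrow> ('n::finite set \<Rightarrow> real ^ 'n \<Rightarrow> 'a::real_normed_vector) set" where
  "test_forms k = {\<Phi>. (\<forall>I\<in>multi_indices k. \<Phi> I \<in> test_functions) \<and>
                      (\<forall>I. I \<notin> multi_indices k \<longrightarrow> \<Phi> I = (\<lambda>x. 0))}"

text \<open>In \<open>d\<Phi> = (\<Sum>I. \<Sum>j. \<partial>\<^sub>j \<phi>\<^sub>I dx\<^sup>j \<and> dx\<^sup>I)\<close>, the term \<open>dx\<^sup>j \<and> dx\<^sup>I\<close> with \<open>j \<notin> I\<close> equals
  \<open>dx\<^sup>J\<close> for \<open>J = I \<union> {j}\<close>, up to the sign of moving \<open>j\<close> past the smaller elements of \<open>J\<close>.\<close>

definition ext_deriv ::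
  "('n set \<Rightarrow> real ^ 'n::{finite,linorder} \<Rightarrow> 'a::real_normed_field) \<Rightarrow>
   'n set \<Rightarrow> real ^ 'n::{finite,linorder} \<Rightarrow> 'a" where
  "ext_deriv \<Phi> J x = (\<Sum>j\<in>J. (-1) ^ card {i\<in>J. i < j} * partial j (\<Phi> (J - {j})) x)"

definition L1_norm :: "(real ^ 'n::finite \<Rightarrow> 'a::real_normed_vector) \<Rightarrow> ennreal" where
  "L1_norm \<phi> = (\<integral>\<^sup>+x. norm (\<phi> x) \<partial>lebesgue)"

definition L1_form_norm ::
  "nat \<Rightarrow> ('n::finite set \<Rightarrow> real ^ 'n \<Rightarrow> 'a::real_normed_vector) \<Rightarrow> ennreal" where
  "L1_form_norm k \<Phi> = (\<Sum>I\<in>multi_indices k. L1_norm (\<Phi> I))"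

definition Upsilon_norm ::
  "nat \<Rightarrow> ('n set \<Rightarrow> real ^ 'n::{finite,linorder} \<Rightarrow> 'a::real_normed_field) \<Rightarrow> ennreal" where
  "Upsilon_norm k \<Phi> = L1_form_norm k \<Phi> + L1_form_norm (k + 1) (ext_deriv \<Phi>)"

definition d_norm ::
  "nat \<Rightarrow> ((real ^ 'n::{finite,linorder} \<Rightarrow> 'a::{real_normed_field,euclidean_space}) \<Rightarrow> 'a) \<Rightarrow> ennreal" where
  "d_norm k u = (SUP \<Phi> \<in> {\<Phi> \<in> test_forms k. Upsilon_norm k \<Phi> \<le> 1}.
                   Max ((\<lambda>I. ennreal (norm (u (\<Phi> I)))) ` multi_indices k))"

definition d_space ::
  "nat \<Rightarrow> ((real ^ 'n::{finite,linorder} \<Rightarrow> 'a::{real_normed_field,euclidean_space}) \<Rightarrow> 'a) set"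
  where "d_space k = {u \<in> distributions. d_norm k u < \<infinity>}"

section \<open>The space bmo\<close>

definition locally_integrable :: "(real ^ 'n::finite \<Rightarrow> 'a::euclidean_space) \<Rightarrow> bool" where
  "locally_integrable f \<longleftrightarrow> (\<forall>K. compact K \<longrightarrow> f absolutely_integrable_on K)"

definition cube :: "real ^ 'n::finite \<Rightarrow> real \<Rightarrow> (real ^ 'n) set" where
  "cube a l = cbox a (\<chi> i. a $ i + l)"

definition average :: "(real ^ 'n::finite) set \<Rightarrow> (real ^ 'n \<Rightarrow> 'a::euclidean_space) \<Rightarrow> 'a" where
  "average Q f = (LINT x:Q|lebesgue. f x) /\<^sub>R measure lebesgue Q"

definition bmo_fun_norm :: "(real ^ 'n::finite \<Rightarrow> 'a::euclidean_space) \<Rightarrow> ennreal" where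
  "bmo_fun_norm f =
     (SUP (a, l) \<in> UNIV \<times> {0<..1}.
        (\<integral>\<^sup>+x\<in>cube a l. norm (f x - average (cube a l) f) \<partial>lebesgue)
          / emeasure lebesgue (cube a l))
   + (SUP (a, l) \<in> UNIV \<times> {1..}.
        (\<integral>\<^sup>+x\<in>cube a l. norm (f x) \<partial>lebesgue) / emeasure lebesgue (cube a l))"

definition represents ::
  "(real ^ 'n::finite \<Rightarrow> 'a::{real_normed_field,euclidean_space}) \<Rightarrow>
   ((real ^ 'n \<Rightarrow> 'a) \<Rightarrow> 'a) \<Rightarrow> bool" where
  "represents f u \<longleftrightarrow> locally_integrable f \<and>
     (\<forall>\<phi>\<in>test_functions. u \<phi> = (LINT x|lebesgue. f x * \<phi> x))"

text \<open>The functions representing a given \<open>u\<close> agree almost everywhere, so the infimum is just their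
  common norm; it is \<open>\<infinity>\<close> if \<open>u\<close> is not given by a locally integrable function.\<close>

definition bmo_norm ::
  "((real ^ 'n::finite \<Rightarrow> 'a::{real_normed_field,euclidean_space}) \<Rightarrow> 'a) \<Rightarrow> ennreal" where
  "bmo_norm u = (INF f \<in> {f. represents f u}. bmo_fun_norm f)"

definition bmo ::
  "((real ^ 'n::finite \<Rightarrow> 'a::{real_normed_field,euclidean_space}) \<Rightarrow> 'a) set" where
  "bmo = {u \<in> distributions. bmo_norm u < \<infinity>}"

definition continuously_embedded ::
  "'v set \<Rightarrow> ('v \<Rightarrow> ennreal) \<Rightarrow> 'v set \<Rightarrow> ('v \<Rightarrow> ennreal) \<Rightarrow> bool" where
  "continuously_embedded X norm_X Y norm_Y \<longleftrightarrow>
     X \<subseteq> Y \<and> (\<exists>C::real. \<forall>u\<in>X. norm_Y u \<le> ennreal C * norm_X u)"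

end

theory Submission
  imports Defs
begin

text \<open>
  Testing \<open>u\<close> with \<open>d(\<psi> dx\<^sup>J)\<close>, which is closed, gives \<open>\<bar>u(\<partial>\<^sub>j\<psi>)\<bar> \<le> M (\<Sum>i. \<parallel>\<partial>\<^sub>i\<psi>\<parallel>\<^sub>1)\<close>,
  and testing with \<open>\<phi> dx\<^sup>I\<close> gives \<open>\<bar>u(\<phi>)\<bar> \<le> M (\<parallel>\<phi>\<parallel>\<^sub>1 + (\<Sum>i. \<parallel>\<partial>\<^sub>i\<phi>\<parallel>\<^sub>1))\<close>; only these two
  estimates are used, so the degree \<open>k\<close> plays no further role. With a mollifier \<open>\<rho>\<close> of mass \<open>c\<close>,
  the difference \<open>\<rho> * \<phi> - c \<phi>\<close> is the Laplacian of a compactly supported \<open>\<psi>\<close>, and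
  \<open>(\<Sum>i. \<Sum>j. \<parallel>\<partial>\<^sub>i\<partial>\<^sub>j\<psi>\<parallel>\<^sub>2\<^sup>2) = \<parallel>\<Delta>\<psi>\<parallel>\<^sub>2\<^sup>2\<close>, so the first estimate applied to each \<open>\<partial>\<^sub>i\<psi>\<close> bounds
  \<open>u(\<rho> * \<phi> - c \<phi>)\<close> by the \<open>L\<^sup>2\<close> norm of \<open>\<phi>\<close>. The smooth part \<open>\<rho> * \<phi>\<close> is handled by the second
  estimate on large cubes; on small cubes \<open>\<phi>\<close> has mean zero, \<open>\<rho> * \<phi>\<close> is a divergence with good
  bounds, and the first estimate suffices, which makes the result scale invariant. Thus \<open>u\<close> is
      bounded
  on \<open>L\<^sup>2\<close> of each cube with the norm that, by duality, is equivalent to the \<open>bmo\<close> bounds for the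
  representing function.
\<close>

section \<open>Smooth functions\<close>

text \<open>The obstacle is that the hypotheses measure derivatives in L1, where from dimension 2 on
  the Laplacian does not control the Hessian. Localisation pays for the detour through L2: on a cube
  the L1 norm costs only the square root of the volume times the L2 norm, and in L2 two integrations
  by parts suffice. Boundedness on the mean-zero L2 functions of a cube, with constant proportional
  to that square root, is boundedness on multiples of L2 atoms of a Hardy space, whose dual
  statement is an oscillation bound. The Newtonian potential of a test function is in general not a
  test function, so a functional known only on test functions cannot be applied to it; hence a
  compactly supported substitute, at the price of a smooth error of fixed length scale 1. The
  gradient estimate survives dilations and carries the result from the unit cube to every cube; the
  Sobolev estimate mixes orders 0 and 1 and is used only for sides at least 1. Real and complex
  scalars are treated together: the functional is restricted to real-valued test functions and its
  values are split into coordinates.\<close>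

lemma partial_eqI:
  assumes "(\<phi> has_derivative D) (at x)"
  shows "partial i \<phi> x = D (axis i 1)"
  unfolding partial_def using frechet_derivative_at[OF assms] by simp

text \<open>A family closed under \<open>partial\<close> contains every iterated partial derivative
  of its members, so differentiability once suffices. This spares formulas for higher derivatives of
  composite functions.\<close>

lemma smooth_coinduct:
  assumes "\<phi> \<in> F"
    and "\<And>\<phi>. \<phi> \<in> F \<Longrightarrow> \<phi> differentiable_on UNIV"
    and "\<And>\<phi> i. \<phi> \<in> F \<Longrightarrow> partial i \<phi> \<in> F"
  shows "smooth \<phi>"
proof -
  have "partials \<alpha> \<phi> \<in> F" for \<alpha>
    by (induction \<alpha>) (use assms in \<open>auto simp: partials_def\<close>)
  then show ?thesis
    unfolding smooth_def using assms(2) by blast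
qed

lemma smooth_differentiable: "smooth \<phi> \<Longrightarrow> \<phi> differentiable (at x)"
  unfolding smooth_def
  by (metis UNIV_I differentiable_on_def foldr_Nil id_apply partials_def)

lemma smooth_partial: "smooth \<phi> \<Longrightarrow> smooth (partial i \<phi>)"
  unfolding smooth_def
proof
  fix \<alpha> assume *: "\<forall>\<alpha>. partials \<alpha> \<phi> differentiable_on UNIV"
  have "partials \<alpha> (partial i \<phi>) = partials (\<alpha> @ [i]) \<phi>"
    by (simp add: partials_def)
  with * show "partials \<alpha> (partial i \<phi>) differentiable_on UNIV" by metis
qed

lemma has_derivative_partials:
  fixes \<phi> :: "real ^ 'n::finite \<Rightarrow> 'a::real_normed_vector"
  assumes "\<phi> differentiable (at x)"
  shows "(\<phi> has_derivative (\<lambda>v. \<Sum>i\<in>UNIV. v $ i *\<^sub>R partial i \<phi> x)) (at x)"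
proof -
  let ?D = "frechet_derivative \<phi> (at x)"
  have D: "(\<phi> has_derivative ?D) (at x)"
    using assms frechet_derivative_works by blast
  then have lin: "linear ?D"
    by (rule has_derivative_linear)
  have "?D v = (\<Sum>i\<in>UNIV. v $ i *\<^sub>R partial i \<phi> x)" for v
  proof -
    have "?D v = ?D (\<Sum>i\<in>UNIV. v $ i *\<^sub>R axis i 1)"
      using basis_expansion[of v] by (simp add: scalar_mult_eq_scaleR)
    also have "\<dots> = (\<Sum>i\<in>UNIV. v $ i *\<^sub>R ?D (axis i 1))"
      using lin by (simp add: linear_sum linear_scale)
    finally show ?thesis by (simp add: partial_def)
  qed
  then have "?D = (\<lambda>v. \<Sum>i\<in>UNIV. v $ i *\<^sub>R partial i \<phi> x)" by blast
  then show ?thesis using D by simp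
qed

lemma smooth_has_derivative:
  "smooth \<phi> \<Longrightarrow> (\<phi> has_derivative (\<lambda>v. \<Sum>i\<in>UNIV. v $ i *\<^sub>R partial i \<phi> x)) (at x)"
  by (intro has_derivative_partials smooth_differentiable)

lemma smooth_continuous_on: "smooth \<phi> \<Longrightarrow> continuous_on A \<phi>"
  by (meson continuous_on_eq_continuous_at continuous_on_subset differentiable_imp_continuous_within
      open_UNIV smooth_differentiable subset_UNIV)

lemma smooth_borel_measurable [measurable_dest]: "smooth \<phi> \<Longrightarrow> \<phi> \<in> borel_measurable borel"
  by (intro borel_measurable_continuous_onI smooth_continuous_on)

text \<open>Smoothness of \<open>\<phi>\<close> follows once \<open>\<phi>\<close> lies in a ring whose generators are differentiable
  with partial derivatives in the ring again.\<close>

inductive_set smooth_ring ::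
  "(real ^ 'n::finite \<Rightarrow> real) set \<Rightarrow> (real ^ 'n \<Rightarrow> real) set" for G where
  generator: "g \<in> G \<Longrightarrow> g \<in> smooth_ring G"
| smooth: "smooth g \<Longrightarrow> g \<in> smooth_ring G"
| add: "g \<in> smooth_ring G \<Longrightarrow> h \<in> smooth_ring G \<Longrightarrow> (\<lambda>x. g x + h x) \<in> smooth_ring G"
| mult: "g \<in> smooth_ring G \<Longrightarrow> h \<in> smooth_ring G \<Longrightarrow> (\<lambda>x. g x * h x) \<in> smooth_ring G"

lemma partial_add:
  fixes g h :: "real ^ 'n::finite \<Rightarrow> 'a::real_normed_vector"
  assumes "g differentiable (at x)" "h differentiable (at x)"
  shows "partial i (\<lambda>x. g x + h x) x = partial i g x + partial i h x"
  by (subst partial_eqI[OF has_derivative_add[OF has_derivative_partials has_derivative_partials]])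
    (use assms in \<open>auto simp: axis_def if_distrib if_distribR cong: if_cong\<close>)

lemma partial_mult:
  fixes g h :: "real ^ 'n::finite \<Rightarrow> real"
  assumes "g differentiable (at x)" "h differentiable (at x)"
  shows "partial i (\<lambda>x. g x * h x) x = g x * partial i h x + partial i g x * h x"
  by (subst partial_eqI[OF has_derivative_mult[OF has_derivative_partials has_derivative_partials]])
    (use assms in \<open>auto simp: axis_def if_distrib if_distribR cong: if_cong\<close>)

lemma smooth_ring_smooth:
  assumes "\<phi> \<in> smooth_ring G"
    and "\<And>g. g \<in> G \<Longrightarrow> g differentiable_on UNIV"
    and "\<And>g i. g \<in> G \<Longrightarrow> partial i g \<in> smooth_ring G"
  shows "smooth \<phi>"
proof (rule smooth_coinduct[OF assms(1)])
  have diff: "g differentiable (at x)" if "g \<in> smooth_ring G" for g x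
    using that
    by induction (use assms(2) in \<open>auto simp: differentiable_on_def intro: smooth_differentiable\<close>)
  then show "g differentiable_on UNIV" if "g \<in> smooth_ring G" for g
    using that by (simp add: differentiable_at_imp_differentiable_on)
  show "partial i g \<in> smooth_ring G" if "g \<in> smooth_ring G" for g i
    using that
  proof induction
    case (add g h)
    have "partial i (\<lambda>x. g x + h x) = (\<lambda>x. partial i g x + partial i h x)"
      using add diff by (auto simp: fun_eq_iff intro!: partial_add)
    with add show ?case by (auto intro: smooth_ring.intros)
  next
    case (mult g h)
    have "partial i (\<lambda>x. g x * h x) = (\<lambda>x. g x * partial i h x + partial i g x * h x)"
      using mult diff by (auto simp: fun_eq_iff intro!: partial_mult)
    with mult show ?case by (auto intro!: smooth_ring.add smooth_ring.mult)
  qed (use assms in \<open>auto intro: smooth_ring.intros smooth_partial\<close>)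
qed

text \<open>The values lie in an arbitrary normed space, beyond the reach of the real-valued
  \<open>smooth_ring\<close>; the invariant is the family of all sums of two smooth
  functions.\<close>

lemma smooth_add:
  fixes g h :: "real ^ 'n::finite \<Rightarrow> 'a::real_normed_vector"
  assumes "smooth g" "smooth h"
  shows "smooth (\<lambda>x. g x + h x)"
proof (rule smooth_coinduct[where F = "{(\<lambda>x. g x + h x) |g h. smooth g \<and> smooth h}"])
  show "(\<lambda>x. g x + h x) \<in> {(\<lambda>x. g x + h x) |g h. smooth g \<and> smooth h}"
    using assms by blast
  fix \<phi> :: "real ^ 'n \<Rightarrow> 'a" assume "\<phi> \<in> {(\<lambda>x. g x + h x) |g h. smooth g \<and> smooth h}"
  then obtain g h where \<phi>: "\<phi> = (\<lambda>x. g x + h x)" "smooth g" "smooth h" by blast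
  show "\<phi> differentiable_on UNIV"
    unfolding \<phi>(1)
    by (intro differentiable_at_imp_differentiable_on differentiable_add smooth_differentiable
        \<phi>(2,3))
  have "partial i \<phi> = (\<lambda>x. partial i g x + partial i h x)" for i
    unfolding \<phi>(1) by (rule ext, rule partial_add) (intro smooth_differentiable \<phi>(2,3))+
  then show "partial i \<phi> \<in> {(\<lambda>x. g x + h x) |g h. smooth g \<and> smooth h}" for i
    using smooth_partial[OF \<phi>(2)] smooth_partial[OF \<phi>(3)] by blast
qed

lemma smooth_mult: "smooth g \<Longrightarrow> smooth h \<Longrightarrow> smooth (\<lambda>x. g x * h x :: real)"
  by (rule smooth_ring_smooth[where G = "{}"]) (auto intro: smooth_ring.intros)

lemma smooth_bounded_linear:
  fixes \<phi> :: "real ^ 'n::finite \<Rightarrow> 'a::real_normed_vector" and L :: "'a \<Rightarrow> 'b::real_normed_vector"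
  assumes L: "bounded_linear L" and "smooth \<phi>"
  shows "smooth (\<lambda>x. L (\<phi> x))" and "partial i (\<lambda>x. L (\<phi> x)) = (\<lambda>x. L (partial i \<phi> x))"
proof -
  have deriv: "((\<lambda>x. L (\<phi> x)) has_derivative (\<lambda>v. L (\<Sum>i\<in>UNIV. v $ i *\<^sub>R partial i \<phi> x))) (at x)"
    if "smooth \<phi>" for \<phi> :: "real ^ 'n \<Rightarrow> 'a" and x
    using bounded_linear.has_derivative[OF L smooth_has_derivative[OF that]] .
  have part: "partial i (\<lambda>x. L (\<phi> x)) = (\<lambda>x. L (partial i \<phi> x))" if "smooth \<phi>"
    for \<phi> :: "real ^ 'n \<Rightarrow> 'a" and i
    by (rule ext, subst partial_eqI[OF deriv[OF that]])
      (auto simp: axis_def if_distrib if_distribR cong: if_cong)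
  show "partial i (\<lambda>x. L (\<phi> x)) = (\<lambda>x. L (partial i \<phi> x))"
    using part assms(2) .
  show "smooth (\<lambda>x. L (\<phi> x))"
  proof (rule smooth_coinduct[where F = "{(\<lambda>x. L (\<phi> x)) |\<phi>. smooth \<phi>}"])
    show "(\<lambda>x. L (\<phi> x)) \<in> {(\<lambda>x. L (\<phi> x)) |\<phi>. smooth \<phi>}" using assms(2) by blast
    show "g differentiable_on UNIV" if "g \<in> {(\<lambda>x. L (\<phi> x)) |\<phi>. smooth \<phi>}"
      for g :: "real ^ 'n \<Rightarrow> 'b"
      using that deriv by (auto simp: differentiable_on_def differentiable_def)
    show "partial i g \<in> {(\<lambda>x. L (\<phi> x)) |\<phi>. smooth \<phi>}"
      if "g \<in> {(\<lambda>x. L (\<phi> x)) |\<phi>. smooth \<phi>}"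
      for g :: "real ^ 'n \<Rightarrow> 'b" and i
      using that part smooth_partial by blast
  qed
qed

lemma smooth_affine:
  fixes \<phi> :: "real ^ 'n::finite \<Rightarrow> 'a::real_normed_vector"
  assumes "smooth \<phi>"
  shows "smooth (\<lambda>x. \<phi> (r *\<^sub>R x + a))"
    and "partial i (\<lambda>x. \<phi> (r *\<^sub>R x + a)) = (\<lambda>x. r *\<^sub>R partial i \<phi> (r *\<^sub>R x + a))"
proof -
  \<comment> \<open>Each differentiation brings out one more factor \<open>r\<close>; the scalar
    \<open>c\<close> collects them, which makes the family invariant.\<close>
  have deriv: "((\<lambda>x. c *\<^sub>R \<phi> (r *\<^sub>R x + a)) has_derivative
      (\<lambda>v. c *\<^sub>R (\<Sum>i\<in>UNIV. (r *\<^sub>R v) $ i *\<^sub>R partial i \<phi> (r *\<^sub>R x + a)))) (at x)"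
    if "smooth \<phi>" for \<phi> :: "real ^ 'n \<Rightarrow> 'a" and x c
    by (intro has_derivative_scaleR_right has_derivative_compose[OF _ smooth_has_derivative[OF
        that]])
      (auto intro!: derivative_eq_intros)
  have part: "partial i (\<lambda>x. c *\<^sub>R \<phi> (r *\<^sub>R x + a)) = (\<lambda>x. (c * r) *\<^sub>R partial i \<phi> (r *\<^sub>R x + a))"
    if "smooth \<phi>" for \<phi> :: "real ^ 'n \<Rightarrow> 'a" and i c
    by (rule ext, subst partial_eqI[OF deriv[OF that]])
      (auto simp: axis_def if_distrib if_distribR cong: if_cong)
  show "partial i (\<lambda>x. \<phi> (r *\<^sub>R x + a)) = (\<lambda>x. r *\<^sub>R partial i \<phi> (r *\<^sub>R x + a))"
    using part[OF assms, of i 1] by simp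
  show "smooth (\<lambda>x. \<phi> (r *\<^sub>R x + a))"
  proof (rule smooth_coinduct[where F = "{(\<lambda>x. c *\<^sub>R \<phi> (r *\<^sub>R x + a)) |c \<phi>. smooth \<phi>}"])
    show "(\<lambda>x. \<phi> (r *\<^sub>R x + a)) \<in> {(\<lambda>x. c *\<^sub>R \<phi> (r *\<^sub>R x + a)) |c \<phi>. smooth \<phi>}"
      using assms by (auto intro!: exI[of _ 1])
    show "g differentiable_on UNIV" if "g \<in> {(\<lambda>x. c *\<^sub>R \<phi> (r *\<^sub>R x + a)) |c \<phi>. smooth \<phi>}"
      for g :: "real ^ 'n \<Rightarrow> 'a"
      using that deriv by (fastforce simp: differentiable_on_def differentiable_def)
    show "partial i g \<in> {(\<lambda>x. c *\<^sub>R \<phi> (r *\<^sub>R x + a)) |c \<phi>. smooth \<phi>}"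
      if "g \<in> {(\<lambda>x. c *\<^sub>R \<phi> (r *\<^sub>R x + a)) |c \<phi>. smooth \<phi>}"
      for g :: "real ^ 'n \<Rightarrow> 'a" and i
      using that part smooth_partial by blast
  qed
qed

lemma partial_const: "partial i (\<lambda>x. c) = (\<lambda>x. 0)"
  by (rule ext, subst partial_eqI[OF has_derivative_const]) simp

lemma smooth_const: "smooth (\<lambda>x. c)"
  by (rule smooth_coinduct[where F = "range (\<lambda>c x. c)"]) (auto simp: partial_const)

lemma smooth_component: "smooth (\<lambda>x::real ^ 'n::finite. x $ i)"
proof -
  have deriv: "((\<lambda>x. x $ i) has_derivative (\<lambda>v. v $ i)) (at x)" for x :: "real ^ 'n"
    by (rule bounded_linear_imp_has_derivative[OF bounded_linear_vec_nth])
  have part: "partial j (\<lambda>x. x $ i :: real) = (\<lambda>x. if j = i then 1 else 0)" for j :: 'n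
    by (rule ext, subst partial_eqI[OF deriv]) (auto simp: axis_def)
  show "smooth (\<lambda>x. x $ i :: real)"
  proof (rule smooth_coinduct[where F = "insert (\<lambda>x. x $ i) (range (\<lambda>c x. c))"])
    show "g differentiable_on UNIV" if "g \<in> insert (\<lambda>x. x $ i) (range (\<lambda>c x. c))"
      for g :: "real ^ 'n \<Rightarrow> real"
      using that deriv by (auto simp: differentiable_on_def intro: differentiable_const)
        (auto simp: differentiable_def)
    show "partial j g \<in> insert (\<lambda>x. x $ i) (range (\<lambda>c x. c))"
      if "g \<in> insert (\<lambda>x. x $ i) (range (\<lambda>c x. c))" for g j
      using that by (auto simp: part partial_const)
  qed auto
qed

lemma smooth_diff: "smooth g \<Longrightarrow> smooth h \<Longrightarrow> smooth (\<lambda>x. g x - h x :: real)"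
  using smooth_add[of g "\<lambda>x. -1 * h x"] smooth_mult[of "\<lambda>x. -1" h] smooth_const by auto

lemma smooth_sum:
  "finite A \<Longrightarrow> (\<And>i. i \<in> A \<Longrightarrow> smooth (f i)) \<Longrightarrow> smooth (\<lambda>x. \<Sum>i\<in>A. f i x :: real)"
  by (induction rule: finite_induct) (auto intro: smooth_const smooth_add)

lemma smooth_prod:
  "finite A \<Longrightarrow> (\<And>i. i \<in> A \<Longrightarrow> smooth (f i)) \<Longrightarrow> smooth (\<lambda>x. \<Prod>i\<in>A. f i x :: real)"
  by (induction rule: finite_induct) (auto intro: smooth_const smooth_mult)

lemma partial_sum:
  fixes f :: "'b \<Rightarrow> real ^ 'n::finite \<Rightarrow> 'a::real_normed_vector"
  assumes "\<And>j. j \<in> A \<Longrightarrow> f j differentiable (at x)"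
  shows "partial i (\<lambda>x. \<Sum>j\<in>A. f j x) x = (\<Sum>j\<in>A. partial i (f j) x)"
  by (subst partial_eqI[OF has_derivative_sum[OF has_derivative_partials]])
    (use assms in \<open>auto simp: axis_def if_distrib if_distribR cong: if_cong\<close>)

lemma partial_cmult:
  fixes g :: "real ^ 'n::finite \<Rightarrow> real"
  assumes "smooth g"
  shows "partial i (\<lambda>x. c * g x) = (\<lambda>x. c * partial i g x)"
  using smooth_bounded_linear(2)[OF bounded_linear_mult_right assms] .

section \<open>Derivatives along lines and the symmetry of second derivatives\<close>

lemma smooth_line_derivative:
  fixes \<phi> :: "real ^ 'n::finite \<Rightarrow> real"
  assumes "smooth \<phi>"
  shows "((\<lambda>s. \<phi> (x + s *\<^sub>R v)) has_real_derivative (\<Sum>i\<in>UNIV. v $ i * partial i \<phi> (x + s *\<^sub>R v)))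
    (at s)"
proof -
  have "((\<lambda>s. \<phi> (x + s *\<^sub>R v)) has_derivative
      (\<lambda>t. \<Sum>i\<in>UNIV. (t *\<^sub>R v) $ i *\<^sub>R partial i \<phi> (x + s *\<^sub>R v))) (at s)"
    by (rule has_derivative_compose[OF _ smooth_has_derivative[OF assms]])
      (auto intro!: derivative_eq_intros)
  then show ?thesis
    unfolding has_field_derivative_def
    by (rule has_derivative_eq_rhs) (auto simp: fun_eq_iff sum_distrib_left mult_ac)
qed

lemma smooth_axis_derivative:
  fixes \<phi> :: "real ^ 'n::finite \<Rightarrow> real"
  assumes "smooth \<phi>"
  shows "((\<lambda>s. \<phi> (x + s *\<^sub>R axis i 1)) has_real_derivative partial i \<phi> (x + s *\<^sub>R axis i 1)) (at s)"
  by (rule DERIV_cong[OF smooth_line_derivative[OF assms]])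
    (auto simp: axis_def if_distrib if_distribR cong: if_cong)

text \<open>The mean value theorem twice: in direction \<open>i\<close> for the increment in
  direction \<open>j\<close>, then in direction \<open>j\<close> for the partial derivative so
  obtained. The second difference is symmetric in \<open>i\<close> and \<open>j\<close>; the
  right-hand side is not visibly so.\<close>

lemma second_difference_mvt:
  fixes \<phi> :: "real ^ 'n::finite \<Rightarrow> real"
  assumes "smooth \<phi>" and "h > 0"
  obtains s t where "0 < s" "s < h" "0 < t" "t < h"
    and "\<phi> (x + h *\<^sub>R axis i 1 + h *\<^sub>R axis j 1) - \<phi> (x + h *\<^sub>R axis i 1) - \<phi> (x + h *\<^sub>R axis j
        1) + \<phi> x
      = h * (h * partial j (partial i \<phi>) (x + s *\<^sub>R axis i 1 + t *\<^sub>R axis j 1))"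
proof -
  define q where "q s = \<phi> ((x + h *\<^sub>R axis j 1) + s *\<^sub>R axis i 1) - \<phi> (x + s *\<^sub>R axis i 1)" for s
  have "(q has_real_derivative partial i \<phi> ((x + h *\<^sub>R axis j 1) + s *\<^sub>R axis i 1)
      - partial i \<phi> (x + s *\<^sub>R axis i 1)) (at s)" for s
    unfolding q_def using assms(1) by (intro DERIV_diff smooth_axis_derivative)
  from MVT2[OF \<open>h > 0\<close> this] obtain s where s: "0 < s" "s < h"
    "q h - q 0 = (h - 0) * (partial i \<phi> ((x + h *\<^sub>R axis j 1) + s *\<^sub>R axis i 1)
      - partial i \<phi> (x + s *\<^sub>R axis i 1))" by blast
  define r where "r t = partial i \<phi> ((x + s *\<^sub>R axis i 1) + t *\<^sub>R axis j 1)" for t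
  have "(r has_real_derivative partial j (partial i \<phi>) ((x + s *\<^sub>R axis i 1) + t *\<^sub>R axis j 1))
      (at t)" for t
    unfolding r_def using assms(1) by (intro smooth_axis_derivative smooth_partial)
  from MVT2[OF \<open>h > 0\<close> this] obtain t where t: "0 < t" "t < h"
    "r h - r 0 = (h - 0) * partial j (partial i \<phi>) ((x + s *\<^sub>R axis i 1) + t *\<^sub>R axis j 1)" by blast
  show thesis
  proof (rule that[OF s(1,2) t(1,2)])
    have "\<phi> (x + h *\<^sub>R axis i 1 + h *\<^sub>R axis j 1) - \<phi> (x + h *\<^sub>R axis i 1) - \<phi> (x + h *\<^sub>R axis j
        1) + \<phi> x
      = q h - q 0" by (simp add: q_def algebra_simps)
    also have "\<dots> = h * (r h - r 0)" using s(3) by (simp add: r_def algebra_simps)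
    also have "\<dots> = h * (h * partial j (partial i \<phi>) (x + s *\<^sub>R axis i 1 + t *\<^sub>R axis j 1))"
      using t(3) by simp
    finally show "\<phi> (x + h *\<^sub>R axis i 1 + h *\<^sub>R axis j 1) - \<phi> (x + h *\<^sub>R axis i 1) - \<phi> (x + h *\<^sub>R
        axis j 1) + \<phi> x
      = h * (h * partial j (partial i \<phi>) (x + s *\<^sub>R axis i 1 + t *\<^sub>R axis j 1))" .
  qed
qed

text \<open>Schwarz's theorem: both mixed derivatives, each taken at some point close to
  \<open>x\<close>, equal the same second difference divided by the squared step; continuity then
  compares them at \<open>x\<close>.\<close>

lemma partial_commute:
  fixes \<phi> :: "real ^ 'n::finite \<Rightarrow> real"
  assumes "smooth \<phi>"
  shows "partial i (partial j \<phi>) = partial j (partial i \<phi>)"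
proof (rule ext, rule ccontr)
  fix x
  let ?p = "partial j (partial i \<phi>)" and ?q = "partial i (partial j \<phi>)"
  assume ne: "?q x \<noteq> ?p x"
  \<comment> \<open>Half the gap: a number cannot be closer than this to both mixed derivatives at
    \<open>x\<close>.\<close>
  define \<epsilon> where "\<epsilon> = \<bar>?q x - ?p x\<bar> / 2"
  have "\<epsilon> > 0" using ne by (simp add: \<epsilon>_def)
  have cont: "isCont ?p x" "isCont ?q x"
    by (intro differentiable_imp_continuous_within smooth_differentiable smooth_partial assms)+
  obtain d1 where d1: "d1 > 0" "\<And>y. dist y x < d1 \<Longrightarrow> dist (?p y) (?p x) < \<epsilon>"
    using cont(1) \<open>\<epsilon> > 0\<close> unfolding continuous_at_eps_delta by blast
  obtain d2 where d2: "d2 > 0" "\<And>y. dist y x < d2 \<Longrightarrow> dist (?q y) (?q x) < \<epsilon>"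
    using cont(2) \<open>\<epsilon> > 0\<close> unfolding continuous_at_eps_delta by blast
  \<comment> \<open>Two axis-parallel steps shorter than \<open>h\<close> add up to less than either
    radius.\<close>
  define h where "h = min d1 d2 / 2"
  have "h > 0" using d1 d2 by (simp add: h_def)
  have close: "dist (x + s *\<^sub>R axis i 1 + t *\<^sub>R axis j 1) x < min d1 d2"
    if "0 < s" "s < h" "0 < t" "t < h" for s t and i j :: 'n
  proof -
    have "dist (x + s *\<^sub>R axis i 1 + t *\<^sub>R axis j 1) x \<le> norm (s *\<^sub>R axis i (1::real)) + norm (t
        *\<^sub>R axis j (1::real))"
      unfolding dist_norm by (rule order_trans[OF _ norm_triangle_ineq]) (simp add: algebra_simps)
    also have "\<dots> < min d1 d2" using that by (simp add: h_def)
    finally show ?thesis .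
  qed
  obtain s t where st: "0 < s" "s < h" "0 < t" "t < h"
    "\<phi> (x + h *\<^sub>R axis i 1 + h *\<^sub>R axis j 1) - \<phi> (x + h *\<^sub>R axis i 1) - \<phi> (x + h *\<^sub>R axis j 1) + \<phi> x
      = h * (h * ?p (x + s *\<^sub>R axis i 1 + t *\<^sub>R axis j 1))"
    by (rule second_difference_mvt[OF assms \<open>h > 0\<close>])
  obtain s' t' where st': "0 < s'" "s' < h" "0 < t'" "t' < h"
    "\<phi> (x + h *\<^sub>R axis j 1 + h *\<^sub>R axis i 1) - \<phi> (x + h *\<^sub>R axis j 1) - \<phi> (x + h *\<^sub>R axis i 1) + \<phi> x
      = h * (h * ?q (x + s' *\<^sub>R axis j 1 + t' *\<^sub>R axis i 1))"
    by (rule second_difference_mvt[OF assms \<open>h > 0\<close>])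
  have swap: "x + h *\<^sub>R axis j 1 + h *\<^sub>R axis i 1 = x + h *\<^sub>R axis i 1 + h *\<^sub>R axis j 1"
    by (simp add: algebra_simps)
  have "h * (h * ?p (x + s *\<^sub>R axis i 1 + t *\<^sub>R axis j 1))
      = h * (h * ?q (x + s' *\<^sub>R axis j 1 + t' *\<^sub>R axis i 1))"
    using st(5) st'(5) unfolding swap by linarith
  then have "?p (x + s *\<^sub>R axis i 1 + t *\<^sub>R axis j 1) = ?q (x + s' *\<^sub>R axis j 1 + t' *\<^sub>R axis i 1)"
    using \<open>h > 0\<close> by simp
  moreover have "dist (?p (x + s *\<^sub>R axis i 1 + t *\<^sub>R axis j 1)) (?p x) < \<epsilon>"
    using d1(2) close[OF st(1-4)] by simp
  moreover have "dist (?q (x + s' *\<^sub>R axis j 1 + t' *\<^sub>R axis i 1)) (?q x) < \<epsilon>"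
    using d2(2) close[OF st'(1-4)] by simp
  ultimately show False
    using ne unfolding \<epsilon>_def dist_real_def by argo
qed

section \<open>Test functions\<close>

text \<open>Heine-Borel: the closure of the set of nonzeros is compact as soon as that set is
  bounded. All later support arguments use this form.\<close>

lemma test_functions_iff:
  "\<phi> \<in> test_functions \<longleftrightarrow> smooth \<phi> \<and> (\<exists>R. \<forall>x. \<phi> x \<noteq> 0 \<longrightarrow> norm x \<le> R)"
  unfolding test_functions_def tsupport_def by (auto simp: bounded_iff)

lemma test_functionsI:
  assumes "smooth \<phi>" "\<And>x. \<phi> x \<noteq> 0 \<Longrightarrow> norm x \<le> R"
  shows "\<phi> \<in> test_functions"
  using assms unfolding test_functions_iff by blast

lemma test_functionsE:
  assumes "\<phi> \<in> test_functions"
  obtains R where "\<And>x. \<phi> x \<noteq> 0 \<Longrightarrow> norm x \<le> R"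
  using assms unfolding test_functions_iff by blast

lemma test_functions_smooth: "\<phi> \<in> test_functions \<Longrightarrow> smooth \<phi>"
  by (simp add: test_functions_iff)

lemma partial_zero_outside:
  assumes "closed S" "\<And>x. x \<notin> S \<Longrightarrow> \<phi> x = 0" "x \<notin> S"
  shows "partial i \<phi> x = 0"
proof -
  have "(\<phi> has_derivative (\<lambda>v. 0)) (at x)"
    by (rule has_derivative_transform_within_open[OF has_derivative_const open_Compl[OF assms(1)]])
      (use assms in auto)
  from partial_eqI[OF this] show ?thesis .
qed

lemma test_functions_partial:
  assumes "\<phi> \<in> test_functions"
  shows "partial i \<phi> \<in> test_functions"
proof -
  obtain R where R: "\<And>x. \<phi> x \<noteq> 0 \<Longrightarrow> norm x \<le> R"
    using test_functionsE[OF assms] by blast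
  have "partial i \<phi> x = 0" if "x \<notin> cball 0 R" for x
    by (rule partial_zero_outside[OF closed_cball _ that]) (use R in auto)
  then show ?thesis
    using assms by (intro test_functionsI[where R = R]) (auto intro: smooth_partial
        test_functions_smooth)
qed

lemma test_functions_mult:
  fixes \<phi> \<psi> :: "real ^ 'n::finite \<Rightarrow> real"
  assumes "\<phi> \<in> test_functions" "smooth \<psi>"
  shows "(\<lambda>x. \<phi> x * \<psi> x) \<in> test_functions" "(\<lambda>x. \<psi> x * \<phi> x) \<in> test_functions"
  using assms smooth_mult by (auto simp: test_functions_iff)

lemma test_functions_cmult:
  fixes \<phi> :: "real ^ 'n::finite \<Rightarrow> real"
  assumes "\<phi> \<in> test_functions"
  shows "(\<lambda>x. c * \<phi> x) \<in> test_functions"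
  using assms by (intro test_functions_mult smooth_const)

lemma test_functions_0: "(\<lambda>x. 0) \<in> test_functions"
  by (simp add: test_functions_iff smooth_const)

lemma test_functions_add:
  fixes \<phi> \<psi> :: "real ^ 'n::finite \<Rightarrow> 'a::real_normed_vector"
  assumes "\<phi> \<in> test_functions" "\<psi> \<in> test_functions"
  shows "(\<lambda>x. \<phi> x + \<psi> x) \<in> test_functions"
proof -
  obtain R where R: "\<And>x. \<phi> x \<noteq> 0 \<Longrightarrow> norm x \<le> R"
    using test_functionsE[OF assms(1)] by blast
  obtain R' where R': "\<And>x. \<psi> x \<noteq> 0 \<Longrightarrow> norm x \<le> R'"
    using test_functionsE[OF assms(2)] by blast
  have "norm x \<le> max R R'" if "\<phi> x + \<psi> x \<noteq> 0" for x
    using that R[of x] R'[of x] by (cases "\<phi> x = 0") (auto simp: le_max_iff_disj)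
  moreover have "smooth (\<lambda>x. \<phi> x + \<psi> x)"
    using assms by (intro smooth_add test_functions_smooth)
  ultimately show ?thesis
    by (intro test_functionsI[where R = "max R R'"])
qed

lemma test_functions_diff:
  fixes \<phi> \<psi> :: "real ^ 'n::finite \<Rightarrow> real"
  assumes "\<phi> \<in> test_functions" "\<psi> \<in> test_functions"
  shows "(\<lambda>x. \<phi> x - \<psi> x) \<in> test_functions"
  using test_functions_add[OF assms(1) test_functions_cmult[OF assms(2), of "-1"]] by simp

lemma test_functions_sum:
  fixes f :: "'b \<Rightarrow> real ^ 'n::finite \<Rightarrow> 'a::real_normed_vector"
  shows "finite A \<Longrightarrow> (\<And>i. i \<in> A \<Longrightarrow> f i \<in> test_functions) \<Longrightarrow> (\<lambda>x. \<Sum>i\<in>A. f i x) \<in> test_functions"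
  by (induction rule: finite_induct) (simp_all add: test_functions_0 test_functions_add)

lemma test_functions_affine:
  fixes \<phi> :: "real ^ 'n::finite \<Rightarrow> 'a::real_normed_vector"
  assumes "\<phi> \<in> test_functions" "r \<noteq> 0"
  shows "(\<lambda>x. \<phi> (r *\<^sub>R x + a)) \<in> test_functions"
proof -
  obtain R where R: "\<And>x. \<phi> x \<noteq> 0 \<Longrightarrow> norm x \<le> R"
    using test_functionsE[OF assms(1)] by blast
  show ?thesis
  proof (rule test_functionsI[where R = "(R + norm a) / \<bar>r\<bar>"])
    show "norm x \<le> (R + norm a) / \<bar>r\<bar>" if "\<phi> (r *\<^sub>R x + a) \<noteq> 0" for x
    proof -
      have "norm (r *\<^sub>R x) \<le> norm (r *\<^sub>R x + a) + norm a"
        using norm_triangle_ineq4[of "r *\<^sub>R x + a" a] by simp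
      then show ?thesis using R[OF that] assms(2) by (simp add: field_simps)
    qed
  qed (use assms in \<open>auto intro: smooth_affine test_functions_smooth\<close>)
qed

lemma test_functions_bounded_linear:
  fixes \<phi> :: "real ^ 'n::finite \<Rightarrow> 'a::real_normed_vector" and L :: "'a \<Rightarrow> 'b::real_normed_vector"
  assumes "bounded_linear L" "\<phi> \<in> test_functions"
  shows "(\<lambda>x. L (\<phi> x)) \<in> test_functions"
proof -
  obtain R where R: "\<And>x. \<phi> x \<noteq> 0 \<Longrightarrow> norm x \<le> R"
    using test_functionsE[OF assms(2)] by blast
  have "L 0 = 0" using assms(1) by (simp add: linear_simps)
  then have "norm x \<le> R" if "L (\<phi> x) \<noteq> 0" for x
    using that R[of x] by (cases "\<phi> x = 0") auto
  then show ?thesis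
    by (intro test_functionsI smooth_bounded_linear(1)[OF assms(1) test_functions_smooth[OF
        assms(2)]])
qed

lemma test_functions_bounded:
  fixes \<phi> :: "real ^ 'n::finite \<Rightarrow> 'a::real_normed_vector"
  assumes "\<phi> \<in> test_functions"
  obtains B where "B \<ge> 0" "\<And>x. norm (\<phi> x) \<le> B"
proof -
  obtain R where R: "\<And>x. \<phi> x \<noteq> 0 \<Longrightarrow> norm x \<le> R"
    using test_functionsE[OF assms] by blast
  have "compact (\<phi> ` cball 0 R)"
    by (intro compact_continuous_image smooth_continuous_on test_functions_smooth assms
        compact_cball)
  from compact_imp_bounded[OF this] obtain B where B: "\<And>x. x \<in> cball 0 R \<Longrightarrow> norm (\<phi> x) \<le> B"
    unfolding bounded_iff by blast
  have "norm (\<phi> x) \<le> max B 0" for x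
    using B[of x] R[of x] by (cases "\<phi> x = 0") (auto simp: le_max_iff_disj)
  then show thesis by (intro that[of "max B 0"]) auto
qed

lemma test_functions_borel_measurable [measurable_dest]:
  "\<phi> \<in> test_functions \<Longrightarrow> \<phi> \<in> borel_measurable borel"
  by (intro smooth_borel_measurable test_functions_smooth)

lemma test_functions_integrable:
  fixes \<phi> :: "real ^ 'n::finite \<Rightarrow> 'a::euclidean_space"
  assumes "\<phi> \<in> test_functions"
  shows "integrable lborel \<phi>"
proof -
  obtain R where R: "\<And>x. \<phi> x \<noteq> 0 \<Longrightarrow> norm x \<le> R"
    using test_functionsE[OF assms] by blast
  have "integrable lborel (\<lambda>x. indicator (cball 0 R) x *\<^sub>R \<phi> x)"
    by (intro borel_integrable_compact smooth_continuous_on test_functions_smooth assms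
        compact_cball)
  also have "(\<lambda>x. indicator (cball 0 R) x *\<^sub>R \<phi> x) = \<phi>"
    using R by (force simp: fun_eq_iff indicator_def)
  finally show ?thesis .
qed

section \<open>Uniform Lipschitz and Taylor estimates\<close>

lemma test_functions_lipschitz:
  fixes \<phi> :: "real ^ 'n::finite \<Rightarrow> real"
  assumes "\<phi> \<in> test_functions"
  obtains B where "B \<ge> 0" "\<And>x v. \<bar>\<phi> (x + v) - \<phi> x\<bar> \<le> B * norm v"
proof -
  have "\<exists>B. B \<ge> 0 \<and> (\<forall>x. \<bar>partial i \<phi> x\<bar> \<le> B)" for i
    using test_functions_bounded[OF test_functions_partial[OF assms, of i]] unfolding
        real_norm_def by blast
  then obtain B where "\<forall>i. B i \<ge> 0 \<and> (\<forall>x. \<bar>partial i \<phi> x\<bar> \<le> B i)"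
    using choice[of "\<lambda>i B. B \<ge> 0 \<and> (\<forall>x. \<bar>partial i \<phi> x\<bar> \<le> B)"] by blast
  then have B: "\<And>i. B i \<ge> 0" "\<And>i x. \<bar>partial i \<phi> x\<bar> \<le> B i" by blast+
  show thesis
  proof (rule that[of "\<Sum>i\<in>UNIV. B i"])
    show "0 \<le> (\<Sum>i\<in>UNIV. B i)" using B by (simp add: sum_nonneg)
    fix x v
    obtain s where s: "\<phi> (x + 1 *\<^sub>R v) - \<phi> (x + 0 *\<^sub>R v)
        = (1 - 0) * (\<Sum>i\<in>UNIV. v $ i * partial i \<phi> (x + s *\<^sub>R v))"
      using MVT2[OF zero_less_one smooth_line_derivative[OF test_functions_smooth[OF assms], of x
          v]]
      by blast
    have "\<bar>\<phi> (x + v) - \<phi> x\<bar> \<le> (\<Sum>i\<in>UNIV. \<bar>v $ i * partial i \<phi> (x + s *\<^sub>R v)\<bar>)"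
      using s by (simp add: sum_abs)
    also have "\<dots> \<le> (\<Sum>i\<in>UNIV. norm v * B i)"
      unfolding abs_mult by (intro sum_mono mult_mono B component_le_norm_cart) auto
    finally show "\<bar>\<phi> (x + v) - \<phi> x\<bar> \<le> (\<Sum>i\<in>UNIV. B i) * norm v"
      by (simp add: sum_distrib_left mult.commute)
  qed
qed

text \<open>The mean value theorem along the segment, then the Lipschitz bound for each partial
  derivative. The constant is uniform in \<open>x\<close>, so the remainder can be integrated over
  translates, as \<open>superpose_derivative\<close> does.\<close>

lemma test_functions_taylor:
  fixes \<phi> :: "real ^ 'n::finite \<Rightarrow> real"
  assumes "\<phi> \<in> test_functions"
  obtains B where "B \<ge> 0"
    "\<And>x v. \<bar>\<phi> (x + v) - \<phi> x - (\<Sum>i\<in>UNIV. v $ i * partial i \<phi> x)\<bar> \<le> B * (norm v)\<^sup>2"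
proof -
  have "\<exists>B. B \<ge> 0 \<and> (\<forall>x v. \<bar>partial i \<phi> (x + v) - partial i \<phi> x\<bar> \<le> B * norm v)" for i
    by (rule test_functions_lipschitz[OF test_functions_partial[OF assms, of i]]) blast
  then obtain B where
    "\<forall>i. B i \<ge> 0 \<and> (\<forall>x v. \<bar>partial i \<phi> (x + v) - partial i \<phi> x\<bar> \<le> B i * norm v)"
    using choice[of "\<lambda>i B. B \<ge> 0 \<and>
      (\<forall>x v. \<bar>partial i \<phi> (x + v) - partial i \<phi> x\<bar> \<le> B * norm v)"] by blast
  then have B: "\<And>i. B i \<ge> 0"
    "\<And>i x v. \<bar>partial i \<phi> (x + v) - partial i \<phi> x\<bar> \<le> B i * norm v" by blast+
  show thesis
  proof (rule that[of "\<Sum>i\<in>UNIV. B i"])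
    show "0 \<le> (\<Sum>i\<in>UNIV. B i)" using B by (simp add: sum_nonneg)
    fix x v
    obtain s where s: "0 < s" "s < 1" "\<phi> (x + 1 *\<^sub>R v) - \<phi> (x + 0 *\<^sub>R v)
        = (1 - 0) * (\<Sum>i\<in>UNIV. v $ i * partial i \<phi> (x + s *\<^sub>R v))"
      using MVT2[OF zero_less_one smooth_line_derivative[OF test_functions_smooth[OF assms], of x
          v]]
      by blast
    have "\<phi> (x + v) - \<phi> x - (\<Sum>i\<in>UNIV. v $ i * partial i \<phi> x)
        = (\<Sum>i\<in>UNIV. v $ i * (partial i \<phi> (x + s *\<^sub>R v) - partial i \<phi> x))"
      using s by (simp add: sum_subtractf algebra_simps)
    also have "\<bar>\<dots>\<bar> \<le> (\<Sum>i\<in>UNIV. \<bar>v $ i * (partial i \<phi> (x + s *\<^sub>R v) - partial i \<phi> x)\<bar>)"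
      by (rule sum_abs)
    also have "\<dots> \<le> (\<Sum>i\<in>UNIV. norm v * (B i * norm v))"
      unfolding abs_mult
    proof (intro sum_mono mult_mono component_le_norm_cart)
      fix i
      have "\<bar>partial i \<phi> (x + s *\<^sub>R v) - partial i \<phi> x\<bar> \<le> B i * norm (s *\<^sub>R v)" by (rule B)
      also have "\<dots> \<le> B i * norm v"
        using s B(1)[of i] by (intro mult_left_mono) (auto simp: mult_left_le_one_le)
      finally show "\<bar>partial i \<phi> (x + s *\<^sub>R v) - partial i \<phi> x\<bar> \<le> B i * norm v" .
    qed auto
    finally show "\<bar>\<phi> (x + v) - \<phi> x - (\<Sum>i\<in>UNIV. v $ i * partial i \<phi> x)\<bar> \<le> (\<Sum>i\<in>UNIV. B i) * (norm
        v)\<^sup>2"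
      by (simp add: sum_distrib_left mult_ac power2_eq_square)
  qed
qed

section \<open>Bump functions\<close>

text \<open>\<open>flat 0\<close> is the usual smooth function that is not analytic at 0; its derivatives are linear
  combinations of the functions \<open>flat k\<close>.\<close>

definition flat :: "nat \<Rightarrow> real \<Rightarrow> real" where
  "flat k s = (if s > 0 then exp (- 1 / s) / s ^ k else 0)"

lemma flat_nonneg: "flat k s \<ge> 0"
  by (simp add: flat_def)

lemma power_div_fact_le_exp:
  fixes y :: real
  assumes "y \<ge> 0"
  shows "y ^ m / fact m \<le> exp y"
proof -
  have "(\<Sum>n\<in>{m}. inverse (fact n) * y ^ n) \<le> (\<Sum>n. inverse (fact n) * y ^ n)"
    by (rule sum_le_suminf) (use assms summable_exp[of y] in auto)
  then show ?thesis
    by (simp add: exp_def divide_inverse mult.commute)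
qed

text \<open>The term of order \<open>k + 2\<close> of the exponential series at \<open>1 / s\<close>
  bounds \<open>exp (1 / s)\<close> from below. The two extra powers leave the factor
  \<open>s\<^sup>2\<close>, which makes the difference quotient of \<open>flat k\<close> at 0 tend
  to 0.\<close>

lemma flat_le_square: "flat k s \<le> fact (k + 2) * s\<^sup>2"
proof (cases "s > 0")
  case True
  have "(1 / s) ^ (k + 2) / fact (k + 2) \<le> exp (1 / s)"
    using True by (intro power_div_fact_le_exp) auto
  then have "exp (- (1 / s)) \<le> fact (k + 2) * s ^ (k + 2)"
    using True by (simp add: exp_minus field_simps del: fact_Suc)
  then show ?thesis
    using True by (simp add: flat_def field_simps power_add power2_eq_square del: fact_Suc)
qed (simp add: flat_def)

lemma flat_derivative:
  "(flat k has_real_derivative flat (k + 2) s - real k * flat (k + 1) s) (at s)"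
proof -
  consider "s > 0" | "s < 0" | "s = 0" by linarith
  then show ?thesis
  proof cases
    case 1
    have "((\<lambda>s. exp (- inverse s) * inverse s ^ k) has_real_derivative
        exp (- inverse s) * inverse s ^ 2 * inverse s ^ k
        + real k * (inverse s ^ (k - 1) * - (inverse s ^ 2)) * exp (- inverse s)) (at s)"
      using 1 by (auto intro!: derivative_eq_intros simp: power2_eq_square)
    also have "exp (- inverse s) * inverse s ^ 2 * inverse s ^ k
        + real k * (inverse s ^ (k - 1) * - (inverse s ^ 2)) * exp (- inverse s)
        = flat (k + 2) s - real k * flat (k + 1) s"
      using 1 by (cases k) (simp_all add: flat_def power2_eq_square divide_inverse power_inverse
          algebra_simps)
    finally have "((\<lambda>s. exp (- 1 / s) / s ^ k) has_real_derivative
        flat (k + 2) s - real k * flat (k + 1) s) (at s)"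
      by (simp add: divide_inverse power_inverse)
    then show ?thesis
      by (rule has_field_derivative_transform_within_open[where S = "{0<..}"])
        (use 1 in \<open>auto simp: flat_def\<close>)
  next
    case 2
    have "((\<lambda>s. 0) has_real_derivative flat (k + 2) s - real k * flat (k + 1) s) (at s)"
      using 2 by (simp add: flat_def)
    then show ?thesis
      by (rule has_field_derivative_transform_within_open[where S = "{..<0}"])
        (use 2 in \<open>auto simp: flat_def\<close>)
  next
    case 3
    have "(\<lambda>h. flat k h / h) \<midarrow>0\<rightarrow> 0"
    proof (rule Lim_null_comparison[where g = "\<lambda>h. fact (k + 2) * \<bar>h\<bar>"])
      show "\<forall>\<^sub>F h in at 0. norm (flat k h / h) \<le> fact (k + 2) * \<bar>h\<bar>"
      proof (rule eventually_at_filter[THEN iffD2], rule always_eventually, intro allI impI)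
        fix h :: real assume "h \<noteq> 0"
        then show "norm (flat k h / h) \<le> fact (k + 2) * \<bar>h\<bar>"
          using flat_le_square[of k h] flat_nonneg[of k h]
          by (simp add: field_simps power2_eq_square abs_mult[symmetric] del: fact_Suc)
      qed
      show "((\<lambda>h::real. fact (k + 2) * \<bar>h\<bar>) \<longlongrightarrow> 0) (at 0)"
        by (auto intro!: tendsto_eq_intros simp del: fact_Suc)
    qed
    then show ?thesis using 3 by (simp add: DERIV_def flat_def)
  qed
qed

lemma flat_compose_derivative:
  fixes p :: "real ^ 'n::finite \<Rightarrow> real"
  assumes "smooth p"
  shows "((\<lambda>x. flat k (p x)) has_derivative
    (\<lambda>v. (\<Sum>i\<in>UNIV. v $ i * partial i p x) * (flat (k + 2) (p x) - real k * flat (k + 1) (p x))))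
        (at x)"
  using has_derivative_compose[OF smooth_has_derivative[OF assms, of x]
      flat_derivative[unfolded has_field_derivative_def, of k "p x"]]
  by (simp add: mult.commute)

lemma partial_flat_compose:
  fixes p :: "real ^ 'n::finite \<Rightarrow> real"
  assumes "smooth p"
  shows "partial i (\<lambda>x. flat k (p x)) =
    (\<lambda>x. partial i p x * (flat (k + 2) (p x) - real k * flat (k + 1) (p x)))"
  by (rule ext, subst partial_eqI[OF flat_compose_derivative[OF assms]])
    (auto simp: axis_def if_distrib if_distribR cong: if_cong)

lemma smooth_flat_compose:
  fixes p :: "real ^ 'n::finite \<Rightarrow> real"
  assumes "smooth p"
  shows "smooth (\<lambda>x. flat k (p x))"
proof (rule smooth_ring_smooth[where G = "range (\<lambda>k x. flat k (p x))"])
  show "(\<lambda>x. flat k (p x)) \<in> smooth_ring (range (\<lambda>k x. flat k (p x)))"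
    by (auto intro: smooth_ring.generator)
  fix g assume g: "g \<in> range (\<lambda>k x. flat k (p x))"
  then obtain k where k: "g = (\<lambda>x. flat k (p x))" by blast
  show "g differentiable_on UNIV"
    using flat_compose_derivative[OF assms] unfolding k differentiable_on_def differentiable_def
        by blast
  have eq: "partial i g = (\<lambda>x. partial i p x * (flat (k + 2) (p x) + (- real k) * flat (k + 1) (p
      x)))" for i
    unfolding k partial_flat_compose[OF assms] by simp
  have gen: "(\<lambda>x. flat k (p x)) \<in> smooth_ring (range (\<lambda>k x. flat k (p x)))" for k
    by (auto intro: smooth_ring.generator)
  show "partial i g \<in> smooth_ring (range (\<lambda>k x. flat k (p x)))" for i
    unfolding eq
    by (intro smooth_ring.mult smooth_ring.add gen smooth_ring.smooth[OF smooth_const]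
        smooth_ring.smooth[OF smooth_partial[OF assms]])
qed

text \<open>With integral zero, \<phi> would vanish almost everywhere, yet the open set where it is
  positive contains \<open>x0\<close> and so is not negligible.\<close>

lemma test_functions_integral_pos:
  fixes \<phi> :: "real ^ 'n::finite \<Rightarrow> real"
  assumes "\<phi> \<in> test_functions" "\<And>x. \<phi> x \<ge> 0" "\<phi> x0 > 0"
  shows "(LBINT x. \<phi> x) > 0"
proof -
  have "(LBINT x. \<phi> x) \<noteq> 0"
  proof
    assume "(LBINT x. \<phi> x) = 0"
    then have ae: "AE x in lborel. \<phi> x = 0"
      using integral_nonneg_eq_0_iff_AE[OF test_functions_integrable[OF assms(1)]] assms(2) by simp
    let ?U = "{x. \<phi> x > 0}"
    have "continuous_on UNIV \<phi>"
      by (intro smooth_continuous_on test_functions_smooth assms(1))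
    then have op: "open ?U"
      by (intro open_Collect_less continuous_on_const)
    have "AE x in lborel. x \<notin> ?U"
      using ae by eventually_elim auto
    then have "emeasure lborel ?U = 0"
      using op by (subst (asm) AE_iff_measurable[where N = ?U]) (auto intro: borel_open)
    then have "?U \<in> null_sets lborel"
      using op by (auto intro: borel_open)
    then have "negligible ?U"
      using negligible_iff_null_sets null_sets_completionI by blast
    then show False
      using open_not_negligible[OF op] assms(3) by blast
  qed
  moreover have "(LBINT x. \<phi> x) \<ge> 0"
    using assms(2) by (simp add: integral_nonneg)
  ultimately show ?thesis by linarith
qed

text \<open>The pair is chosen such that \<open>\<nabla>ball_bump x = - x \<cdot> mollifier x\<close>.\<close>

definition ball_bump :: "real ^ 'n::finite \<Rightarrow> real" where
  "ball_bump x = flat 0 (1 - x \<bullet> x)"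

definition mollifier :: "real ^ 'n::finite \<Rightarrow> real" where
  "mollifier x = 2 * flat 2 (1 - x \<bullet> x)"

lemma smooth_inner_self: "smooth (\<lambda>x::real ^ 'n::finite. 1 - x \<bullet> x)"
proof -
  have "smooth (\<lambda>x::real ^ 'n. 1 - (\<Sum>i\<in>UNIV. x $ i * x $ i))"
    by (intro smooth_diff smooth_const smooth_sum smooth_mult smooth_component) auto
  then show ?thesis by (simp add: inner_vec_def)
qed

lemma partial_inner_self: "partial i (\<lambda>x::real ^ 'n::finite. 1 - x \<bullet> x) = (\<lambda>x. - 2 * x $ i)"
proof
  fix x :: "real ^ 'n"
  have "((\<lambda>x. 1 - x \<bullet> x) has_derivative (\<lambda>v. - 2 * (x \<bullet> v))) (at x)"
    by (auto intro!: derivative_eq_intros simp: inner_commute)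
  from partial_eqI[OF this] show "partial i (\<lambda>x. 1 - x \<bullet> x) x = - 2 * x $ i"
    by (simp add: inner_axis)
qed

lemma flat_inner_self_nz: "flat k (1 - x \<bullet> x) \<noteq> 0 \<Longrightarrow> norm x \<le> 1"
  by (simp add: flat_def norm_le_square split: if_splits)

lemma ball_bump_test: "ball_bump \<in> test_functions"
  unfolding ball_bump_def[abs_def]
  by (intro test_functionsI[where R = 1] smooth_flat_compose[OF smooth_inner_self]
      flat_inner_self_nz)

lemma mollifier_test: "mollifier \<in> test_functions"
  unfolding mollifier_def[abs_def]
  by (intro test_functions_cmult test_functionsI[where R = 1] smooth_flat_compose[OF
      smooth_inner_self]
      flat_inner_self_nz)

lemma mollifier_nonneg: "mollifier x \<ge> 0"
  by (simp add: mollifier_def flat_nonneg)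

lemma ball_bump_support: "ball_bump x \<noteq> 0 \<Longrightarrow> norm x \<le> 1"
  unfolding ball_bump_def by (rule flat_inner_self_nz)

lemma mollifier_support: "mollifier x \<noteq> 0 \<Longrightarrow> norm x \<le> 1"
  unfolding mollifier_def by (rule flat_inner_self_nz[of 2]) simp

text \<open>The derivative of \<open>flat 0\<close> is \<open>flat 2\<close> and the inner function
  contributes \<open>- 2 * x $ i\<close>; hence the form of \<open>mollifier\<close>. In
  \<open>laplacian_parametrix\<close>, an integration by parts replaces the bump by the mollifier
  times a coordinate through this identity.\<close>

lemma partial_ball_bump: "partial i ball_bump x = - x $ i * mollifier x"
  unfolding ball_bump_def[abs_def] partial_flat_compose[OF smooth_inner_self] partial_inner_self
  by (simp add: mollifier_def numeral_2_eq_2)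

lemma mollifier_integral_pos: "(\<integral>x. mollifier x \<partial>(lborel :: (real ^ 'n::finite) measure)) > 0"
  by (rule test_functions_integral_pos[OF mollifier_test mollifier_nonneg, of 0])
    (simp add: mollifier_def flat_def)

text \<open>The parameter \<open>r\<close> only sharpens the edges: as it grows, every factor tends
  to 1 inside the box, while outside some factor is always 0. Indicators of open boxes thus become
  bounded pointwise limits of test functions that vanish outside the same box.\<close>

definition box_bump :: "real ^ 'n::finite \<Rightarrow> real ^ 'n \<Rightarrow> real \<Rightarrow> real ^ 'n \<Rightarrow> real" where
  "box_bump a b r x = (\<Prod>i\<in>UNIV. flat 0 (r * (x $ i - a $ i)) * flat 0 (r * (b $ i - x $ i)))"

lemma flat_0_le_1: "flat 0 s \<le> 1"
  by (simp add: flat_def)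

lemma box_bump_nonneg: "box_bump a b r x \<ge> 0"
  by (simp add: box_bump_def prod_nonneg flat_nonneg)

lemma box_bump_le_1: "box_bump a b r x \<le> 1"
  unfolding box_bump_def
  by (intro prod_le_1 conjI mult_le_one mult_nonneg_nonneg flat_nonneg flat_0_le_1)

lemma box_bump_pos_iff:
  assumes "r > 0"
  shows "box_bump a b r x > 0 \<longleftrightarrow> x \<in> box a b"
proof -
  have *: "flat 0 (r * s) \<noteq> 0 \<longleftrightarrow> s > 0" for s
    using assms by (auto simp: flat_def zero_less_mult_iff)
  have "box_bump a b r x > 0 \<longleftrightarrow> box_bump a b r x \<noteq> 0"
    using box_bump_nonneg[of a b r x] by auto
  also have "\<dots> \<longleftrightarrow> x \<in> box a b"
    unfolding box_bump_def prod_zero_iff[OF finite_class.finite_UNIV] mem_box_cart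
    using * by (simp add: ball_conj_distrib)
  finally show ?thesis .
qed

lemma box_bump_zero: "r > 0 \<Longrightarrow> x \<notin> box a b \<Longrightarrow> box_bump a b r x = 0"
  using box_bump_pos_iff[of r a b x] box_bump_nonneg[of a b r x] by linarith

lemma box_bump_test:
  assumes "r > 0"
  shows "box_bump a b r \<in> test_functions"
proof -
  obtain R where R: "\<And>x. x \<in> box a b \<Longrightarrow> norm x \<le> R"
    using bounded_box[of a b] unfolding bounded_iff by blast
  have "smooth (box_bump a b r)"
    unfolding box_bump_def[abs_def]
    by (intro smooth_prod smooth_mult smooth_flat_compose smooth_diff smooth_const
        smooth_component) auto
  then show ?thesis
    by (rule test_functionsI[where R = R]) (use R box_bump_zero[OF assms] in blast)
qed

lemma box_bump_tendsto: "(\<lambda>n. box_bump a b (real (Suc n)) x) \<longlonglongrightarrow> indicator (box a b) x"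
proof (cases "x \<in> box a b")
  case True
  have lim: "(\<lambda>n. flat 0 (real (Suc n) * s)) \<longlonglongrightarrow> 1" if "s > 0" for s
  proof -
    have "(\<lambda>n. exp (- (1 / s) * inverse (real (Suc n)))) \<longlonglongrightarrow> exp (- (1 / s) * 0)"
      by (intro tendsto_intros LIMSEQ_inverse_real_of_nat)
    also have "(\<lambda>n. exp (- (1 / s) * inverse (real (Suc n)))) = (\<lambda>n. flat 0 (real (Suc n) * s))"
      using that by (auto simp: flat_def fun_eq_iff field_simps intro: add_pos_nonneg)
    finally show ?thesis by simp
  qed
  have "(\<lambda>n. box_bump a b (real (Suc n)) x) \<longlonglongrightarrow> (\<Prod>i\<in>(UNIV::'a set). 1 * 1)"
    unfolding box_bump_def
    by (intro tendsto_prod tendsto_mult lim) (use True in \<open>auto simp: mem_box_cart\<close>)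
  then show ?thesis using True by simp
next
  case False
  then show ?thesis by (simp add: box_bump_zero)
qed

section \<open>Integration by parts and averaged translates\<close>

lemma integral_translate:
  fixes f :: "'a::euclidean_space \<Rightarrow> real"
  assumes [measurable]: "f \<in> borel_measurable borel"
  shows "(LBINT x. f (a + x)) = (LBINT x. f x)"
proof -
  have "(LBINT x. f x) = (\<integral>x. f x \<partial>(distr lborel borel ((+) a)))"
    by (simp add: lborel_distr_plus)
  also have "\<dots> = (LBINT x. f (a + x))"
    by (rule integral_distr) auto
  finally show ?thesis by simp
qed

text \<open>The difference quotients have integral 0 by translation invariance of Lebesgue measure,
  and dominated convergence passes to their limit.\<close>

lemma integral_partial_eq_0:
  fixes \<phi> :: "real ^ 'n::finite \<Rightarrow> real"
  assumes \<phi>: "\<phi> \<in> test_functions"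
  shows "(LBINT x. partial i \<phi> x) = 0"
proof -
  obtain R where R: "\<And>x. \<phi> x \<noteq> 0 \<Longrightarrow> norm x \<le> R"
    using test_functionsE[OF \<phi>] by blast
  obtain B where B: "B \<ge> 0" "\<And>x v. \<bar>\<phi> (x + v) - \<phi> x\<bar> \<le> B * norm v"
    by (rule test_functions_lipschitz[OF \<phi>]) blast
  define s where "s n x = real (Suc n) * (\<phi> (inverse (real (Suc n)) *\<^sub>R axis i 1 + x) - \<phi> x)" for
      n x
  have [measurable]: "\<phi> \<in> borel_measurable borel" "partial i \<phi> \<in> borel_measurable borel"
    using test_functions_borel_measurable \<phi> test_functions_partial by blast+
  have int: "integrable lborel (\<lambda>x. \<phi> (a + x))" for a
    using test_functions_integrable[OF test_functions_affine[OF \<phi>, of 1 a]] by (simp add: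
        add.commute)
  have "(\<lambda>n. LBINT x. s n x) \<longlonglongrightarrow> (LBINT x. partial i \<phi> x)"
  \<comment> \<open>\<open>B\<close> is a Lipschitz constant of \<open>\<phi>\<close>; the steps
    have length at most 1, so all quotients vanish outside the support ball enlarged by 1.\<close>
  proof (rule integral_dominated_convergence[where w = "\<lambda>x. indicator (cball 0 (\<bar>R\<bar> + 1)) x *\<^sub>R B"])
    show "integrable lborel (\<lambda>x::real ^ 'n. indicator (cball 0 (\<bar>R\<bar> + 1)) x *\<^sub>R B)"
      by (intro borel_integrable_compact) auto
    show "AE x in lborel. (\<lambda>n. s n x) \<longlonglongrightarrow> partial i \<phi> x"
    proof (rule AE_I2)
      fix x
      have "(\<lambda>h. (\<phi> (x + (0 + h) *\<^sub>R axis i 1) - \<phi> (x + 0 *\<^sub>R axis i 1)) / h) \<midarrow>0\<rightarrow> partial i \<phi> (x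
          + 0 *\<^sub>R axis i 1)"
        using smooth_axis_derivative[OF test_functions_smooth[OF \<phi>], of x i 0] unfolding DERIV_def .
      moreover have "filterlim (\<lambda>n. inverse (real (Suc n))) (at 0) sequentially"
        unfolding filterlim_at using LIMSEQ_inverse_real_of_nat by auto
      ultimately have "(\<lambda>n. (\<phi> (x + (0 + inverse (real (Suc n))) *\<^sub>R axis i 1) - \<phi> (x + 0 *\<^sub>R
          axis i 1))
          / inverse (real (Suc n))) \<longlonglongrightarrow> partial i \<phi> (x + 0 *\<^sub>R axis i 1)"
        by (rule filterlim_compose)
      then show "(\<lambda>n. s n x) \<longlonglongrightarrow> partial i \<phi> x"
        by (simp add: s_def add.commute field_simps)
    qed
    show "AE x in lborel. norm (s n x) \<le> indicator (cball 0 (\<bar>R\<bar> + 1)) x *\<^sub>R B" for n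
    proof (rule AE_I2)
      fix x
      let ?v = "inverse (real (Suc n)) *\<^sub>R axis i (1::real)"
      have nv: "norm ?v = inverse (real (Suc n))" by simp
      show "norm (s n x) \<le> indicator (cball 0 (\<bar>R\<bar> + 1)) x *\<^sub>R B"
      proof (cases "x \<in> cball 0 (\<bar>R\<bar> + 1)")
        case True
        have "\<bar>s n x\<bar> \<le> real (Suc n) * (B * norm ?v)"
          unfolding s_def abs_mult using B(2)[of x ?v]
          by (intro mult_mono) (auto simp: add.commute)
        also have "real (Suc n) * (B * norm ?v) = B" unfolding nv by (simp add: field_simps)
        finally show ?thesis using True by simp
      next
        case False
        have "norm x \<le> norm (?v + x) + norm ?v"
          using norm_triangle_ineq4[of "?v + x" ?v] by simp
        moreover have "norm ?v \<le> 1" unfolding nv by (simp add: field_simps)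
        ultimately have "norm (?v + x) > R" "norm x > R"
          using False by (auto simp: not_le)
        then have "\<phi> (?v + x) = 0" "\<phi> x = 0" using R by (meson not_le)+
        then show ?thesis using B by (simp add: s_def)
      qed
    qed
  qed (auto simp: s_def)
  moreover have "(LBINT x. s n x) = 0" for n
    unfolding s_def using int[of 0] int by (simp add: integral_translate)
  ultimately show ?thesis
    using LIMSEQ_unique[OF _ tendsto_const] by simp
qed

lemma integral_by_parts:
  fixes \<phi> \<psi> :: "real ^ 'n::finite \<Rightarrow> real"
  assumes "\<phi> \<in> test_functions" "smooth \<psi>"
  shows "(LBINT x. partial i \<phi> x * \<psi> x) = - (LBINT x. \<phi> x * partial i \<psi> x)"
proof -
  have "partial i (\<lambda>x. \<phi> x * \<psi> x) = (\<lambda>x. \<phi> x * partial i \<psi> x + partial i \<phi> x * \<psi> x)"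
    by (rule ext, rule partial_mult)
      (use assms in \<open>auto intro: smooth_differentiable test_functions_smooth\<close>)
  then have "(LBINT x. \<phi> x * partial i \<psi> x + partial i \<phi> x * \<psi> x) = 0"
    using integral_partial_eq_0[OF test_functions_mult(1)[OF assms], of i] by simp
  moreover have "integrable lborel (\<lambda>x. \<phi> x * partial i \<psi> x)"
    by (intro test_functions_integrable test_functions_mult(1) assms smooth_partial)
  moreover have "integrable lborel (\<lambda>x. partial i \<phi> x * \<psi> x)"
    by (intro test_functions_integrable test_functions_mult(1) assms test_functions_partial)
  ultimately show ?thesis by simp
qed

text \<open>A convolution of \<open>\<phi>\<close> with the image under \<open>h\<close> of the
  signed measure of density \<open>w\<close>. The parameter space is kept abstract so that
  differentiation, supports and the L1 bound are settled once for the mollification, the parametrix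
  and the divergence form in \<open>low_frequency_bound\<close>.\<close>

definition superpose ::
  "'b measure \<Rightarrow> ('b \<Rightarrow> real) \<Rightarrow> ('b \<Rightarrow> real ^ 'n::finite) \<Rightarrow> (real ^ 'n \<Rightarrow> real) \<Rightarrow> real ^ 'n \<Rightarrow> real"
      where
  "superpose M w h \<phi> x = (\<integral>\<omega>. w \<omega> * \<phi> (x - h \<omega>) \<partial>M)"

lemma superpose_integrable:
  fixes w :: "'b \<Rightarrow> real" and h :: "'b \<Rightarrow> real ^ 'n::finite"
  assumes w: "integrable M w" and h[measurable]: "h \<in> borel_measurable M"
    and \<phi>: "\<phi> \<in> test_functions"
  shows "integrable M (\<lambda>\<omega>. w \<omega> * \<phi> (x - h \<omega>))"
proof -
  obtain B where B: "\<And>x. norm (\<phi> x) \<le> B"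
    by (rule test_functions_bounded[OF \<phi>]) blast
  have [measurable]: "\<phi> \<in> borel_measurable borel" "w \<in> borel_measurable M"
    using test_functions_borel_measurable \<phi> w by auto
  show ?thesis
  proof (rule Bochner_Integration.integrable_bound[where f = "\<lambda>\<omega>. w \<omega> * B"])
    show "AE \<omega> in M. norm (w \<omega> * \<phi> (x - h \<omega>)) \<le> norm (w \<omega> * B)"
    proof (rule AE_I2)
      fix \<omega>
      have "\<bar>\<phi> (x - h \<omega>)\<bar> \<le> \<bar>B\<bar>" using B[of "x - h \<omega>"] by simp
      then show "norm (w \<omega> * \<phi> (x - h \<omega>)) \<le> norm (w \<omega> * B)"
        unfolding real_norm_def abs_mult by (rule mult_left_mono) simp
    qed
  qed (use w in auto)
qed

text \<open>All derivatives fall on \<open>\<phi>\<close>. Its Taylor remainder is quadratic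
  uniformly in the base point, so integrating it against \<open>w\<close> leaves at most
  \<open>W * B\<close> times the squared increment, without a limit theorem.\<close>

lemma superpose_derivative:
  assumes w: "integrable M w" and h: "h \<in> borel_measurable M" and \<phi>: "\<phi> \<in> test_functions"
  shows "(superpose M w h \<phi> has_derivative (\<lambda>v. \<Sum>i\<in>UNIV. v $ i * superpose M w h (partial i \<phi>)
      x)) (at x)"
proof -
  obtain B where B: "B \<ge> 0"
    "\<And>x v. \<bar>\<phi> (x + v) - \<phi> x - (\<Sum>i\<in>UNIV. v $ i * partial i \<phi> x)\<bar> \<le> B * (norm v)\<^sup>2"
    by (rule test_functions_taylor[OF \<phi>]) blast
  define W where "W = (\<integral>\<omega>. \<bar>w \<omega>\<bar> \<partial>M)"
  have int: "integrable M (\<lambda>\<omega>. w \<omega> * \<psi> (x - h \<omega>))" if "\<psi> \<in> test_functions" for \<psi> x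
    by (rule superpose_integrable[OF w h that])
  note int' = int[OF \<phi>] int[OF test_functions_partial[OF \<phi>]]
  show ?thesis
  proof (rule has_derivativeI_sandwich[where e = 1 and H = "\<lambda>y. W * B * norm (y - x)"])
    show "bounded_linear (\<lambda>v. \<Sum>i\<in>UNIV. v $ i * superpose M w h (partial i \<phi>) x)"
      by (intro bounded_linear_sum bounded_linear_mult_const bounded_linear_vec_nth)
    show "((\<lambda>y. W * B * norm (y - x)) \<longlongrightarrow> 0) (at x)"
      by (auto intro!: tendsto_eq_intros)
    fix y assume y: "y \<noteq> x"
    have eq: "superpose M w h \<phi> y - superpose M w h \<phi> x - (\<Sum>i\<in>UNIV. (y - x) $ i * superpose M w h
        (partial i \<phi>) x)
      = (\<integral>\<omega>. w \<omega> * \<phi> (y - h \<omega>) - w \<omega> * \<phi> (x - h \<omega>)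
        - (\<Sum>i\<in>UNIV. (y - x) $ i * (w \<omega> * partial i \<phi> (x - h \<omega>))) \<partial>M)"
      unfolding superpose_def using int' by (simp del: vector_minus_component)
    also have "\<dots> = (\<integral>\<omega>. w \<omega> * (\<phi> ((x - h \<omega>) + (y - x)) - \<phi> (x - h \<omega>)
        - (\<Sum>i\<in>UNIV. (y - x) $ i * partial i \<phi> (x - h \<omega>))) \<partial>M)"
      by (rule Bochner_Integration.integral_cong) (auto simp: algebra_simps sum_distrib_left
          sum_subtractf)
    finally have eq: "superpose M w h \<phi> y - superpose M w h \<phi> x - (\<Sum>i\<in>UNIV. (y - x) $ i *
        superpose M w h (partial i \<phi>) x)
      = \<dots>" .
    have "norm \<dots> \<le> (\<integral>\<omega>. \<bar>w \<omega>\<bar> * (B * (norm (y - x))\<^sup>2) \<partial>M)"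
    proof (rule order_trans[OF integral_norm_bound integral_mono])
      show "integrable M (\<lambda>\<omega>. norm (w \<omega> * (\<phi> (x - h \<omega> + (y - x)) - \<phi> (x - h \<omega>)
          - (\<Sum>i\<in>UNIV. (y - x) $ i * partial i \<phi> (x - h \<omega>)))))"
      proof -
        have "integrable M (\<lambda>\<omega>. w \<omega> * \<phi> (y - h \<omega>) - w \<omega> * \<phi> (x - h \<omega>)
          - (\<Sum>i\<in>UNIV. (y - x) $ i * (w \<omega> * partial i \<phi> (x - h \<omega>))))"
          using int' by simp
        then show ?thesis
          by (intro integrable_norm, elim Bochner_Integration.integrable_cong[THEN iffD1, rotated
              2])
            (auto simp: algebra_simps sum_distrib_left sum_subtractf)
      qed
      show "integrable M (\<lambda>\<omega>. \<bar>w \<omega>\<bar> * (B * (norm (y - x))\<^sup>2))" using w by simp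
    qed (unfold real_norm_def abs_mult, intro mult_left_mono B, simp)
    also have "\<dots> = W * B * norm (y - x) * norm (y - x)"
      using w by (simp add: W_def power2_eq_square)
    finally show "norm ((superpose M w h \<phi> y - superpose M w h \<phi> x) -
        (\<Sum>i\<in>UNIV. (y - x) $ i * superpose M w h (partial i \<phi>) x)) / norm (y - x) \<le> W * B * norm
            (y - x)"
      unfolding eq using y by (simp add: field_simps)
  qed auto
qed

lemma partial_superpose:
  assumes "integrable M w" "h \<in> borel_measurable M" "\<phi> \<in> test_functions"
  shows "partial i (superpose M w h \<phi>) = superpose M w h (partial i \<phi>)"
  by (rule ext, subst partial_eqI[OF superpose_derivative[OF assms]])
    (auto simp: axis_def if_distrib if_distribR cong: if_cong)

lemma superpose_nz:
  assumes "superpose M w h \<phi> x \<noteq> 0"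
  obtains \<omega> where "w \<omega> \<noteq> 0" "\<phi> (x - h \<omega>) \<noteq> 0"
proof (rule ccontr)
  assume "\<not> thesis"
  with that have "(\<lambda>\<omega>. w \<omega> * \<phi> (x - h \<omega>)) = (\<lambda>\<omega>. 0)" by (auto simp: fun_eq_iff)
  then have "superpose M w h \<phi> x = 0" unfolding superpose_def by simp
  with assms show False by simp
qed

lemma superpose_test:
  assumes w: "integrable M w" and h: "h \<in> borel_measurable M" and \<phi>: "\<phi> \<in> test_functions"
    and R: "\<And>\<omega>. w \<omega> \<noteq> 0 \<Longrightarrow> norm (h \<omega>) \<le> R"
  shows "superpose M w h \<phi> \<in> test_functions"
proof -
  obtain R' where R': "\<And>x. \<phi> x \<noteq> 0 \<Longrightarrow> norm x \<le> R'"
    using test_functionsE[OF \<phi>] by blast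
  show ?thesis
  proof (rule test_functionsI[where R = "R' + R"])
    show "smooth (superpose M w h \<phi>)"
      by (rule smooth_coinduct[where F = "superpose M w h ` test_functions"])
        (use \<phi> superpose_derivative[OF w h] partial_superpose[OF w h] test_functions_partial in
          \<open>fastforce simp: differentiable_on_def differentiable_def\<close>)+
    show "norm x \<le> R' + R" if nz: "superpose M w h \<phi> x \<noteq> 0" for x
    proof -
      obtain \<omega> where "w \<omega> \<noteq> 0" "\<phi> (x - h \<omega>) \<noteq> 0" using superpose_nz[OF nz] .
      then have "norm (x - h \<omega>) \<le> R'" "norm (h \<omega>) \<le> R" using R' R by auto
      then show ?thesis using norm_triangle_ineq[of "x - h \<omega>" "h \<omega>"] by simp
    qed
  qed
qed

text \<open>Young's inequality: Tonelli, for which \<open>M\<close> must be sigma-finite, followed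
  by translation invariance in the inner integral.\<close>

lemma superpose_L1:
  fixes h :: "'b \<Rightarrow> real ^ 'n::finite"
  assumes w: "integrable M w" and h[measurable]: "h \<in> borel_measurable M" and \<phi>: "\<phi> \<in>
      test_functions"
    and R: "\<And>\<omega>. w \<omega> \<noteq> 0 \<Longrightarrow> norm (h \<omega>) \<le> R" and M: "sigma_finite_measure M"
  shows "(LBINT x. \<bar>superpose M w h \<phi> x\<bar>) \<le> (\<integral>\<omega>. \<bar>w \<omega>\<bar> \<partial>M) * (LBINT x. \<bar>\<phi> x\<bar>)"
proof -
  interpret pair_sigma_finite lborel M
    using M by (simp add: pair_sigma_finite_def sigma_finite_lborel)
  have [measurable]: "\<phi> \<in> borel_measurable borel" "w \<in> borel_measurable M"
    using test_functions_borel_measurable \<phi> w by auto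
  have T: "superpose M w h \<phi> \<in> test_functions" by (rule superpose_test[OF w h \<phi> R])
  have [measurable]: "superpose M w h \<phi> \<in> borel_measurable borel"
    using T by (rule test_functions_borel_measurable)
  have "ennreal (LBINT x. \<bar>superpose M w h \<phi> x\<bar>) = (\<integral>\<^sup>+x. \<bar>superpose M w h \<phi> x\<bar> \<partial>lborel)"
    using test_functions_integrable[OF T] by (subst nn_integral_eq_integral) auto
  also have "\<dots> \<le> (\<integral>\<^sup>+x. (\<integral>\<^sup>+\<omega>. ennreal \<bar>w \<omega> * \<phi> (x - h \<omega>)\<bar> \<partial>M) \<partial>lborel)"
  proof (rule nn_integral_mono)
    fix x
    have int: "integrable M (\<lambda>\<omega>. w \<omega> * \<phi> (x - h \<omega>))" by (rule superpose_integrable[OF w h \<phi>])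
    then have "(\<integral>\<^sup>+\<omega>. ennreal \<bar>w \<omega> * \<phi> (x - h \<omega>)\<bar> \<partial>M) = ennreal (\<integral>\<omega>. \<bar>w \<omega> * \<phi> (x - h \<omega>)\<bar> \<partial>M)"
      by (intro nn_integral_eq_integral) auto
    moreover have "\<bar>superpose M w h \<phi> x\<bar> \<le> (\<integral>\<omega>. \<bar>w \<omega> * \<phi> (x - h \<omega>)\<bar> \<partial>M)"
      unfolding superpose_def by (rule integral_abs_bound)
    ultimately show "ennreal \<bar>superpose M w h \<phi> x\<bar> \<le> (\<integral>\<^sup>+\<omega>. ennreal \<bar>w \<omega> * \<phi> (x - h \<omega>)\<bar> \<partial>M)"
      by (simp add: ennreal_leI)
  qed
  also have "\<dots> = (\<integral>\<^sup>+\<omega>. (\<integral>\<^sup>+x. ennreal \<bar>w \<omega> * \<phi> (x - h \<omega>)\<bar> \<partial>lborel) \<partial>M)"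
  proof (rule Fubini'[symmetric])
    have [measurable]: "fst \<in> borel_measurable (lborel \<Otimes>\<^sub>M M)"
      using measurable_fst[of lborel M] by simp
    show "(\<lambda>(x, \<omega>). ennreal \<bar>w \<omega> * \<phi> (x - h \<omega>)\<bar>) \<in> borel_measurable (lborel \<Otimes>\<^sub>M M)"
      unfolding split_beta' by measurable
  qed
  also have "\<dots> = (\<integral>\<^sup>+\<omega>. ennreal \<bar>w \<omega>\<bar> * ennreal (LBINT x. \<bar>\<phi> x\<bar>) \<partial>M)"
  proof (rule nn_integral_cong)
    fix \<omega>
    have "(\<integral>\<^sup>+x. ennreal \<bar>w \<omega> * \<phi> (x - h \<omega>)\<bar> \<partial>lborel) = ennreal \<bar>w \<omega>\<bar> * (\<integral>\<^sup>+x. ennreal \<bar>\<phi> (- h \<omega>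
        + x)\<bar> \<partial>lborel)"
      by (subst nn_integral_cmult[symmetric]) (auto simp: abs_mult ennreal_mult)
    also have "(\<integral>\<^sup>+x. ennreal \<bar>\<phi> (- h \<omega> + x)\<bar> \<partial>lborel) = (\<integral>\<^sup>+x. ennreal \<bar>\<phi> x\<bar> \<partial>distr lborel borel
        ((+) (- h \<omega>)))"
      by (subst nn_integral_distr) auto
    also have "\<dots> = ennreal (LBINT x. \<bar>\<phi> x\<bar>)"
      unfolding lborel_distr_plus using test_functions_integrable[OF \<phi>]
      by (subst nn_integral_eq_integral) auto
    finally show "(\<integral>\<^sup>+x. ennreal \<bar>w \<omega> * \<phi> (x - h \<omega>)\<bar> \<partial>lborel) = ennreal \<bar>w \<omega>\<bar> * ennreal (LBINT x.
        \<bar>\<phi> x\<bar>)" .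
  qed
  also have "\<dots> = ennreal (\<integral>\<omega>. \<bar>w \<omega>\<bar> \<partial>M) * ennreal (LBINT x. \<bar>\<phi> x\<bar>)"
    using w by (subst nn_integral_multc) (auto simp: nn_integral_eq_integral)
  finally show ?thesis
    by (subst (asm) ennreal_mult[symmetric]) (auto simp: integral_nonneg)
qed

section \<open>A parametrix for the Laplacian\<close>

lemma segment_integrable:
  fixes w :: "real ^ 'n::finite \<Rightarrow> real" and F :: "real \<times> (real ^ 'n) \<Rightarrow> real"
  assumes w: "w \<in> test_functions" and F: "continuous_on UNIV F"
  shows "integrable lborel (\<lambda>p. indicator {0..1} (fst p) * (w (snd p) * F p))"
proof -
  obtain R where R: "\<And>x. w x \<noteq> 0 \<Longrightarrow> norm x \<le> R"
    using test_functionsE[OF w] by blast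
  let ?S = "{0..1::real} \<times> cball (0::real ^ 'n) R"
  have "continuous_on UNIV (\<lambda>p. w (snd p) * F p)"
    by (intro continuous_on_mult F continuous_on_compose2[of UNIV w UNIV snd] smooth_continuous_on
        test_functions_smooth w continuous_on_snd continuous_on_id) auto
  then have "integrable lborel (\<lambda>p. indicator ?S p *\<^sub>R (w (snd p) * F p))"
    by (intro borel_integrable_compact compact_Times) (auto intro: continuous_on_subset)
  also have "(\<lambda>p. indicator ?S p *\<^sub>R (w (snd p) * F p)) = (\<lambda>p. indicator {0..1} (fst p) * (w (snd
      p) * F p))"
    using R by (force simp: fun_eq_iff indicator_def)
  finally show ?thesis .
qed

lemma lborel_fst:
  fixes f :: "'a::euclidean_space \<times> 'b::euclidean_space \<Rightarrow> real"
  assumes "integrable lborel f"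
  shows "(LBINT p. f p) = (LBINT t. LBINT y. f (t, y))"
  using lborel_pair.integral_fst'[of f] assms by (simp add: lborel_prod)

lemma lborel_snd:
  fixes f :: "'a::euclidean_space \<times> 'b::euclidean_space \<Rightarrow> real"
  assumes "integrable lborel f"
  shows "(LBINT p. f p) = (LBINT y. LBINT t. f (t, y))"
  using lborel_pair.integral_snd[of "\<lambda>t y. f (t, y)"] assms by (simp add: lborel_prod)

lemma continuous_on_segment:
  fixes \<psi> :: "real ^ 'n::finite \<Rightarrow> real"
  assumes "smooth \<psi>"
  shows "continuous_on UNIV (\<lambda>p. \<psi> (x - fst p *\<^sub>R snd p))"
  by (rule continuous_on_compose2[of UNIV \<psi>, OF smooth_continuous_on[OF assms]])
    (auto intro!: continuous_intros)

lemma integral_segment_derivative: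
  fixes \<psi> :: "real ^ 'n::finite \<Rightarrow> real"
  assumes "smooth \<psi>"
  shows "(LBINT t. indicator {0..1} t * (\<Sum>i\<in>UNIV. - y $ i * partial i \<psi> (x - t *\<^sub>R y))) = \<psi> (x -
      y) - \<psi> x"
proof -
  let ?f = "\<lambda>t. \<Sum>i\<in>UNIV. (- y) $ i * partial i \<psi> (x + t *\<^sub>R (- y))"
  have "(LBINT t. indicator {0..1} t *\<^sub>R ?f t) = \<psi> (x + 1 *\<^sub>R (- y)) - \<psi> (x + 0 *\<^sub>R (- y))"
  proof (rule integral_FTC_atLeastAtMost[where F = "\<lambda>t. \<psi> (x + t *\<^sub>R (- y))"])
    show "((\<lambda>t. \<psi> (x + t *\<^sub>R (- y))) has_vector_derivative ?f t) (at t within {0..1})" for t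
      using smooth_line_derivative[OF assms, of x "- y" t]
      by (simp add: has_real_derivative_iff_has_vector_derivative has_vector_derivative_at_within)
    show "continuous_on {0..1} ?f"
      by (intro continuous_on_sum continuous_on_mult continuous_on_const
          continuous_on_compose2[of UNIV "partial _ \<psi>", OF smooth_continuous_on[OF
              smooth_partial[OF assms]]])
        (auto intro!: continuous_intros)
  qed simp
  then show ?thesis by simp
qed

text \<open>Fubini with the segment parameter innermost, then the fundamental theorem of calculus.
  It enters twice with exchanged roles: weight \<open>mollifier\<close> and function
  \<open>\<phi>\<close> for the Laplacian of the parametrix, weight \<open>\<phi>\<close> and
  function \<open>mollifier\<close> for the divergence form of
  \<open>mollify \<phi>\<close>.\<close>

lemma segment_average:
  fixes w \<psi> :: "real ^ 'n::finite \<Rightarrow> real"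
  assumes w: "w \<in> test_functions" and \<psi>: "smooth \<psi>"
  shows "(LBINT p. indicator {0..1} (fst p) *
      (w (snd p) * (\<Sum>i\<in>UNIV. - snd p $ i * partial i \<psi> (x - fst p *\<^sub>R snd p))))
    = (LBINT y. w y * (\<psi> (x - y) - \<psi> x))"
proof -
  have "integrable lborel (\<lambda>p. indicator {0..1} (fst p) *
      (w (snd p) * (\<Sum>i\<in>UNIV. - snd p $ i * partial i \<psi> (x - fst p *\<^sub>R snd p))))"
    by (intro segment_integrable w continuous_on_sum continuous_on_mult
        continuous_on_segment smooth_partial \<psi> continuous_intros)
  from lborel_snd[OF this] show ?thesis
  proof (rule trans, intro Bochner_Integration.integral_cong refl)
    fix y
    have "(LBINT t. indicator {0..1} t * (w y * (\<Sum>i\<in>UNIV. - y $ i * partial i \<psi> (x - t *\<^sub>R y))))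
        = (LBINT t. w y * (indicator {0..1} t * (\<Sum>i\<in>UNIV. - y $ i * partial i \<psi> (x - t *\<^sub>R y))))"
      by (rule Bochner_Integration.integral_cong) (auto simp: algebra_simps)
    also have "\<dots> = w y * (\<psi> (x - y) - \<psi> x)"
      by (simp only: integral_mult_right_zero integral_segment_derivative[OF \<psi>])
    finally show "(LBINT t. indicator {0..1} (fst (t, y)) * (w (snd (t, y)) *
        (\<Sum>i\<in>UNIV. - snd (t, y) $ i * partial i \<psi> (x - fst (t, y) *\<^sub>R snd (t, y)))))
        = w y * (\<psi> (x - y) - \<psi> x)" by simp
  qed
qed

text \<open>The kernel is not normalised; its mass stays in the estimates as the constant
  \<open>c\<close>.\<close>

definition mollify :: "(real ^ 'n::finite \<Rightarrow> real) \<Rightarrow> real ^ 'n \<Rightarrow> real" where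
  "mollify \<phi> = superpose lborel mollifier (\<lambda>y. y) \<phi>"

text \<open>Convolution with the kernel \<open>\<integral>\<^sub>0\<^sup>1 t \<sigma>\<^sub>t dt\<close>, where \<open>\<sigma> = ball_bump\<close> and
  \<open>\<sigma>\<^sub>t(x) = t\<^sup>-\<^sup>n \<sigma>(x/t)\<close>: this is the Newtonian potential up to a smooth error, but compactly
  supported in every dimension.\<close>

definition parametrix :: "(real ^ 'n::finite \<Rightarrow> real) \<Rightarrow> real ^ 'n \<Rightarrow> real" where
  "parametrix \<phi> = superpose lborel (\<lambda>p. indicator {0..1} (fst p) * (ball_bump (snd p) * fst p))
     (\<lambda>p. fst p *\<^sub>R snd p) \<phi>"

lemma parametrix_weight_integrable:
  "integrable lborel (\<lambda>p::real \<times> (real ^ 'n::finite). indicator {0..1} (fst p) * (ball_bump (snd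
      p) * fst p))"
  by (intro segment_integrable ball_bump_test continuous_intros)

lemma segment_map_measurable:
  "(\<lambda>p::real \<times> (real ^ 'n::finite). fst p *\<^sub>R snd p) \<in> borel_measurable lborel"
proof -
  have "continuous_on UNIV (\<lambda>p::real \<times> (real ^ 'n). fst p *\<^sub>R snd p)"
    by (intro continuous_intros)
  then show ?thesis by (simp add: borel_measurable_continuous_onI)
qed

lemma parametrix_weight_support:
  fixes p :: "real \<times> (real ^ 'n::finite)"
  assumes "indicator {0..1} (fst p) * (ball_bump (snd p) * fst p) \<noteq> 0"
  shows "norm (fst p *\<^sub>R snd p) \<le> 1"
proof -
  have "0 \<le> fst p" "fst p \<le> 1" "ball_bump (snd p) \<noteq> 0"
    using assms by (auto simp: indicator_def split: if_splits)
  then show ?thesis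
    using ball_bump_support[of "snd p"] by (simp add: mult_le_one)
qed

lemma parametrix_test: "\<phi> \<in> test_functions \<Longrightarrow> parametrix \<phi> \<in> test_functions"
  unfolding parametrix_def
  by (rule superpose_test[OF parametrix_weight_integrable segment_map_measurable _
      parametrix_weight_support])

lemma partial_parametrix: "\<phi> \<in> test_functions \<Longrightarrow> partial i (parametrix \<phi>) = parametrix (partial i \<phi>)"
  unfolding parametrix_def
  by (rule partial_superpose[OF parametrix_weight_integrable segment_map_measurable])

lemma mollify_test: "\<phi> \<in> test_functions \<Longrightarrow> mollify \<phi> \<in> test_functions"
  unfolding mollify_def
  by (rule superpose_test[OF test_functions_integrable[OF mollifier_test] _ _ mollifier_support])
      auto

lemma mollify_integrable:
  "\<phi> \<in> test_functions \<Longrightarrow> integrable lborel (\<lambda>y. mollifier y * \<phi> (x - y))"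
  by (rule superpose_integrable[OF test_functions_integrable[OF mollifier_test]]) auto

text \<open>The weight \<open>t\<close> of the kernel is exactly the chain-rule factor that makes
  \<open>t\<close> times a second derivative of \<open>\<phi>\<close> at \<open>x - t y\<close>
  minus the \<open>y\<close>-derivative of a first one. Integration by parts moves that derivative
  to \<open>ball_bump\<close>, where it becomes \<open>- y $ i * mollifier y\<close>. Summed over
  \<open>i\<close>, the integrand is the derivative in \<open>t\<close> of \<open>\<phi>\<close>
  along the segment, and integrating over \<open>t\<close> leaves the difference of the endpoint
  values.\<close>

lemma laplacian_parametrix:
  fixes \<phi> :: "real ^ 'n::finite \<Rightarrow> real"
  assumes \<phi>: "\<phi> \<in> test_functions"
  shows "(\<Sum>i\<in>UNIV. partial i (partial i (parametrix \<phi>)) x)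
    = mollify \<phi> x - (LBINT y::real ^ 'n. mollifier y) * \<phi> x"
proof -
  have smooth: "smooth \<phi>" "smooth (partial i \<phi>)" "smooth (partial i (partial i \<phi>))" for i
    by (intro test_functions_smooth test_functions_partial \<phi>)+
  have mol: "integrable lborel (mollifier :: real ^ 'n \<Rightarrow> real)"
    by (rule test_functions_integrable[OF mollifier_test])
  have inti: "integrable lborel (\<lambda>p. indicator {0..1} (fst p) *
      (mollifier (snd p) * (- snd p $ i * partial i \<phi> (x - fst p *\<^sub>R snd p))))" for i
    by (intro segment_integrable mollifier_test continuous_on_mult continuous_on_segment smooth
        continuous_intros)
  have "partial i (partial i (parametrix \<phi>)) x = (LBINT p. indicator {0..1} (fst p) *
      (mollifier (snd p) * (- snd p $ i * partial i \<phi> (x - fst p *\<^sub>R snd p))))" for i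
  proof -
    have "integrable lborel (\<lambda>p. indicator {0..1} (fst p) * (ball_bump (snd p) *
        (fst p * partial i (partial i \<phi>) (x - fst p *\<^sub>R snd p))))"
      by (intro segment_integrable ball_bump_test continuous_on_mult continuous_on_segment smooth
          continuous_intros)
    note int = lborel_fst[OF this]
    have "partial i (partial i (parametrix \<phi>)) x = (LBINT p. indicator {0..1} (fst p) *
        (ball_bump (snd p) *
        (fst p * partial i (partial i \<phi>) (x - fst p *\<^sub>R snd p))))"
      unfolding partial_parametrix[OF \<phi>] partial_parametrix[OF test_functions_partial[OF \<phi>]]
      by (simp add: parametrix_def superpose_def mult_ac)
    also have "\<dots> = (LBINT t. LBINT y. indicator {0..1} t * (mollifier y * (- y $ i * partial i \<phi>
        (x - t *\<^sub>R y))))"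
    proof (rule trans[OF int], rule Bochner_Integration.integral_cong[OF refl])
      fix t :: real
      have aff: "(\<lambda>y. partial i \<phi> (x - t *\<^sub>R y)) = (\<lambda>y. partial i \<phi> ((- t) *\<^sub>R y + x))"
        by simp
      have sm: "smooth (\<lambda>y. partial i \<phi> (x - t *\<^sub>R y))"
        unfolding aff by (rule smooth_affine(1)[OF smooth(2)])
      have pa: "partial i (\<lambda>y. partial i \<phi> (x - t *\<^sub>R y)) = (\<lambda>y. - t * partial i (partial i \<phi>) (x
          - t *\<^sub>R y))"
        unfolding aff smooth_affine(2)[OF smooth(2)] by (simp add: fun_eq_iff)
      have "(LBINT y. ball_bump y * (t * partial i (partial i \<phi>) (x - t *\<^sub>R y)))
          = - (LBINT y. ball_bump y * (- t * partial i (partial i \<phi>) (x - t *\<^sub>R y)))"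
        by (simp add: mult_ac)
      also have "\<dots> = (LBINT y. partial i ball_bump y * partial i \<phi> (x - t *\<^sub>R y))"
        using integral_by_parts[OF ball_bump_test sm, of i] unfolding pa by simp
      also have "\<dots> = (LBINT y. mollifier y * (- y $ i * partial i \<phi> (x - t *\<^sub>R y)))"
        by (simp add: partial_ball_bump mult_ac)
      finally show "(LBINT y. indicator {0..1} (fst (t, y)) * (ball_bump (snd (t, y)) *
          (fst (t, y) * partial i (partial i \<phi>) (x - fst (t, y) *\<^sub>R snd (t, y)))))
        = (LBINT y. indicator {0..1} t * (mollifier y * (- y $ i * partial i \<phi> (x - t *\<^sub>R y))))"
        by (simp only: fst_conv snd_conv integral_mult_right_zero)
    qed
    also have "\<dots> = (LBINT p. indicator {0..1} (fst p) *
      (mollifier (snd p) * (- snd p $ i * partial i \<phi> (x - fst p *\<^sub>R snd p))))"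
      using lborel_fst[OF inti[of i]] by simp
    finally show ?thesis .
  qed
  then have "(\<Sum>i\<in>UNIV. partial i (partial i (parametrix \<phi>)) x)
    = (LBINT p. (\<Sum>i\<in>UNIV. indicator {0..1} (fst p) *
      (mollifier (snd p) * (- snd p $ i * partial i \<phi> (x - fst p *\<^sub>R snd p)))))"
    using inti by (simp del: mult_minus_left mult_minus_right)
  also have "\<dots> = (LBINT p. indicator {0..1} (fst p) * (mollifier (snd p) *
      (\<Sum>i\<in>UNIV. - snd p $ i * partial i \<phi> (x - fst p *\<^sub>R snd p))))"
    by (simp only: sum_distrib_left)
  also have "\<dots> = (LBINT y. mollifier y * (\<phi> (x - y) - \<phi> x))"
    by (rule segment_average[OF mollifier_test smooth(1)])
  also have "\<dots> = (LBINT y. mollifier y * \<phi> (x - y) - mollifier y * \<phi> x)"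
    by (simp add: algebra_simps)
  also have "\<dots> = mollify \<phi> x - (LBINT y::real ^ 'n. mollifier y) * \<phi> x"
    using mollify_integrable[OF \<phi>, of x] mol by (simp add: mollify_def superpose_def)
  finally show ?thesis .
qed

section \<open>Square integrals\<close>

lemma Cauchy_Schwarz_integral:
  fixes f g :: "'a \<Rightarrow> real"
  assumes [measurable]: "f \<in> borel_measurable M" "g \<in> borel_measurable M"
    and f: "integrable M (\<lambda>x. (f x)\<^sup>2)" and g: "integrable M (\<lambda>x. (g x)\<^sup>2)"
  shows "(\<integral>x. \<bar>f x * g x\<bar> \<partial>M) \<le> sqrt (\<integral>x. (f x)\<^sup>2 \<partial>M) * sqrt (\<integral>x. (g x)\<^sup>2 \<partial>M)"
proof -
  let ?F = "\<integral>x. (f x)\<^sup>2 \<partial>M" and ?G = "\<integral>x. (g x)\<^sup>2 \<partial>M"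
  have FG: "?F \<ge> 0" "?G \<ge> 0" by (auto intro: integral_nonneg)
  have "(\<integral>\<^sup>+x. ennreal \<bar>f x\<bar> * ennreal \<bar>g x\<bar> \<partial>M)\<^sup>2
      \<le> (\<integral>\<^sup>+x. (ennreal \<bar>f x\<bar>)\<^sup>2 \<partial>M) * (\<integral>\<^sup>+x. (ennreal \<bar>g x\<bar>)\<^sup>2 \<partial>M)"
    by (rule Cauchy_Schwarz_nn_integral) auto
  also have "(\<integral>\<^sup>+x. (ennreal \<bar>f x\<bar>)\<^sup>2 \<partial>M) = ennreal ?F"
    using f by (simp add: ennreal_power nn_integral_eq_integral)
  also have "(\<integral>\<^sup>+x. (ennreal \<bar>g x\<bar>)\<^sup>2 \<partial>M) = ennreal ?G"
    using g by (simp add: ennreal_power nn_integral_eq_integral)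
  finally have *: "(\<integral>\<^sup>+x. ennreal \<bar>f x * g x\<bar> \<partial>M)\<^sup>2 \<le> ennreal (?F * ?G)"
    using FG by (simp add: abs_mult ennreal_mult)
  have "(\<integral>x. \<bar>f x * g x\<bar> \<partial>M) \<le> sqrt (?F * ?G)"
  proof (rule real_le_rsqrt)
    have "(\<integral>x. \<bar>f x * g x\<bar> \<partial>M) = enn2real (\<integral>\<^sup>+x. ennreal \<bar>f x * g x\<bar> \<partial>M)"
      by (rule integral_eq_nn_integral) auto
    then have "(\<integral>x. \<bar>f x * g x\<bar> \<partial>M)\<^sup>2 = enn2real ((\<integral>\<^sup>+x. ennreal \<bar>f x * g x\<bar> \<partial>M)\<^sup>2)"
      by (simp add: power2_eq_square enn2real_mult)
    also have "\<dots> \<le> enn2real (ennreal (?F * ?G))"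
      by (rule enn2real_mono[OF *]) simp
    finally show "(\<integral>x. \<bar>f x * g x\<bar> \<partial>M)\<^sup>2 \<le> ?F * ?G" using FG by simp
  qed
  then show ?thesis by (simp add: real_sqrt_mult)
qed

text \<open>Real-valued, so that norms can be subtracted and scaled freely; the integral always
  exists for test functions, to which \<open>L1\<close> and \<open>L2\<close> are applied.\<close>

definition L1 :: "(real ^ 'n::finite \<Rightarrow> real) \<Rightarrow> real" where
  "L1 \<phi> = (LBINT x. \<bar>\<phi> x\<bar>)"

definition L2 :: "(real ^ 'n::finite \<Rightarrow> real) \<Rightarrow> real" where
  "L2 \<phi> = sqrt (LBINT x. (\<phi> x)\<^sup>2)"

lemma L1_nonneg: "L1 \<phi> \<ge> 0"
  by (simp add: L1_def integral_nonneg)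

lemma L2_nonneg: "L2 \<phi> \<ge> 0"
  by (simp add: L2_def integral_nonneg)

lemma test_functions_power2:
  fixes \<phi> :: "real ^ 'n::finite \<Rightarrow> real"
  shows "\<phi> \<in> test_functions \<Longrightarrow> (\<lambda>x. (\<phi> x)\<^sup>2) \<in> test_functions"
  unfolding power2_eq_square by (intro test_functions_mult test_functions_smooth)

text \<open>Cauchy-Schwarz against the indicator of \<open>S\<close>. This converts the L1 norms of
  the gradient estimate into the L2 norms in which the Hessian is controlled.\<close>

lemma L1_le_L2:
  assumes \<phi>: "\<phi> \<in> test_functions" and S: "S \<in> fmeasurable lborel" and 0: "\<And>x. x \<notin> S \<Longrightarrow> \<phi> x = 0"
  shows "L1 \<phi> \<le> sqrt (measure lborel S) * L2 \<phi>"
proof -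
  have [measurable]: "\<phi> \<in> borel_measurable borel" "S \<in> sets borel"
    using test_functions_borel_measurable \<phi> S by auto
  have sq: "(\<lambda>x. (indicator S x)\<^sup>2) = (indicator S :: _ \<Rightarrow> real)"
    by (auto simp: indicator_def)
  have "L1 \<phi> = (LBINT x. \<bar>indicator S x * \<phi> x\<bar>)"
    unfolding L1_def by (intro Bochner_Integration.integral_cong) (use 0 in \<open>auto simp:
        indicator_def\<close>)
  also have "\<dots> \<le> sqrt (LBINT x. (indicator S x)\<^sup>2) * sqrt (LBINT x. (\<phi> x)\<^sup>2)"
    by (rule Cauchy_Schwarz_integral)
      (use S test_functions_integrable[OF test_functions_power2[OF \<phi>]] in \<open>auto simp: sq
          fmeasurable_def\<close>)
  also have "\<dots> = sqrt (measure lborel S) * L2 \<phi>"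
    using S unfolding sq L2_def by simp
  finally show ?thesis .
qed

text \<open>Two integrations by parts, one in direction \<open>j\<close> and one in direction
  \<open>i\<close>; in between, the third derivatives are reordered.\<close>

lemma integral_square_second_partial:
  fixes \<psi> :: "real ^ 'n::finite \<Rightarrow> real"
  assumes \<psi>: "\<psi> \<in> test_functions"
  shows "(LBINT x. (partial j (partial i \<psi>) x)\<^sup>2)
    = (LBINT x. partial i (partial i \<psi>) x * partial j (partial j \<psi>) x)"
proof -
  have t: "partial i \<psi> \<in> test_functions" "partial j (partial i \<psi>) \<in> test_functions"
    "partial j (partial j \<psi>) \<in> test_functions"
    by (intro test_functions_partial \<psi>)+
  have s: "smooth \<psi>" "smooth (partial j \<psi>)" "smooth (partial i \<psi>)"
    by (intro test_functions_smooth test_functions_partial \<psi>)+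
  have "(LBINT x. (partial j (partial i \<psi>) x)\<^sup>2) = - (LBINT x. partial i \<psi> x * partial j (partial
      j (partial i \<psi>)) x)"
    using integral_by_parts[OF t(1) test_functions_smooth[OF t(2)], of j] by (simp add:
        power2_eq_square)
  also have "partial j (partial j (partial i \<psi>)) = partial i (partial j (partial j \<psi>))"
    using partial_commute[OF s(1)] partial_commute[OF s(2)] by simp
  also have "- (LBINT x. partial i \<psi> x * partial i (partial j (partial j \<psi>)) x)
      = (LBINT x. partial i (partial i \<psi>) x * partial j (partial j \<psi>) x)"
    using integral_by_parts[OF t(1) test_functions_smooth[OF t(3)], of i] by simp
  finally show ?thesis .
qed

text \<open>An elementary form of the L2 boundedness of products of two Riesz transforms: a single
  entry is bounded by the sum of the squares of all entries, which
  \<open>integral_square_second_partial\<close> identifies with the squared norm of the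
  Laplacian.\<close>

lemma hessian_L2_le:
  fixes \<psi> :: "real ^ 'n::finite \<Rightarrow> real"
  assumes \<psi>: "\<psi> \<in> test_functions"
  shows "L2 (partial j (partial i \<psi>)) \<le> L2 (\<lambda>x. \<Sum>i\<in>UNIV. partial i (partial i \<psi>) x)"
proof -
  have t: "partial j (partial i \<psi>) \<in> test_functions" for i j
    using \<psi> by (intro test_functions_partial)
  have int: "integrable lborel (\<lambda>x. partial i (partial i \<psi>) x * partial j (partial j \<psi>) x)" for i j
    by (intro test_functions_integrable test_functions_mult(1) t test_functions_smooth)
  have "(LBINT x. (partial j (partial i \<psi>) x)\<^sup>2) \<le> (\<Sum>i\<in>UNIV. LBINT x. (partial j (partial i \<psi>)
      x)\<^sup>2)"
    by (rule member_le_sum) (auto intro: integral_nonneg)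
  also have "\<dots> \<le> (\<Sum>j\<in>UNIV. \<Sum>i\<in>UNIV. LBINT x. (partial j (partial i \<psi>) x)\<^sup>2)"
    by (rule member_le_sum[where f = "\<lambda>j. \<Sum>i\<in>UNIV. LBINT x. (partial j (partial i \<psi>) x)\<^sup>2"])
      (auto intro: integral_nonneg sum_nonneg)
  also have "\<dots> = (\<Sum>j\<in>UNIV. \<Sum>i\<in>UNIV. LBINT x. partial i (partial i \<psi>) x * partial j (partial j \<psi>) x)"
    by (simp only: integral_square_second_partial[OF \<psi>])
  also have "\<dots> = (LBINT x. (\<Sum>j\<in>UNIV. \<Sum>i\<in>UNIV. partial i (partial i \<psi>) x * partial j (partial j \<psi>)
      x))"
    using int by (simp add: Bochner_Integration.integral_sum Bochner_Integration.integrable_sum)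
  also have "\<dots> = (LBINT x. (\<Sum>i\<in>UNIV. partial i (partial i \<psi>) x)\<^sup>2)"
    by (simp add: power2_eq_square sum_distrib_left sum_distrib_right)
  finally show ?thesis unfolding L2_def by simp
qed

text \<open>Pointwise this is Jensen's inequality for the kernel, obtained by expanding the
  nonnegative integral of the squared deviation from the weighted mean \<open>m / c\<close>.
  \<open>superpose_L1\<close> then integrates the mollified square, and each of the two steps
  contributes one factor \<open>c\<close>.\<close>

lemma mollify_L2:
  fixes \<phi> :: "real ^ 'n::finite \<Rightarrow> real"
  assumes \<phi>: "\<phi> \<in> test_functions"
  shows "(LBINT x. (mollify \<phi> x)\<^sup>2)
    \<le> (LBINT y::real ^ 'n. mollifier y)\<^sup>2 * (LBINT x. (\<phi> x)\<^sup>2)"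
proof -
  define c where "c = (LBINT y::real ^ 'n. mollifier y)"
  have c: "c > 0" unfolding c_def by (rule mollifier_integral_pos)
  note \<phi>2 = test_functions_power2[OF \<phi>]
  have pointwise: "(mollify \<phi> x)\<^sup>2 \<le> c * mollify (\<lambda>x. (\<phi> x)\<^sup>2) x" for x
  proof -
    define m where "m = mollify \<phi> x"
    have i: "integrable lborel (\<lambda>y. mollifier y * \<phi> (x - y))"
      "integrable lborel (\<lambda>y. mollifier y * (\<phi> (x - y))\<^sup>2)"
      "integrable lborel (mollifier :: real ^ 'n \<Rightarrow> real)"
      using mollify_integrable[OF \<phi>] mollify_integrable[OF \<phi>2] test_functions_integrable[OF
          mollifier_test]
      by auto
    have "0 \<le> (LBINT y. mollifier y * (\<phi> (x - y) - m / c)\<^sup>2)"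
      by (intro Bochner_Integration.integral_nonneg mult_nonneg_nonneg mollifier_nonneg) auto
    also have "\<dots> = (LBINT y. mollifier y * (\<phi> (x - y))\<^sup>2 - 2 * (m / c) * (mollifier y * \<phi> (x - y))
        + (m / c)\<^sup>2 * mollifier y)"
      by (intro Bochner_Integration.integral_cong) (auto simp: power2_eq_square algebra_simps)
    also have "\<dots> = mollify (\<lambda>x. (\<phi> x)\<^sup>2) x - 2 * (m / c) * m + (m / c)\<^sup>2 * c"
      unfolding m_def c_def using i by (simp add: mollify_def superpose_def)
    finally have "0 \<le> mollify (\<lambda>x. (\<phi> x)\<^sup>2) x - m\<^sup>2 / c"
      using c by (simp add: power2_eq_square)
    then show ?thesis using c by (simp add: m_def field_simps)
  qed
  have nonneg: "mollify (\<lambda>x. (\<phi> x)\<^sup>2) x \<ge> 0" for x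
    unfolding mollify_def superpose_def by (intro Bochner_Integration.integral_nonneg
        mult_nonneg_nonneg mollifier_nonneg) auto
  have "(LBINT x. (mollify \<phi> x)\<^sup>2) \<le> (LBINT x. c * mollify (\<lambda>x. (\<phi> x)\<^sup>2) x)"
    by (intro integral_mono pointwise integrable_mult_right test_functions_integrable
        test_functions_power2 mollify_test \<phi> \<phi>2)
  also have "\<dots> = c * (LBINT x. \<bar>mollify (\<lambda>x. (\<phi> x)\<^sup>2) x\<bar>)"
    using nonneg by simp
  also have "\<dots> \<le> c * ((LBINT y::real ^ 'n. \<bar>mollifier y\<bar>) * (LBINT x. \<bar>(\<phi> x)\<^sup>2\<bar>))"
    unfolding mollify_def
    by (intro mult_left_mono superpose_L1[OF test_functions_integrable[OF mollifier_test] _ \<phi>2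
        mollifier_support])
      (use c sigma_finite_lborel in auto)
  also have "(LBINT y::real ^ 'n. \<bar>mollifier y\<bar>) = c"
    by (simp add: c_def mollifier_nonneg)
  finally show ?thesis
    by (simp add: c_def[symmetric] power2_eq_square mult_ac)
qed

section \<open>Estimates on cubes\<close>

lemma integral_affine:
  fixes f :: "'a::euclidean_space \<Rightarrow> real"
  assumes [measurable]: "f \<in> borel_measurable borel" and "c \<noteq> 0"
  shows "(LBINT x. f x) = \<bar>c\<bar> ^ DIM('a) * (LBINT x. f (t + c *\<^sub>R x))"
proof -
  have "(LBINT x. f x) = (\<integral>x. f x \<partial>density (distr lborel borel (\<lambda>x. t + c *\<^sub>R x)) (\<lambda>_. \<bar>c\<bar> ^
      DIM('a)))"
    using lborel_affine[OF assms(2), of t] by simp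
  also have "\<dots> = (\<integral>x. \<bar>c\<bar> ^ DIM('a) *\<^sub>R f x \<partial>distr lborel borel (\<lambda>x. t + c *\<^sub>R x))"
    by (rule integral_density) auto
  also have "\<dots> = (LBINT x. \<bar>c\<bar> ^ DIM('a) *\<^sub>R f (t + c *\<^sub>R x))"
    by (rule integral_distr) auto
  finally show ?thesis by simp
qed

text \<open>With the roles exchanged, derivatives of \<open>mollify \<phi>\<close> fall on the fixed
  mollifier, so they cost only the L1 norm of \<open>\<phi>\<close>.\<close>

lemma mollify_commute:
  assumes \<phi>: "\<phi> \<in> test_functions"
  shows "mollify \<phi> = superpose lborel \<phi> (\<lambda>y. y) mollifier"
proof
  fix x :: "real ^ 'a"
  have [measurable]: "\<phi> \<in> borel_measurable borel" "(mollifier :: real ^ 'a \<Rightarrow> real) \<in>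
      borel_measurable borel"
    using test_functions_borel_measurable \<phi> mollifier_test by blast+
  have "mollify \<phi> x = (LBINT y. mollifier (x + (-1) *\<^sub>R y) * \<phi> (x - (x + (-1) *\<^sub>R y)))"
    unfolding mollify_def superpose_def by (subst integral_affine[of _ "-1" x]) auto
  then show "mollify \<phi> x = superpose lborel \<phi> (\<lambda>y. y) mollifier x"
    by (simp add: superpose_def mult.commute)
qed

lemma mem_cube: "x \<in> cube a l \<longleftrightarrow> (\<forall>i. a $ i \<le> x $ i \<and> x $ i \<le> a $ i + l)"
  by (auto simp: cube_def mem_box_cart)

lemma cube_nonempty: "l \<ge> 0 \<Longrightarrow> cube a l \<noteq> {}"
  using mem_cube[of a a l] by auto

lemma measure_cube:
  fixes a :: "real ^ 'n::finite"
  assumes "l \<ge> 0"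
  shows "measure lborel (cube a l) = l ^ CARD('n)"
  using content_cbox_cart[OF cube_nonempty[OF assms, unfolded cube_def], of a] by (simp add:
      cube_def)

lemma cube_fmeasurable: "cube a l \<in> fmeasurable lborel"
  unfolding cube_def by (intro fmeasurable_compact compact_cbox)

lemma closed_cube: "closed (cube a l)"
  unfolding cube_def by (rule closed_cbox)

text \<open>Both sides of \<open>gradient_bound\<close> are of first order. Composing the functional
  with a dilation therefore preserves the locale and only multiplies \<open>M\<close> by the volume
  factor; this is what \<open>mean_zero_bound\<close> exploits.\<close>

locale gradient_bounded =
  fixes \<l> :: "(real ^ 'n::finite \<Rightarrow> real) \<Rightarrow> real" and M :: real
  assumes add: "\<lbrakk>\<phi> \<in> test_functions; \<psi> \<in> test_functions\<rbrakk> \<Longrightarrow> \<l> (\<lambda>x. \<phi> x + \<psi> x) = \<l> \<phi> + \<l> \<psi>"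
    and scale: "\<phi> \<in> test_functions \<Longrightarrow> \<l> (\<lambda>x. c * \<phi> x) = c * \<l> \<phi>"
    and gradient_bound: "\<phi> \<in> test_functions \<Longrightarrow> \<bar>\<l> (partial j \<phi>)\<bar> \<le> M * (\<Sum>i\<in>UNIV. L1 (partial i \<phi>))"
    and bound_nonneg: "M \<ge> 0"

text \<open>Kept separate because the terms of order 0 and 1 scale differently, so that a dilation
  does not simply change \<open>M\<close>.\<close>

locale sobolev_bounded = gradient_bounded \<l> M
  for \<l> :: "(real ^ 'n::finite \<Rightarrow> real) \<Rightarrow> real" and M :: real +
  assumes sobolev_bound: "\<phi> \<in> test_functions \<Longrightarrow> \<bar>\<l> \<phi>\<bar> \<le> M * (L1 \<phi> + (\<Sum>i\<in>UNIV. L1 (partial i \<phi>)))"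

context gradient_bounded
begin

lemma zero: "\<l> (\<lambda>x. 0) = 0"
  using scale[OF test_functions_0, of 0] by simp

lemma diff: "\<lbrakk>\<phi> \<in> test_functions; \<psi> \<in> test_functions\<rbrakk> \<Longrightarrow> \<l> (\<lambda>x. \<phi> x - \<psi> x) = \<l> \<phi> - \<l> \<psi>"
  using add[of \<phi> "\<lambda>x. -1 * \<psi> x"] scale[of \<psi> "-1"] test_functions_cmult[of \<psi> "-1"] by simp

lemma sum: "finite A \<Longrightarrow> (\<And>i. i \<in> A \<Longrightarrow> f i \<in> test_functions) \<Longrightarrow> \<l> (\<lambda>x. \<Sum>i\<in>A. f i x) = (\<Sum>i\<in>A. \<l> (f i))"
  by (induction rule: finite_induct) (simp_all add: zero add test_functions_sum)

lemma mollify_split: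
  assumes \<phi>: "\<phi> \<in> test_functions" and c: "c > 0"
  shows "c * \<bar>\<l> \<phi>\<bar> \<le> \<bar>\<l> (mollify \<phi>)\<bar> + \<bar>\<l> (\<lambda>x. mollify \<phi> x - c * \<phi> x)\<bar>"
proof -
  have "\<l> (\<lambda>x. mollify \<phi> x - c * \<phi> x) = \<l> (mollify \<phi>) - c * \<l> \<phi>"
    using diff[OF mollify_test[OF \<phi>] test_functions_cmult[OF \<phi>], of c] scale[OF \<phi>, of c] by simp
  then have "c * \<l> \<phi> = \<l> (mollify \<phi>) - \<l> (\<lambda>x. mollify \<phi> x - c * \<phi> x)" by simp
  then show ?thesis
    using c by (metis abs_mult abs_of_pos abs_triangle_ineq4)
qed

text \<open>The argument is the Laplacian of the parametrix, that is, a sum of derivatives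
  \<open>partial i\<close> of the test functions \<open>partial i (parametrix \<phi>)\<close>. The
  constants: two summations over coordinates, one from the Laplacian and one from the gradient
  estimate; \<open>3 ^ CARD('n)\<close> from enlarging the cube; \<open>2 * c\<close> for the L2
  norm of \<open>mollify \<phi> - c \<phi>\<close>.\<close>

lemma high_frequency_bound:
  assumes \<phi>: "\<phi> \<in> test_functions" and supp: "\<And>x. x \<notin> cube a l \<Longrightarrow> \<phi> x = 0" and l: "l \<ge> 1"
  shows "\<bar>\<l> (\<lambda>x. mollify \<phi> x - (LBINT y::real ^ 'n. mollifier y) * \<phi> x)\<bar>
    \<le> M * (real CARD('n))\<^sup>2 * sqrt (3 ^ CARD('n)) * (2 * (LBINT y::real ^ 'n. mollifier y))
      * sqrt (l ^ CARD('n)) * L2 \<phi>"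
proof -
  define c where "c = (LBINT y::real ^ 'n. mollifier y)"
  have c: "c > 0" unfolding c_def by (rule mollifier_integral_pos)
  let ?\<Psi> = "parametrix \<phi>"
  \<comment> \<open>The parametrix translates by vectors of norm at most 1, so the support grows by
    1 on every side; since \<open>l \<ge> 1\<close>, the new side \<open>l + 2\<close> is at most
    \<open>3 * l\<close>.\<close>
  let ?Q = "cube (\<chi> i. a $ i - 1) (l + 2) :: (real ^ 'n) set"
  have \<Psi>: "?\<Psi> \<in> test_functions" by (rule parametrix_test[OF \<phi>])
  have t: "partial i ?\<Psi> \<in> test_functions" "partial j (partial i ?\<Psi>) \<in> test_functions" for i j
    by (intro test_functions_partial \<Psi>)+
  have lap: "(\<Sum>i\<in>UNIV. partial i (partial i ?\<Psi>) x) = mollify \<phi> x - c * \<phi> x" for x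
    unfolding c_def by (rule laplacian_parametrix[OF \<phi>])
  have supp\<Psi>: "?\<Psi> x = 0" if "x \<notin> ?Q" for x
  proof (rule ccontr)
    assume "?\<Psi> x \<noteq> 0"
    then obtain p where p: "indicator {0..1} (fst p) * (ball_bump (snd p) * fst p) \<noteq> 0" "\<phi> (x -
        fst p *\<^sub>R snd p) \<noteq> 0"
      unfolding parametrix_def by (rule superpose_nz) blast
    have "x - fst p *\<^sub>R snd p \<in> cube a l" using supp p(2) by blast
    moreover have "\<bar>(fst p *\<^sub>R snd p) $ i\<bar> \<le> 1" for i
      using component_le_norm_cart[of "fst p *\<^sub>R snd p" i] parametrix_weight_support[OF p(1)] by
          linarith
    ultimately have "x \<in> ?Q"
      unfolding mem_cube vector_minus_component vec_lambda_beta
      by (intro allI) (smt (verit))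
    with that show False by blast
  qed
  have supp1: "partial i ?\<Psi> x = 0" if "x \<notin> ?Q" for i x
    by (rule partial_zero_outside[OF closed_cube supp\<Psi> that])
  have supp2: "partial j (partial i ?\<Psi>) x = 0" if "x \<notin> ?Q" for i j x
    by (rule partial_zero_outside[OF closed_cube supp1 that])
  have L2lap: "L2 (\<lambda>x. \<Sum>i\<in>UNIV. partial i (partial i ?\<Psi>) x) \<le> 2 * c * L2 \<phi>"
  proof -
    note i = test_functions_integrable[OF test_functions_power2[OF \<phi>]]
      test_functions_integrable[OF test_functions_power2[OF mollify_test[OF \<phi>]]]
    have tst: "(\<lambda>x. mollify \<phi> x - c * \<phi> x) \<in> test_functions"
      by (intro test_functions_diff mollify_test test_functions_cmult \<phi>)
    have "(LBINT x. (mollify \<phi> x - c * \<phi> x)\<^sup>2) \<le> (LBINT x. 2 * (mollify \<phi> x)\<^sup>2 + 2 * c\<^sup>2 * (\<phi> x)\<^sup>2)"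
    proof (rule integral_mono)
      show "integrable lborel (\<lambda>x. (mollify \<phi> x - c * \<phi> x)\<^sup>2)"
        by (intro test_functions_integrable test_functions_power2 tst)
      show "(mollify \<phi> x - c * \<phi> x)\<^sup>2 \<le> 2 * (mollify \<phi> x)\<^sup>2 + 2 * c\<^sup>2 * (\<phi> x)\<^sup>2" for x
        using zero_le_power2[of "mollify \<phi> x + c * \<phi> x"]
        by (simp add: power2_eq_square algebra_simps)
    qed (use i in auto)
    also have "\<dots> = 2 * (LBINT x. (mollify \<phi> x)\<^sup>2) + 2 * c\<^sup>2 * (LBINT x. (\<phi> x)\<^sup>2)"
      using i by simp
    also have "\<dots> \<le> (2 * c)\<^sup>2 * (LBINT x. (\<phi> x)\<^sup>2)"
      using mollify_L2[OF \<phi>] by (simp add: c_def power2_eq_square)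
    finally have "L2 (\<lambda>x. mollify \<phi> x - c * \<phi> x) \<le> sqrt ((2 * c)\<^sup>2 * (LBINT x. (\<phi> x)\<^sup>2))"
      unfolding L2_def by simp
    also have "\<dots> = 2 * c * L2 \<phi>"
      using c by (simp add: L2_def real_sqrt_mult)
    finally show ?thesis unfolding lap .
  qed
  have L1: "L1 (partial j (partial i ?\<Psi>)) \<le> sqrt (3 ^ CARD('n)) * sqrt (l ^ CARD('n)) * (2 * c *
      L2 \<phi>)" for i j
  proof -
    have "L1 (partial j (partial i ?\<Psi>)) \<le> sqrt (measure lborel ?Q) * L2 (partial j (partial i ?\<Psi>))"
      by (rule L1_le_L2[OF t(2) cube_fmeasurable supp2])
    also have "\<dots> \<le> (sqrt (3 ^ CARD('n)) * sqrt (l ^ CARD('n))) * (2 * c * L2 \<phi>)"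
    proof (intro mult_mono order_trans[OF hessian_L2_le[OF \<Psi>] L2lap])
      have "(l + 2) ^ CARD('n) \<le> (3 * l) ^ CARD('n)"
        using l by (intro power_mono) auto
      then show "sqrt (measure lborel ?Q) \<le> sqrt (3 ^ CARD('n)) * sqrt (l ^ CARD('n))"
        using l by (simp add: measure_cube real_sqrt_mult[symmetric] power_mult_distrib)
    qed (use l in \<open>auto simp: L2_nonneg\<close>)
    finally show ?thesis .
  qed
  have "\<bar>\<l> (\<lambda>x. mollify \<phi> x - c * \<phi> x)\<bar> = \<bar>\<Sum>i\<in>UNIV. \<l> (partial i (partial i ?\<Psi>))\<bar>"
    using sum[of UNIV "\<lambda>i. partial i (partial i ?\<Psi>)"] t by (simp add: lap)
  also have "\<dots> \<le> (\<Sum>i\<in>UNIV. \<bar>\<l> (partial i (partial i ?\<Psi>))\<bar>)"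
    by (rule sum_abs)
  also have "\<dots> \<le> (\<Sum>i\<in>(UNIV::'n set). M * (\<Sum>j\<in>(UNIV::'n set). sqrt (3 ^ CARD('n)) * sqrt (l ^
      CARD('n)) * (2 * c * L2 \<phi>)))"
    by (intro sum_mono order_trans[OF gradient_bound] mult_left_mono L1 bound_nonneg t)
  also have "\<dots> = M * (real CARD('n))\<^sup>2 * sqrt (3 ^ CARD('n)) * (2 * c) * sqrt (l ^ CARD('n)) * L2 \<phi>"
    by (simp add: power2_eq_square)
  finally show ?thesis unfolding c_def .
qed

text \<open>For \<open>\<phi>\<close> of mean zero, the translates of the mollifier in its convolution with \<open>\<phi>\<close> may be
  replaced by their differences to the untranslated one; this writes the convolution as a
  divergence.\<close>

lemma low_frequency_bound:
  assumes \<phi>: "\<phi> \<in> test_functions" and supp: "\<And>x. x \<notin> cube 0 1 \<Longrightarrow> \<phi> x = 0"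
    and mean: "(LBINT x. \<phi> x) = 0"
  shows "\<bar>\<l> (mollify \<phi>)\<bar> \<le> M * (real CARD('n) * (\<Sum>j\<in>UNIV. L1 (partial j (mollifier :: real ^ 'n \<Rightarrow>
      real)))) * L1 \<phi>"
proof -
  let ?m = "mollifier :: real ^ 'n \<Rightarrow> real"
  define w where "w i p = indicator {0..1} (fst p) * (\<phi> (snd p) * (- snd p $ i))" for i and p ::
      "real \<times> (real ^ 'n)"
  let ?h = "\<lambda>p::real \<times> (real ^ 'n). fst p *\<^sub>R snd p"
  have int: "integrable lborel (w i)" for i
    unfolding w_def[abs_def] by (intro segment_integrable \<phi> continuous_intros)
  obtain R where R: "\<And>x. \<phi> x \<noteq> 0 \<Longrightarrow> norm x \<le> R"
    using test_functionsE[OF \<phi>] by blast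
  have wR: "norm (?h p) \<le> R" if "w i p \<noteq> 0" for i p
  proof -
    have *: "0 \<le> fst p" "fst p \<le> 1" "\<phi> (snd p) \<noteq> 0"
      using that by (auto simp: w_def indicator_def split: if_splits)
    have "norm (?h p) \<le> norm (snd p)" using * by (simp add: mult_left_le_one_le)
    then show ?thesis using R[OF *(3)] by simp
  qed
  \<comment> \<open>The vector field with components \<open>?H i\<close> has divergence
    \<open>mollify \<phi>\<close>. Its weights depend on \<open>\<phi>\<close> alone, and every
    derivative falls on the mollifier.\<close>
  let ?H = "\<lambda>i. superpose lborel (w i) ?h ?m"
  have H: "?H i \<in> test_functions" for i
    by (rule superpose_test[OF int segment_map_measurable mollifier_test wR])
  have pH: "partial j (?H i) = superpose lborel (w i) ?h (partial j ?m)" for i j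
    by (rule partial_superpose[OF int segment_map_measurable mollifier_test])
  have "integrable lborel \<phi>" by (rule test_functions_integrable[OF \<phi>])
  have div: "mollify \<phi> x = (\<Sum>i\<in>UNIV. partial i (?H i) x)" for x
  proof -
    have i: "integrable lborel (\<lambda>p. w i p * partial i ?m (x - ?h p))" for i
      by (rule superpose_integrable[OF int segment_map_measurable test_functions_partial[OF
          mollifier_test]])
    have j: "integrable lborel (\<lambda>y. \<phi> y * ?m (x - y))"
      by (rule superpose_integrable[OF test_functions_integrable[OF \<phi>] _ mollifier_test]) auto
    have "(\<Sum>i\<in>UNIV. partial i (?H i) x) = (LBINT p. (\<Sum>i\<in>UNIV. w i p * partial i ?m (x - ?h p)))"
      unfolding pH superpose_def using i by simp
    also have "\<dots> = (LBINT p. indicator {0..1} (fst p) *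
      (\<phi> (snd p) * (\<Sum>i\<in>UNIV. - snd p $ i * partial i ?m (x - fst p *\<^sub>R snd p))))"
      by (simp add: w_def sum_distrib_left mult_ac)
    also have "\<dots> = (LBINT y. \<phi> y * (?m (x - y) - ?m x))"
      by (rule segment_average[OF \<phi> test_functions_smooth[OF mollifier_test]])
    also have "\<dots> = (LBINT y. \<phi> y * ?m (x - y) - \<phi> y * ?m x)"
      by (simp add: algebra_simps)
    also have "\<dots> = (LBINT y. \<phi> y * ?m (x - y))"
      using j \<open>integrable lborel \<phi>\<close> mean by simp
    finally show ?thesis by (simp add: mollify_commute[OF \<phi>] superpose_def)
  qed
  have wL1: "(LBINT p. \<bar>w i p\<bar>) \<le> L1 \<phi>" for i
  proof -
    have int0: "integrable lborel (\<lambda>p. indicator {0..1::real} (fst p) * (\<phi> (snd p) * 1))"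
      by (intro segment_integrable \<phi> continuous_intros)
    have "(LBINT p. \<bar>w i p\<bar>) \<le> (LBINT p. \<bar>indicator {0..1::real} (fst p) * (\<phi> (snd p) * 1)\<bar>)"
    proof (rule integral_mono)
      show "\<bar>w i p\<bar> \<le> \<bar>indicator {0..1} (fst p) * (\<phi> (snd p) * 1)\<bar>" for p
      proof (cases "\<phi> (snd p) = 0")
        case False
        then have "snd p \<in> cube 0 1" using supp by blast
        \<comment> \<open>On the unit cube at the origin, the coordinate factor in the weight costs
          nothing.\<close>
        then have "\<bar>snd p $ i\<bar> \<le> 1" by (simp add: mem_cube abs_le_iff)
        then show ?thesis by (simp add: w_def abs_mult mult_left_le mult_left_mono)
      qed (simp add: w_def)
    qed (use int int0 in auto)
    also have "\<dots> = (LBINT y. LBINT t. \<bar>indicator {0..1::real} t * (\<phi> y * 1)\<bar>)"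
      using lborel_snd[OF integrable_abs[OF int0]] by simp
    also have "\<dots> = (LBINT y. \<bar>\<phi> y\<bar>)"
      by (simp add: abs_mult)
    finally show ?thesis unfolding L1_def .
  qed
  have "\<bar>\<l> (mollify \<phi>)\<bar> = \<bar>\<Sum>i\<in>UNIV. \<l> (partial i (?H i))\<bar>"
    using sum[of UNIV "\<lambda>i. partial i (?H i)"] test_functions_partial[OF H]
    by (simp add: div[symmetric])
  also have "\<dots> \<le> (\<Sum>i\<in>UNIV. \<bar>\<l> (partial i (?H i))\<bar>)"
    by (rule sum_abs)
  also have "\<dots> \<le> (\<Sum>i\<in>(UNIV::'n set). M * (\<Sum>j\<in>UNIV. L1 \<phi> * L1 (partial j ?m)))"
  proof (intro sum_mono order_trans[OF gradient_bound[OF H]] mult_left_mono bound_nonneg)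
    fix i j
    have "L1 (partial j (?H i)) \<le> (LBINT p. \<bar>w i p\<bar>) * L1 (partial j ?m)"
      unfolding pH L1_def
      by (rule superpose_L1[OF int segment_map_measurable test_functions_partial[OF
          mollifier_test] wR sigma_finite_lborel])
    also have "\<dots> \<le> L1 \<phi> * L1 (partial j ?m)"
      by (intro mult_right_mono wL1 L1_nonneg)
    finally show "L1 (partial j (?H i)) \<le> L1 \<phi> * L1 (partial j ?m)" .
  qed
  also have "\<dots> = M * (real CARD('n) * (\<Sum>j\<in>UNIV. L1 (partial j ?m))) * L1 \<phi>"
    by (simp add: sum_distrib_left[symmetric])
  finally show ?thesis .
qed

end

text \<open>The Sobolev estimate for \<open>mollify \<phi>\<close>, with \<open>\<phi>\<close> taken
  as the weight: Young's inequality then bounds all its terms by the L1 norm of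
  \<open>\<phi>\<close> times norms of the fixed mollifier. In contrast to
  \<open>low_frequency_bound\<close>, no mean-zero condition is imposed.\<close>

lemma (in sobolev_bounded) mollify_bound:
  assumes \<phi>: "\<phi> \<in> test_functions"
  shows "\<bar>\<l> (mollify \<phi>)\<bar>
    \<le> M * (L1 (mollifier :: real ^ 'n \<Rightarrow> real) + (\<Sum>i\<in>UNIV. L1 (partial i (mollifier :: real ^ 'n \<Rightarrow>
        real)))) * L1 \<phi>"
proof -
  let ?m = "mollifier :: real ^ 'n \<Rightarrow> real"
  obtain R where R: "\<And>x. \<phi> x \<noteq> 0 \<Longrightarrow> norm x \<le> R"
    using test_functionsE[OF \<phi>] by blast
  have L1: "L1 (superpose lborel \<phi> (\<lambda>y. y) \<psi>) \<le> L1 \<phi> * L1 \<psi>" if "\<psi> \<in> test_functions" for \<psi>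
    unfolding L1_def
    by (rule superpose_L1[OF test_functions_integrable[OF \<phi>] _ that R sigma_finite_lborel]) auto
  have p: "partial i (mollify \<phi>) = superpose lborel \<phi> (\<lambda>y. y) (partial i ?m)" for i
    unfolding mollify_commute[OF \<phi>]
    by (rule partial_superpose[OF test_functions_integrable[OF \<phi>] _ mollifier_test]) auto
  have "\<bar>\<l> (mollify \<phi>)\<bar> \<le> M * (L1 (mollify \<phi>) + (\<Sum>i\<in>UNIV. L1 (partial i (mollify \<phi>))))"
    by (rule sobolev_bound[OF mollify_test[OF \<phi>]])
  also have "\<dots> \<le> M * (L1 \<phi> * L1 ?m + (\<Sum>i\<in>UNIV. L1 \<phi> * L1 (partial i ?m)))"
    unfolding p unfolding mollify_commute[OF \<phi>]
    by (intro mult_left_mono add_mono sum_mono L1 test_functions_partial mollifier_test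
        bound_nonneg)
  also have "\<dots> = M * (L1 (mollifier :: real ^ 'n \<Rightarrow> real) + (\<Sum>i\<in>UNIV. L1 (partial i ?m))) * L1 \<phi>"
    by (simp add: sum_distrib_left[symmetric] algebra_simps)
  finally show ?thesis .
qed

text \<open>\<open>K\<close> is chosen before the functional and before \<open>M\<close>, because
  the bound will be applied to rescaled functionals. At unit side the low-frequency and
  high-frequency estimates combine, and the L1 norm is at most the L2 norm.\<close>

lemma unit_cube_bound:
  "\<exists>K\<ge>0. \<forall>\<l> M. gradient_bounded (\<l> :: (real ^ 'n::finite \<Rightarrow> real) \<Rightarrow> real) M \<longrightarrow> (\<forall>\<phi>\<in>test_functions.
    (\<forall>x. x \<notin> cube 0 1 \<longrightarrow> \<phi> x = 0) \<longrightarrow> (LBINT x. \<phi> x) = 0 \<longrightarrow> \<bar>\<l> \<phi>\<bar> \<le> K * M * L2 \<phi>)"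
proof -
  define c where "c = (LBINT y::real ^ 'n. mollifier y)"
  have c: "c > 0" unfolding c_def by (rule mollifier_integral_pos)
  define A where "A = (real CARD('n))\<^sup>2 * sqrt (3 ^ CARD('n)) * (2 * c)"
  define B where "B = real CARD('n) * (\<Sum>j\<in>UNIV. L1 (partial j (mollifier :: real ^ 'n \<Rightarrow> real)))"
  have AB: "A \<ge> 0" "B \<ge> 0" using c by (auto simp: A_def B_def L1_nonneg sum_nonneg)
  show ?thesis
  proof (intro exI[of _ "(A + B) / c"] conjI allI impI ballI)
    show "(A + B) / c \<ge> 0" using AB c by simp
    fix \<l> :: "(real ^ 'n \<Rightarrow> real) \<Rightarrow> real" and M and \<phi> :: "real ^ 'n \<Rightarrow> real"
    assume "gradient_bounded \<l> M" and \<phi>: "\<phi> \<in> test_functions"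
      and supp: "\<forall>x. x \<notin> cube 0 1 \<longrightarrow> \<phi> x = 0" and mean: "(LBINT x. \<phi> x) = 0"
    interpret gradient_bounded \<l> M by fact
    have "L1 \<phi> \<le> L2 \<phi>"
      using L1_le_L2[OF \<phi> cube_fmeasurable, of 0 1] supp by (simp add: measure_cube)
    have "c * \<bar>\<l> \<phi>\<bar> \<le> \<bar>\<l> (mollify \<phi>)\<bar> + \<bar>\<l> (\<lambda>x. mollify \<phi> x - c * \<phi> x)\<bar>"
      by (rule mollify_split[OF \<phi> c])
    also have "\<dots> \<le> M * B * L1 \<phi> + M * A * L2 \<phi>"
      using low_frequency_bound[OF \<phi> _ mean] high_frequency_bound[OF \<phi>, of 0 1] supp
      by (simp add: A_def B_def c_def mult_ac)
    also have "\<dots> \<le> M * B * L2 \<phi> + M * A * L2 \<phi>"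
      using \<open>L1 \<phi> \<le> L2 \<phi>\<close> AB bound_nonneg by (simp add: mult_left_mono)
    finally show "\<bar>\<l> \<phi>\<bar> \<le> (A + B) / c * M * L2 \<phi>"
      using c by (simp add: field_simps)
  qed
qed

section \<open>From the unit cube to cubes of arbitrary size\<close>

lemma integral_rescale:
  fixes f :: "real ^ 'n::finite \<Rightarrow> real"
  assumes "f \<in> borel_measurable borel" "l > 0"
  shows "(LBINT x. f (l *\<^sub>R x + a)) = (LBINT x. f x) / l ^ CARD('n)"
  using integral_affine[OF assms(1), of l a] assms(2) by (simp add: add.commute)

text \<open>Transport to the unit cube. Composed with the dilation, the functional satisfies the
  gradient estimate with \<open>M * l ^ CARD('n)\<close>: the powers of \<open>l\<close> from the
  derivatives on the two sides cancel and the volume remains. The L2 norm of the transported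
  function gives back the square root of the volume.\<close>

lemma mean_zero_bound:
  "\<exists>K\<ge>0. \<forall>\<l> M. gradient_bounded (\<l> :: (real ^ 'n::finite \<Rightarrow> real) \<Rightarrow> real) M \<longrightarrow>
    (\<forall>\<phi>\<in>test_functions. \<forall>a. \<forall>l>0. (\<forall>x. x \<notin> cube a l \<longrightarrow> \<phi> x = 0) \<longrightarrow> (LBINT x. \<phi> x) = 0 \<longrightarrow>
      \<bar>\<l> \<phi>\<bar> \<le> K * M * sqrt (l ^ CARD('n)) * L2 \<phi>)"
proof -
  obtain K where K: "K \<ge> 0" "\<And>\<l> M \<phi>. \<lbrakk>gradient_bounded (\<l> :: (real ^ 'n \<Rightarrow> real) \<Rightarrow> real) M; \<phi> \<in>
      test_functions;
    \<forall>x. x \<notin> cube 0 1 \<longrightarrow> \<phi> x = 0; (LBINT x. \<phi> x) = 0\<rbrakk> \<Longrightarrow> \<bar>\<l> \<phi>\<bar> \<le> K * M * L2 \<phi>"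
    using unit_cube_bound by blast
  show ?thesis
  proof (intro exI[of _ K] conjI allI impI ballI K(1))
    fix \<l> :: "(real ^ 'n \<Rightarrow> real) \<Rightarrow> real" and M and \<phi> :: "real ^ 'n \<Rightarrow> real" and a :: "real ^ 'n"
        and l :: real
    assume "gradient_bounded \<l> M" and \<phi>: "\<phi> \<in> test_functions" and l: "l > 0"
      and supp: "\<forall>x. x \<notin> cube a l \<longrightarrow> \<phi> x = 0" and mean: "(LBINT x. \<phi> x) = 0"
    interpret gradient_bounded \<l> M by fact
    let ?S = "\<lambda>\<psi> x. \<psi> ((1 / l) *\<^sub>R x + (- (1 / l)) *\<^sub>R a) :: real"
    have S: "?S \<psi> \<in> test_functions" if "\<psi> \<in> test_functions" for \<psi>
      by (rule test_functions_affine[OF that]) (use l in simp)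
    have pS: "partial i (?S \<psi>) = (\<lambda>x. (1 / l) * ?S (partial i \<psi>) x)" if "\<psi> \<in> test_functions" for \<psi> i
      using smooth_affine(2)[OF test_functions_smooth[OF that], of i "1 / l" "(- (1 / l)) *\<^sub>R a"]
      by simp
    have L1S: "L1 (partial i (?S \<psi>)) = l ^ CARD('n) / l * L1 (partial i \<psi>)" if \<psi>: "\<psi> \<in>
        test_functions" for \<psi> i
    proof -
      have "L1 (partial i (?S \<psi>)) = (1 / l) * (LBINT x. \<bar>?S (partial i \<psi>) x\<bar>)"
        unfolding L1_def pS[OF \<psi>] using l by (simp add: abs_mult)
      also have "(LBINT x. \<bar>?S (partial i \<psi>) x\<bar>) = (LBINT x. \<bar>partial i \<psi> x\<bar>) / (1 / l) ^ CARD('n)"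
        by (rule integral_rescale[where f = "\<lambda>x. \<bar>partial i \<psi> x\<bar>"])
          (use l test_functions_borel_measurable[OF test_functions_partial[OF \<psi>]] in auto)
      finally show ?thesis using l by (simp add: L1_def power_one_over field_simps)
    qed
    have gb: "gradient_bounded (\<lambda>\<psi>. \<l> (?S \<psi>)) (M * l ^ CARD('n))"
    proof
      show "\<l> (?S (\<lambda>x. \<psi> x + \<eta> x)) = \<l> (?S \<psi>) + \<l> (?S \<eta>)"
        if "\<psi> \<in> test_functions" "\<eta> \<in> test_functions" for \<psi> \<eta>
        by (rule add[OF S[OF that(1)] S[OF that(2)]])
      show "\<l> (?S (\<lambda>x. c * \<psi> x)) = c * \<l> (?S \<psi>)" if "\<psi> \<in> test_functions" for \<psi> c
        by (rule scale[OF S[OF that]])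
      show "\<bar>\<l> (?S (partial j \<psi>))\<bar> \<le> M * l ^ CARD('n) * (\<Sum>i\<in>UNIV. L1 (partial i \<psi>))"
        if \<psi>: "\<psi> \<in> test_functions" for \<psi> j
      proof -
        have "?S (partial j \<psi>) = (\<lambda>x. l * partial j (?S \<psi>) x)"
          unfolding pS[OF \<psi>] using l by simp
        then have "\<bar>\<l> (?S (partial j \<psi>))\<bar> = l * \<bar>\<l> (partial j (?S \<psi>))\<bar>"
          using scale[OF test_functions_partial[OF S[OF \<psi>]], of l j] l by (simp add: abs_mult)
        also have "\<dots> \<le> l * (M * (\<Sum>i\<in>UNIV. L1 (partial i (?S \<psi>))))"
          using l by (intro mult_left_mono gradient_bound S \<psi>) simp
        also have "\<dots> = M * l ^ CARD('n) * (\<Sum>i\<in>UNIV. L1 (partial i \<psi>))"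
          unfolding L1S[OF \<psi>] using l by (simp add: sum_distrib_left mult.assoc)
        finally show ?thesis .
      qed
      show "M * l ^ CARD('n) \<ge> 0" using bound_nonneg l by simp
    qed
    \<comment> \<open>The transplant of \<open>\<phi>\<close> to the unit cube, undone by
      \<open>?S\<close>.\<close>
    let ?\<phi> = "\<lambda>x. \<phi> (l *\<^sub>R x + a)"
    have eq: "?S ?\<phi> = \<phi>"
      using l by (simp add: scaleR_diff_right)
    have "\<bar>\<l> (?S ?\<phi>)\<bar> \<le> K * (M * l ^ CARD('n)) * L2 ?\<phi>"
    proof (rule K(2)[OF gb])
      show "?\<phi> \<in> test_functions" by (rule test_functions_affine[OF \<phi>]) (use l in simp)
      show "\<forall>x. x \<notin> cube 0 1 \<longrightarrow> ?\<phi> x = 0"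
      proof (intro allI impI)
        fix x :: "real ^ 'n" assume "x \<notin> cube 0 1"
        then have "l *\<^sub>R x + a \<notin> cube a l"
          using l by (auto simp: mem_cube zero_le_mult_iff mult_le_cancel_left1)
        with supp show "?\<phi> x = 0" by blast
      qed
      show "(LBINT x. ?\<phi> x) = 0"
        using integral_rescale[OF test_functions_borel_measurable[OF \<phi>] l, of a] mean by simp
    qed
    also have "L2 ?\<phi> = L2 \<phi> / sqrt (l ^ CARD('n))"
      using integral_rescale[of "\<lambda>x. (\<phi> x)\<^sup>2" l a] test_functions_borel_measurable[OF
          test_functions_power2[OF \<phi>]] l
      by (simp add: L2_def real_sqrt_divide)
    also have "K * (M * l ^ CARD('n)) * (L2 \<phi> / sqrt (l ^ CARD('n))) 
        = K * M * (l ^ CARD('n) / sqrt (l ^ CARD('n))) * L2 \<phi>" by simp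
    also have "l ^ CARD('n) / sqrt (l ^ CARD('n)) = sqrt (l ^ CARD('n))"
      using l by (intro real_div_sqrt) simp
    finally show "\<bar>\<l> \<phi>\<bar> \<le> K * M * sqrt (l ^ CARD('n)) * L2 \<phi>" unfolding eq .
  qed
qed

text \<open>Here the low-frequency part is handled by \<open>mollify_bound\<close> in place of the
  divergence form, so the mean of \<open>\<phi>\<close> is arbitrary. Everything is done at scale 1
  without dilation, whence \<open>l \<ge> 1\<close>.\<close>

lemma large_cube_bound:
  "\<exists>K\<ge>0. \<forall>\<l> M. sobolev_bounded (\<l> :: (real ^ 'n::finite \<Rightarrow> real) \<Rightarrow> real) M \<longrightarrow>
    (\<forall>\<phi>\<in>test_functions. \<forall>a. \<forall>l\<ge>1. (\<forall>x. x \<notin> cube a l \<longrightarrow> \<phi> x = 0) \<longrightarrow>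
      \<bar>\<l> \<phi>\<bar> \<le> K * M * sqrt (l ^ CARD('n)) * L2 \<phi>)"
proof -
  define c where "c = (LBINT y::real ^ 'n. mollifier y)"
  have c: "c > 0" unfolding c_def by (rule mollifier_integral_pos)
  define A where "A = (real CARD('n))\<^sup>2 * sqrt (3 ^ CARD('n)) * (2 * c)"
  define B where "B = L1 (mollifier :: real ^ 'n \<Rightarrow> real) + (\<Sum>i\<in>UNIV. L1 (partial i (mollifier ::
      real ^ 'n \<Rightarrow> real)))"
  have AB: "A \<ge> 0" "B \<ge> 0" using c by (auto simp: A_def B_def L1_nonneg sum_nonneg)
  show ?thesis
  proof (intro exI[of _ "(A + B) / c"] conjI allI impI ballI)
    show "(A + B) / c \<ge> 0" using AB c by simp
    fix \<l> :: "(real ^ 'n \<Rightarrow> real) \<Rightarrow> real" and M and \<phi> :: "real ^ 'n \<Rightarrow> real" and a :: "real ^ 'n"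
        and l :: real
    assume "sobolev_bounded \<l> M" and \<phi>: "\<phi> \<in> test_functions" and l: "l \<ge> 1"
      and supp: "\<forall>x. x \<notin> cube a l \<longrightarrow> \<phi> x = 0"
    interpret sobolev_bounded \<l> M by fact
    have L1: "L1 \<phi> \<le> sqrt (l ^ CARD('n)) * L2 \<phi>"
      using L1_le_L2[OF \<phi> cube_fmeasurable, of a l] supp l by (simp add: measure_cube)
    have "c * \<bar>\<l> \<phi>\<bar> \<le> \<bar>\<l> (mollify \<phi>)\<bar> + \<bar>\<l> (\<lambda>x. mollify \<phi> x - c * \<phi> x)\<bar>"
      by (rule mollify_split[OF \<phi> c])
    also have "\<dots> \<le> M * B * L1 \<phi> + M * A * (sqrt (l ^ CARD('n)) * L2 \<phi>)"
      using mollify_bound[OF \<phi>] high_frequency_bound[OF \<phi>, of a l] supp l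
      by (simp add: A_def B_def c_def mult_ac)
    also have "\<dots> \<le> M * B * (sqrt (l ^ CARD('n)) * L2 \<phi>) + M * A * (sqrt (l ^ CARD('n)) * L2 \<phi>)"
      using L1 AB bound_nonneg by (simp add: mult_left_mono)
    finally show "\<bar>\<l> \<phi>\<bar> \<le> (A + B) / c * M * sqrt (l ^ CARD('n)) * L2 \<phi>"
      using c by (simp add: field_simps)
  qed
qed

section \<open>Duality\<close>

text \<open>Since \<open>ennreal\<close> sends negative numbers to 0, the densities
  \<open>ennreal (G x)\<close> and \<open>ennreal (- G x)\<close> are the positive and negative
  parts of \<open>G\<close>. The two measures agree on boxes, an intersection-stable generator of
  the Borel sets, hence on all Borel sets.\<close>

lemma AE_zero_if_integral_boxes_zero:
  fixes G :: "'a::euclidean_space \<Rightarrow> real"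
  assumes G: "integrable lborel G" and box: "\<And>c d. (LBINT x. indicator (box c d) x * G x) = 0"
  shows "AE x in lborel. G x = 0"
proof -
  have [measurable]: "G \<in> borel_measurable borel" using G by auto
  have intA: "integrable lborel (\<lambda>x. indicator A x * G x)" if "A \<in> sets borel" for A
    using integrable_mult_indicator[of A lborel G] that G by simp
  have inj: "enn2real a = enn2real b \<longleftrightarrow> a = b" if "a \<noteq> \<infinity>" "b \<noteq> \<infinity>" for a b
    using that by (cases a; cases b) auto
  have zero_iff: "(LBINT x. indicator A x * G x) = 0 \<longleftrightarrow>
    (\<integral>\<^sup>+x. ennreal (G x) * indicator A x \<partial>lborel) = (\<integral>\<^sup>+x. ennreal (- G x) * indicator A x \<partial>lborel)"
    if A: "A \<in> sets borel" for A
  proof -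
    have e: "(\<integral>\<^sup>+x. ennreal (indicator A x * G x) \<partial>lborel) = (\<integral>\<^sup>+x. ennreal (G x) * indicator A x
        \<partial>lborel)"
      "(\<integral>\<^sup>+x. ennreal (- (indicator A x * G x)) \<partial>lborel) = (\<integral>\<^sup>+x. ennreal (- G x) * indicator A x
          \<partial>lborel)"
      by (intro nn_integral_cong; simp split: split_indicator)+
    have fin: "(\<integral>\<^sup>+x. ennreal (indicator A x * G x) \<partial>lborel) \<noteq> \<infinity>"
      "(\<integral>\<^sup>+x. ennreal (- (indicator A x * G x)) \<partial>lborel) \<noteq> \<infinity>"
      using intA[OF A] unfolding real_integrable_def by auto
    have "(LBINT x. indicator A x * G x) = 0 \<longleftrightarrow>
        enn2real (\<integral>\<^sup>+x. ennreal (indicator A x * G x) \<partial>lborel) = enn2real (\<integral>\<^sup>+x. ennreal (-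
            (indicator A x * G x)) \<partial>lborel)"
      by (subst real_lebesgue_integral_def[OF intA[OF A]]) auto
    also have "\<dots> \<longleftrightarrow> (\<integral>\<^sup>+x. ennreal (indicator A x * G x) \<partial>lborel) = (\<integral>\<^sup>+x. ennreal (- (indicator A
        x * G x)) \<partial>lborel)"
      by (rule inj[OF fin])
    finally show ?thesis unfolding e .
  qed
  have "density lborel (\<lambda>x. ennreal (G x)) = density lborel (\<lambda>x. ennreal (- G x))"
  proof (rule measure_eqI_generator_eq)
    let ?E = "range (\<lambda>(a, b). box a b::'a set)"
    show "Int_stable ?E" by (auto simp: Int_stable_def box_Int_box)
    show "?E \<subseteq> Pow UNIV" "sets (density lborel (\<lambda>x. ennreal (G x))) = sigma_sets UNIV ?E"
      "sets (density lborel (\<lambda>x. ennreal (- G x))) = sigma_sets UNIV ?E"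
      by (simp_all add: borel_eq_box)
    let ?A = "\<lambda>n::nat. box (- (real n *\<^sub>R One)) (real n *\<^sub>R One) :: 'a set"
    show "range ?A \<subseteq> ?E" "(\<Union>i. ?A i) = UNIV"
      unfolding UN_box_eq_UNIV by auto
    show "emeasure (density lborel (\<lambda>x. ennreal (G x))) (?A i) \<noteq> \<infinity>" for i
    proof -
      have "(\<integral>\<^sup>+x. ennreal (G x) * indicator (?A i) x \<partial>lborel) \<le> (\<integral>\<^sup>+x. ennreal (G x) \<partial>lborel)"
        by (intro nn_integral_mono) (simp split: split_indicator)
      also have "\<dots> < \<infinity>" using G unfolding real_integrable_def by (auto simp: top.not_eq_extremum)
      finally show ?thesis by (simp add: emeasure_density)
    qed
    show "emeasure (density lborel (\<lambda>x. ennreal (G x))) X = emeasure (density lborel (\<lambda>x. ennreal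
        (- G x))) X"
      if "X \<in> ?E" for X
    proof -
      from that obtain c d where X: "X = box c d" by auto
      have "(\<integral>\<^sup>+x. ennreal (G x) * indicator X x \<partial>lborel) = (\<integral>\<^sup>+x. ennreal (- G x) * indicator X
          x \<partial>lborel)"
        using zero_iff[of X] box[of c d] by (simp add: X)
      then show ?thesis by (simp add: emeasure_density X)
    qed
  qed
  then have "(\<integral>\<^sup>+x. ennreal (G x) * indicator A x \<partial>lborel) = (\<integral>\<^sup>+x. ennreal (- G x) * indicator A
      x \<partial>lborel)"
    if "A \<in> sets borel" for A
    using that emeasure_density[of "\<lambda>x. ennreal (G x)" lborel A] emeasure_density[of "\<lambda>x. ennreal
        (- G x)" lborel A]
    by simp
  then have "(LBINT x. indicator A x * G x) = 0" if "A \<in> sets borel" for A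
    using zero_iff that by blast
  then show ?thesis
    by (intro sigma_finite_measure.density_zero[OF sigma_finite_lborel G]) (simp add:
        set_lebesgue_integral_def)
qed

text \<open>The fundamental lemma of the calculus of variations: box bumps approximate indicators of
  boxes boundedly, so orthogonality to test functions passes to indicators.\<close>

lemma AE_zero_if_orthogonal:
  fixes F :: "real ^ 'n::finite \<Rightarrow> real"
  assumes F: "integrable lborel (\<lambda>x. indicator (cbox a b) x * F x)" and [measurable]: "F \<in>
      borel_measurable borel"
    and orth: "\<And>\<phi>. \<phi> \<in> test_functions \<Longrightarrow> (\<And>x. x \<notin> cbox a b \<Longrightarrow> \<phi> x = 0) \<Longrightarrow> (LBINT x. F x * \<phi> x) = 0"
  shows "AE x in lborel. x \<in> cbox a b \<longrightarrow> F x = 0"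
proof -
  \<comment> \<open>The open box, because its intersection with a box is again a box that carries
    bumps; the boundary is a null set.\<close>
  define G where "G x = indicator (box a b) x * F x" for x
  have G: "integrable lborel G"
  proof (rule Bochner_Integration.integrable_bound[OF F])
    show "AE x in lborel. norm (G x) \<le> norm (indicator (cbox a b) x * F x)"
      unfolding G_def using box_subset_cbox by (intro AE_I2) (auto simp: indicator_def)
  qed (simp add: G_def[abs_def])
  have "AE x in lborel. G x = 0"
  proof (rule AE_zero_if_integral_boxes_zero[OF G])
    fix c d :: "real ^ 'n"
    obtain p q where pq: "box a b \<inter> box c d = box p q" using box_Int_box by blast
    let ?B = "\<lambda>n. box_bump p q (real (Suc n))"
    have "(\<lambda>n. LBINT x. F x * ?B n x) \<longlonglongrightarrow> (LBINT x. F x * indicator (box p q) x)"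
    proof (rule integral_dominated_convergence[where w = "\<lambda>x. \<bar>indicator (cbox a b) x * F x\<bar>"])
      have [measurable]: "?B n \<in> borel_measurable borel" for n
        by (rule test_functions_borel_measurable[OF box_bump_test]) simp
      show "(\<lambda>x. F x * ?B n x) \<in> borel_measurable lborel" for n by measurable
      show "AE x in lborel. (\<lambda>n. F x * ?B n x) \<longlonglongrightarrow> F x * indicator (box p q) x"
        by (intro AE_I2 tendsto_mult tendsto_const box_bump_tendsto)
      show "AE x in lborel. norm (F x * ?B n x) \<le> \<bar>indicator (cbox a b) x * F x\<bar>" for n
      proof (rule AE_I2)
        fix x
        show "norm (F x * ?B n x) \<le> \<bar>indicator (cbox a b) x * F x\<bar>"
        proof (cases "x \<in> box p q")
          case True
          then have "x \<in> cbox a b" using pq box_subset_cbox by blast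
          then show ?thesis using box_bump_le_1[of p q "real (Suc n)" x] box_bump_nonneg[of p q
              "real (Suc n)" x]
            by (simp add: abs_mult mult_left_le)
        qed (simp add: box_bump_zero)
      qed
      show "integrable lborel (\<lambda>x. \<bar>indicator (cbox a b) x * F x\<bar>)" using F by simp
    qed measurable
    moreover have "(LBINT x. F x * ?B n x) = 0" for n
    proof (rule orth[OF box_bump_test])
      show "?B n x = 0" if "x \<notin> cbox a b" for x
        using that pq box_subset_cbox[of a b] by (intro box_bump_zero) auto
    qed simp
    ultimately have "(LBINT x. F x * indicator (box p q) x) = 0"
      using LIMSEQ_unique[OF _ tendsto_const] by simp
    also have "(\<lambda>x. F x * indicator (box p q) x) = (\<lambda>x. indicator (box c d) x * G x)"
      unfolding pq[symmetric] G_def by (auto simp: fun_eq_iff split: split_indicator)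
    finally show "(LBINT x. indicator (box c d) x * G x) = 0" .
  qed
  moreover have "AE x in lborel. x \<notin> cbox a b - box a b"
    by (rule AE_not_in[OF null_sets_cbox_Diff_box])
  ultimately show ?thesis
    by eventually_elim (auto simp: G_def)
qed

text \<open>By minimising \<open>\<parallel>\<phi>\<parallel>\<^sup>2 - 2 \<l>(\<phi>)\<close> over \<open>V\<close>.\<close>

lemma Riesz_test_functions:
  fixes V :: "(real ^ 'n::finite \<Rightarrow> real) set" and \<l> :: "(real ^ 'n \<Rightarrow> real) \<Rightarrow> real"
  assumes V: "V \<subseteq> test_functions" and V0: "(\<lambda>x. 0) \<in> V"
    and Vadd: "\<And>\<phi> \<psi>. \<phi> \<in> V \<Longrightarrow> \<psi> \<in> V \<Longrightarrow> (\<lambda>x. \<phi> x + \<psi> x) \<in> V"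
    and Vscale: "\<And>c \<phi>. \<phi> \<in> V \<Longrightarrow> (\<lambda>x. c * \<phi> x) \<in> V"
    and S: "S \<in> fmeasurable lborel" and VS: "\<And>\<phi> x. \<phi> \<in> V \<Longrightarrow> x \<notin> S \<Longrightarrow> \<phi> x = 0"
    and add: "\<And>\<phi> \<psi>. \<phi> \<in> V \<Longrightarrow> \<psi> \<in> V \<Longrightarrow> \<l> (\<lambda>x. \<phi> x + \<psi> x) = \<l> \<phi> + \<l> \<psi>"
    and scale: "\<And>c \<phi>. \<phi> \<in> V \<Longrightarrow> \<l> (\<lambda>x. c * \<phi> x) = c * \<l> \<phi>"
    and bound: "\<And>\<phi>. \<phi> \<in> V \<Longrightarrow> \<bar>\<l> \<phi>\<bar> \<le> A * L2 \<phi>" and A: "A \<ge> 0"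
  obtains g where "integrable lborel g" "\<And>x. x \<notin> S \<Longrightarrow> g x = 0"
    "\<And>\<phi>. \<phi> \<in> V \<Longrightarrow> \<l> \<phi> = (LBINT x. g x * \<phi> x)"
    "(LBINT x. \<bar>g x\<bar>) \<le> sqrt (measure lborel S) * (2 * A)"
proof -
  define J where "J \<phi> = (L2 \<phi>)\<^sup>2 - 2 * \<l> \<phi>" for \<phi>
  have L2sq: "(L2 \<phi>)\<^sup>2 = (LBINT x. (\<phi> x)\<^sup>2)" for \<phi> :: "real ^ 'n \<Rightarrow> real"
    by (simp add: L2_def Bochner_Integration.integral_nonneg)
  have int2: "integrable lborel (\<lambda>x. \<phi> x * \<psi> x)" if "\<phi> \<in> V" "\<psi> \<in> V" for \<phi> \<psi>
    using that V by (intro test_functions_integrable test_functions_mult(1)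
        test_functions_smooth) auto
  have L2add: "(L2 (\<lambda>x. \<phi> x + t * \<psi> x))\<^sup>2 = (L2 \<phi>)\<^sup>2 + 2 * t * (LBINT x. \<phi> x * \<psi> x) + t\<^sup>2 * (L2
      \<psi>)\<^sup>2"
    if "\<phi> \<in> V" "\<psi> \<in> V" for \<phi> \<psi> t
  proof -
    have "(L2 (\<lambda>x. \<phi> x + t * \<psi> x))\<^sup>2
        = (LBINT x. \<phi> x * \<phi> x + 2 * t * (\<phi> x * \<psi> x) + t\<^sup>2 * (\<psi> x * \<psi> x))"
      unfolding L2sq by (intro Bochner_Integration.integral_cong) (auto simp: power2_eq_square
          algebra_simps)
    also have "\<dots> = (L2 \<phi>)\<^sup>2 + 2 * t * (LBINT x. \<phi> x * \<psi> x) + t\<^sup>2 * (L2 \<psi>)\<^sup>2"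
      unfolding L2sq using int2 that by (simp add: power2_eq_square)
    finally show ?thesis .
  qed
  \<comment> \<open>Along a line \<open>J\<close> is a quadratic polynomial in \<open>t\<close>.
    Comparing its values with the infimum yields both the Cauchy property of a minimising sequence
    and the representation in the limit.\<close>
  have Jadd: "J (\<lambda>x. \<phi> x + t * \<psi> x) = J \<phi> + 2 * t * ((LBINT x. \<phi> x * \<psi> x) - \<l> \<psi>) + t\<^sup>2 * (L2 \<psi>)\<^sup>2"
    if "\<phi> \<in> V" "\<psi> \<in> V" for \<phi> \<psi> t
    unfolding J_def L2add[OF that] add[OF that(1) Vscale[OF that(2)]] scale[OF that(2)]
    by (simp add: algebra_simps)
  have Jlow: "J \<phi> \<ge> - A\<^sup>2" if "\<phi> \<in> V" for \<phi>
  proof -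
    have "\<l> \<phi> \<le> A * L2 \<phi>" using bound[OF that] by linarith
    moreover have "0 \<le> (L2 \<phi> - A)\<^sup>2" by simp
    ultimately show ?thesis by (simp add: J_def power2_eq_square algebra_simps)
  qed
  define m where "m = Inf (J ` V)"
  have bdd: "bdd_below (J ` V)" using Jlow by (auto intro!: bdd_belowI[where m = "- A\<^sup>2"])
  have m_le: "m \<le> J \<phi>" if "\<phi> \<in> V" for \<phi>
    unfolding m_def using that bdd by (intro cInf_lower) auto
  \<comment> \<open>The geometric rate makes the norms of consecutive differences summable, so the
    minimising sequence itself converges almost everywhere, without passing to a
    subsequence.\<close>
  have "\<forall>n::nat. \<exists>\<phi>. \<phi> \<in> V \<and> J \<phi> < m + (1 / 4) ^ n"
  proof
    fix n :: nat
    have "Inf (J ` V) < m + (1 / 4) ^ n" by (simp add: m_def)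
    then obtain y where "y \<in> J ` V" "y < m + (1 / 4) ^ n"
      using cInf_lessD[of "J ` V"] V0 by blast
    then show "\<exists>\<phi>. \<phi> \<in> V \<and> J \<phi> < m + (1 / 4) ^ n" by blast
  qed
  from choice[OF this] obtain f where f: "\<And>n. f n \<in> V" "\<And>n. J (f n) < m + (1 / 4) ^ n" by blast
  have ft: "f n \<in> test_functions" for n using f(1) V by blast
  note dec = f(2)

  define s where "s n x = f (Suc n) x - f n x" for n x
  have sV: "s n \<in> V" for n
    using Vadd[OF f(1)[of "Suc n"] Vscale[OF f(1)[of n], of "-1"]] by (simp add: s_def[abs_def])
  have st: "s n \<in> test_functions" for n using sV V by blast
  \<comment> \<open>The parallelogram argument: the value of \<open>J\<close> at the midpoint of
    \<open>f n\<close> and \<open>f (Suc n)\<close> is at least \<open>m\<close>, and eliminating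
    the linear term \<open>d\<close> bounds the quadratic one by the excess of \<open>J\<close> over
    \<open>m\<close> at the two ends.\<close>
  have s_bound: "L2 (s n) \<le> 2 * (1 / 2) ^ n" for n
  proof -
    define d where "d = (LBINT x. f n x * s n x) - \<l> (s n)"
    have "f (Suc n) = (\<lambda>x. f n x + 1 * s n x)" by (simp add: s_def fun_eq_iff)
    then have J1: "J (f (Suc n)) = J (f n) + 2 * d + (L2 (s n))\<^sup>2"
      using Jadd[OF f(1) sV, of n 1 n] by (simp add: d_def)
    have "m \<le> J (\<lambda>x. f n x + (1 / 2) * s n x)"
      by (rule m_le[OF Vadd[OF f(1) Vscale[OF sV]]])
    then have J2: "m \<le> J (f n) + d + (L2 (s n))\<^sup>2 / 4"
      using Jadd[OF f(1) sV, of n "1 / 2" n] by (simp add: d_def power2_eq_square)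
    have "(L2 (s n))\<^sup>2 \<le> 2 * (1 / 4) ^ n + 2 * (1 / 4) ^ Suc n"
      using J1 J2 dec[of n] dec[of "Suc n"] by simp
    also have "\<dots> \<le> (2 * (1 / 2) ^ n)\<^sup>2"
      by (simp add: power_mult_distrib power_mult[symmetric] mult.commute[of n] )
        (simp add: power_mult power2_eq_square)
    finally show ?thesis by (rule power2_le_imp_le) simp
  qed
  \<comment> \<open>The finite measure of \<open>S\<close> turns the L2 rate into an L1 rate, so the
    limit can be taken as an absolutely convergent series in L1.\<close>
  have s_L1: "(LBINT x. norm (s n x)) \<le> 2 * sqrt (measure lborel S) * (1 / 2) ^ n" for n
  proof -
    have "(LBINT x. norm (s n x)) \<le> sqrt (measure lborel S) * L2 (s n)"
      using L1_le_L2[OF st S VS[OF sV]] by (simp add: L1_def)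
    also have "\<dots> \<le> sqrt (measure lborel S) * (2 * (1 / 2) ^ n)"
      by (intro mult_left_mono s_bound) simp
    finally show ?thesis by (simp add: mult_ac)
  qed
  have s_int: "integrable lborel (s n)" for n by (rule test_functions_integrable[OF st])
  then have [measurable]: "s n \<in> borel_measurable borel" for n by auto
  have summ: "summable (\<lambda>n. LBINT x. norm (s n x))"
    by (rule summable_comparison_test'[where g = "\<lambda>n. 2 * sqrt (measure lborel S) * (1 / 2) ^ n"])
      (use s_L1 in \<open>auto simp: Bochner_Integration.integral_nonneg intro!: summable_mult
          summable_geometric\<close>)
  have AEs: "AE x in lborel. summable (\<lambda>n. norm (s n x))"
  proof -
    have "(\<integral>\<^sup>+x. (\<Sum>n. ennreal (norm (s n x))) \<partial>lborel) = (\<Sum>n. \<integral>\<^sup>+x. ennreal (norm (s n x)) \<partial>lborel)"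
      by (rule nn_integral_suminf) auto
    also have "\<dots> = (\<Sum>n. ennreal (LBINT x. norm (s n x)))"
      by (intro suminf_cong nn_integral_eq_integral) (use s_int in auto)
    also have "\<dots> \<noteq> \<infinity>"
      using summ by (simp add: suminf_ennreal2 Bochner_Integration.integral_nonneg)
    finally have "AE x in lborel. (\<Sum>n. ennreal (norm (s n x))) \<noteq> \<infinity>"
      by (intro nn_integral_PInf_AE) auto
    then show ?thesis
      by eventually_elim (auto intro!: summable_suminf_not_top)
  qed
  \<comment> \<open>The telescoping series of the sequence; \<open>w\<close> dominates all its
    partial sums. Every term is 0 outside \<open>S\<close>, so \<open>g\<close> vanishes there
    everywhere and not just almost everywhere.\<close>
  define g where "g x = f 0 x + (\<Sum>n. s n x)" for x
  define w where "w x = \<bar>f 0 x\<bar> + (\<Sum>n. norm (s n x))" for x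
  have g_int: "integrable lborel g"
    unfolding g_def[abs_def]
    by (rule Bochner_Integration.integrable_add[OF test_functions_integrable[OF ft]
        integrable_suminf[OF s_int AEs summ]])
  have w_int: "integrable lborel w"
    unfolding w_def[abs_def]
  proof (rule Bochner_Integration.integrable_add)
    show "integrable lborel (\<lambda>x. \<bar>f 0 x\<bar>)"
      by (intro integrable_abs test_functions_integrable ft)
    show "integrable lborel (\<lambda>x. \<Sum>n. norm (s n x))"
      by (rule integrable_suminf[where f = "\<lambda>n x. norm (s n x)"]) (use s_int AEs summ in simp_all)
  qed
  have partial_sums: "f N x = f 0 x + (\<Sum>n<N. s n x)" for N x
    by (induction N) (simp_all add: s_def)
  have lim: "AE x in lborel. (\<lambda>N. f N x) \<longlonglongrightarrow> g x \<and> (\<forall>N. \<bar>f N x\<bar> \<le> w x)"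
    using AEs
  proof eventually_elim
    case (elim x)
    have "(\<lambda>N. f 0 x + (\<Sum>n<N. s n x)) \<longlonglongrightarrow> f 0 x + (\<Sum>n. s n x)"
      by (intro tendsto_add tendsto_const summable_LIMSEQ[OF summable_norm_cancel[OF elim]])
    moreover have "\<bar>f N x\<bar> \<le> w x" for N
    proof -
      have "\<bar>f N x\<bar> \<le> \<bar>f 0 x\<bar> + (\<Sum>n<N. norm (s n x))"
        unfolding partial_sums[of N x] real_norm_def
        by (rule order_trans[OF abs_triangle_ineq]) (intro add_left_mono sum_abs)
      also have "(\<Sum>n<N. norm (s n x)) \<le> (\<Sum>n. norm (s n x))"
        by (rule sum_le_suminf[OF elim]) auto
      finally show ?thesis by (simp add: w_def)
    qed
    ultimately show ?case by (simp add: g_def partial_sums[symmetric])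
  qed
  have [measurable]: "f n \<in> borel_measurable borel" "g \<in> borel_measurable borel" for n
    using test_functions_borel_measurable[OF ft] g_int by auto
  show thesis
  proof (rule that[OF g_int])
    show "g x = 0" if "x \<notin> S" for x
      using VS[OF f(1) that] VS[OF sV that] by (simp add: g_def)
    show "\<l> \<psi> = (LBINT x. g x * \<psi> x)" if \<psi>: "\<psi> \<in> V" for \<psi>
    proof -
      have [measurable]: "\<psi> \<in> borel_measurable borel"
        using \<psi> V test_functions_borel_measurable by blast
      obtain B where B: "\<And>x. norm (\<psi> x) \<le> B"
        using test_functions_bounded[of \<psi>] \<psi> V by blast
      have "(\<lambda>n. LBINT x. f n x * \<psi> x) \<longlonglongrightarrow> (LBINT x. g x * \<psi> x)"
      proof (rule integral_dominated_convergence[where w = "\<lambda>x. w x * B"])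
        show "AE x in lborel. (\<lambda>n. f n x * \<psi> x) \<longlonglongrightarrow> g x * \<psi> x"
          using lim by eventually_elim (auto intro: tendsto_mult)
        show "AE x in lborel. norm (f n x * \<psi> x) \<le> w x * B" for n
          using lim
        proof eventually_elim
          case (elim x)
          then have "\<bar>f n x\<bar> \<le> w x" by blast
          moreover have "\<bar>\<psi> x\<bar> \<le> B" using B[of x] by simp
          ultimately show ?case unfolding real_norm_def abs_mult
            by (intro mult_mono) auto
        qed
      qed (use w_int in auto)
      moreover have "(\<lambda>n. LBINT x. f n x * \<psi> x) \<longlonglongrightarrow> \<l> \<psi>"
      proof -
        define q where "q = (L2 \<psi>)\<^sup>2"
        have q: "q \<ge> 0" by (simp add: q_def)
        have est: "\<bar>(LBINT x. f n x * \<psi> x) - \<l> \<psi>\<bar> \<le> sqrt (q + 1) * (1 / 2) ^ n" for n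
        proof -
          define d where "d = (LBINT x. f n x * \<psi> x) - \<l> \<psi>"
          \<comment> \<open>Nearly the minimiser of the quadratic in \<open>t\<close>; the added 1
            keeps it defined when \<open>\<psi>\<close> has norm 0.\<close>
          define t where "t = - d / (q + 1)"
          have "m \<le> J (\<lambda>x. f n x + t * \<psi> x)"
            by (rule m_le[OF Vadd[OF f(1) Vscale[OF \<psi>]]])
          then have "0 \<le> (1 / 4) ^ n + 2 * t * d + t\<^sup>2 * q"
            using Jadd[OF f(1) \<psi>, of n t] dec[of n] by (simp add: d_def q_def)
          also have "t\<^sup>2 * q \<le> t\<^sup>2 * (q + 1)" by (simp add: mult_left_mono)
          also have "t\<^sup>2 * (q + 1) = - t * d"
            using q by (simp add: t_def power2_eq_square)
          finally have "- t * d \<le> (1 / 4) ^ n" by (simp add: mult.commute)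
          then have "d\<^sup>2 \<le> (q + 1) * (1 / 4) ^ n"
            using q by (simp add: t_def power2_eq_square field_simps)
          also have "\<dots> = (sqrt (q + 1) * (1 / 2) ^ n)\<^sup>2"
            using q by (simp add: power_mult_distrib power_mult[symmetric] mult.commute[of n])
              (simp add: power_mult power2_eq_square)
          finally have "\<bar>d\<bar> \<le> sqrt (q + 1) * (1 / 2) ^ n"
            using q by (intro power2_le_imp_le[of "\<bar>d\<bar>"]) simp_all
          then show ?thesis by (simp add: d_def)
        qed
        have "(\<lambda>n. (LBINT x. f n x * \<psi> x) - \<l> \<psi>) \<longlonglongrightarrow> 0"
        proof (rule Lim_null_comparison)
          show "\<forall>\<^sub>F n in sequentially. norm ((LBINT x. f n x * \<psi> x) - \<l> \<psi>) \<le> sqrt (q + 1) * (1 /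
              2) ^ n"
            using est by simp
          show "(\<lambda>n. sqrt (q + 1) * (1 / 2) ^ n) \<longlonglongrightarrow> 0"
            by (intro tendsto_mult_right_zero LIMSEQ_power_zero) simp
        qed
        then show ?thesis by (simp add: LIM_zero_iff)
      qed
      ultimately show ?thesis by (rule LIMSEQ_unique[rotated])
    qed
    show "(LBINT x. \<bar>g x\<bar>) \<le> sqrt (measure lborel S) * (2 * A)"
    proof (rule LIMSEQ_le)
      show "(\<lambda>n. LBINT x. \<bar>f n x\<bar>) \<longlonglongrightarrow> (LBINT x. \<bar>g x\<bar>)"
      proof (rule integral_dominated_convergence[where w = w])
        show "AE x in lborel. (\<lambda>n. \<bar>f n x\<bar>) \<longlonglongrightarrow> \<bar>g x\<bar>"
          using lim by eventually_elim (auto intro: tendsto_rabs)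
        show "AE x in lborel. norm \<bar>f n x\<bar> \<le> w x" for n
          using lim by eventually_elim auto
      qed (use w_int in auto)
      have "(\<lambda>n. sqrt (measure lborel S) * (2 * A + (1 / 2) ^ n)) \<longlonglongrightarrow> sqrt (measure lborel S) * (2
          * A + 0)"
        by (intro tendsto_intros LIMSEQ_power_zero) simp
      then show "(\<lambda>n. sqrt (measure lborel S) * (2 * A + (1 / 2) ^ n)) \<longlonglongrightarrow> sqrt (measure lborel S)
          * (2 * A)"
        by simp
      have "(LBINT x. \<bar>f n x\<bar>) \<le> sqrt (measure lborel S) * (2 * A + (1 / 2) ^ n)" for n
      proof -
        \<comment> \<open>Comparison with the zero function gives
          \<open>J (f n) < (1 / 4) ^ n\<close>. As \<open>J\<close> is at least the squared norm
          minus \<open>2 * A\<close> times the norm, the norm cannot exceed \<open>r\<close>; this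
          is the origin of the factor 2.\<close>
        define r where "r = 2 * A + (1 / 2) ^ n"
        have "L2 (f n) \<le> r"
        proof (rule ccontr)
          assume "\<not> L2 (f n) \<le> r"
          then have "L2 (f n) > r" by simp
          have "\<l> (\<lambda>x. 0) = 0" using scale[OF V0, of 0] by simp
          then have "J (\<lambda>x. 0) = 0" by (simp add: J_def L2_def)
          then have "J (f n) < (1 / 4) ^ n" using m_le[OF V0] dec[of n] by simp
          then have "(L2 (f n))\<^sup>2 - 2 * A * L2 (f n) < (1 / 4) ^ n"
            using bound[OF f(1)[of n]] by (simp add: J_def)
          moreover have "(1 / 2) ^ n * (1 / 2) ^ n \<le> L2 (f n) * (L2 (f n) - 2 * A)"
            using \<open>L2 (f n) > r\<close> A by (intro mult_mono) (auto simp: r_def L2_nonneg)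
          moreover have "(1 / 2 :: real) ^ n * (1 / 2) ^ n = (1 / 4) ^ n"
            by (simp add: power_mult_distrib[symmetric])
          ultimately show False by (simp add: power2_eq_square algebra_simps)
        qed
        then have "sqrt (measure lborel S) * L2 (f n) \<le> sqrt (measure lborel S) * r"
          by (intro mult_left_mono) auto
        then show ?thesis using L1_le_L2[OF ft[of n] S VS[OF f(1)]] by (simp add: L1_def r_def)
      qed
      then show "\<exists>N. \<forall>n\<ge>N. (LBINT x. \<bar>f n x\<bar>) \<le> sqrt (measure lborel S) * (2 * A + (1 / 2) ^ n)"
        by blast
    qed
  qed
qed

section \<open>Representation of bounded functionals\<close>

definition tests_in :: "(real ^ 'n::finite) set \<Rightarrow> (real ^ 'n \<Rightarrow> real) set" where
  "tests_in S = {\<phi> \<in> test_functions. \<forall>x. x \<notin> S \<longrightarrow> \<phi> x = 0}"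

lemma integrable_times_test:
  fixes F :: "real ^ 'n::finite \<Rightarrow> real"
  assumes F: "integrable lborel (\<lambda>x. indicator S x * F x)" and \<phi>: "\<phi> \<in> tests_in S"
  shows "integrable lborel (\<lambda>x. F x * \<phi> x)"
proof -
  obtain B where B: "\<And>x. norm (\<phi> x) \<le> B"
    using test_functions_bounded[of \<phi>] \<phi> unfolding tests_in_def by blast
  have eq: "(\<lambda>x. F x * \<phi> x) = (\<lambda>x. indicator S x * F x * \<phi> x)"
    using \<phi> by (auto simp: tests_in_def fun_eq_iff split: split_indicator)
  have [measurable]: "\<phi> \<in> borel_measurable borel"
    using \<phi> test_functions_borel_measurable unfolding tests_in_def by blast
  show ?thesis
    unfolding eq
  proof (rule Bochner_Integration.integrable_bound[where f = "\<lambda>x. indicator S x * F x * B"])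
    show "(\<lambda>x. indicator S x * F x * \<phi> x) \<in> borel_measurable lborel"
      using F by measurable
    show "AE x in lborel. norm (indicator S x * F x * \<phi> x) \<le> norm (indicator S x * F x * B)"
    proof (rule AE_I2)
      fix x
      have "\<bar>\<phi> x\<bar> \<le> \<bar>B\<bar>" using B[of x] by simp
      then show "norm (indicator S x * F x * \<phi> x) \<le> norm (indicator S x * F x * B)"
        unfolding real_norm_def abs_mult[of _ "\<phi> x"] abs_mult[of _ B] by (rule mult_left_mono) simp
    qed
  qed (use F in simp)
qed

lemma tests_in_add:
  assumes "\<phi> \<in> tests_in S" "\<psi> \<in> tests_in S"
  shows "(\<lambda>x. \<phi> x + \<psi> x) \<in> tests_in S"
  using assms test_functions_add[of \<phi> \<psi>] by (simp add: tests_in_def)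

lemma tests_in_cmult:
  assumes "\<phi> \<in> tests_in S"
  shows "(\<lambda>x. c * \<phi> x) \<in> tests_in S"
  using assms test_functions_cmult[of \<phi> c] by (simp add: tests_in_def)

lemma tests_in_test: "\<phi> \<in> tests_in S \<Longrightarrow> \<phi> \<in> test_functions"
  by (simp add: tests_in_def)

text \<open>\<open>V\<close> is left abstract because two choices occur: all test functions in the
  cube and those of mean zero. One square root of the volume comes from the bound, the other from
  passing to the L1 norm of the density.\<close>

lemma cube_density:
  fixes \<l> :: "(real ^ 'n::finite \<Rightarrow> real) \<Rightarrow> real" and a :: "real ^ 'n"
  assumes \<l>: "gradient_bounded \<l> M" and l: "l > 0" and K: "K \<ge> 0"
    and V: "V \<subseteq> tests_in (cube a l)" and V0: "(\<lambda>x. 0) \<in> V"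
    and Vadd: "\<And>\<phi> \<psi>. \<phi> \<in> V \<Longrightarrow> \<psi> \<in> V \<Longrightarrow> (\<lambda>x. \<phi> x + \<psi> x) \<in> V"
    and Vscale: "\<And>c \<phi>. \<phi> \<in> V \<Longrightarrow> (\<lambda>x. c * \<phi> x) \<in> V"
    and bound: "\<And>\<phi>. \<phi> \<in> V \<Longrightarrow> \<bar>\<l> \<phi>\<bar> \<le> K * M * sqrt (l ^ CARD('n)) * L2 \<phi>"
  obtains g where "integrable lborel g" "\<And>x. x \<notin> cube a l \<Longrightarrow> g x = 0"
    "\<And>\<phi>. \<phi> \<in> V \<Longrightarrow> \<l> \<phi> = (LBINT x. g x * \<phi> x)"
    "(LBINT x. \<bar>g x\<bar>) \<le> 2 * K * M * l ^ CARD('n)"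
proof -
  interpret gradient_bounded \<l> M by fact
  have Vt: "\<phi> \<in> test_functions" "x \<notin> cube a l \<Longrightarrow> \<phi> x = 0" if "\<phi> \<in> V" for \<phi> x
    using that V by (auto simp: tests_in_def)
  show thesis
  proof (rule Riesz_test_functions[of V "cube a l" \<l> "K * M * sqrt (l ^ CARD('n))"])
    show "0 \<le> K * M * sqrt (l ^ CARD('n))"
      using K bound_nonneg l by simp
    fix g assume g: "integrable lborel g" "\<And>x. x \<notin> cube a l \<Longrightarrow> g x = 0"
      "\<And>\<phi>. \<phi> \<in> V \<Longrightarrow> \<l> \<phi> = (LBINT x. g x * \<phi> x)"
      "(LBINT x. \<bar>g x\<bar>) \<le> sqrt (measure lborel (cube a l)) * (2 * (K * M * sqrt (l ^ CARD('n))))"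
    note g(4)
    also have "sqrt (measure lborel (cube a l)) * (2 * (K * M * sqrt (l ^ CARD('n))))
        = 2 * K * M * (sqrt (l ^ CARD('n)) * sqrt (l ^ CARD('n)))"
      using l by (simp add: measure_cube mult_ac)
    also have "sqrt (l ^ CARD('n)) * sqrt (l ^ CARD('n)) = l ^ CARD('n)"
      using l by simp
    finally have "(LBINT x. \<bar>g x\<bar>) \<le> 2 * K * M * l ^ CARD('n)" .
    from that[OF g(1-3) this] show thesis .
  qed (use Vt Vadd Vscale V0 bound in \<open>auto simp: cube_fmeasurable add scale\<close>)
qed

lemma cube_cbox: "cube a l = cbox a (\<chi> i. a $ i + l)"
  by (simp add: cube_def)

lemma AE_eq_density:
  fixes F g :: "real ^ 'n::finite \<Rightarrow> real"
  assumes [measurable]: "F \<in> borel_measurable borel" "g \<in> borel_measurable borel"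
    and F: "integrable lborel (\<lambda>x. indicator (cube a l) x * F x)" and g: "integrable lborel (\<lambda>x.
        indicator (cube a l) x * g x)"
    and eq: "\<And>\<phi>. \<phi> \<in> tests_in (cube a l) \<Longrightarrow> (LBINT x. F x * \<phi> x) = (LBINT x. g x * \<phi> x)"
  shows "AE x in lborel. x \<in> cube a l \<longrightarrow> F x = g x"
proof -
  have "AE x in lborel. x \<in> cube a l \<longrightarrow> F x - g x = 0"
    unfolding cube_cbox
  proof (rule AE_zero_if_orthogonal)
    show "integrable lborel (\<lambda>x. indicator (cbox a (\<chi> i. a $ i + l)) x * (F x - g x))"
      using F g by (simp add: cube_cbox right_diff_distrib)
    fix \<phi> :: "real ^ 'n \<Rightarrow> real"
    assume "\<phi> \<in> test_functions" "\<And>x. x \<notin> cbox a (\<chi> i. a $ i + l) \<Longrightarrow> \<phi> x = 0"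
    then have \<phi>: "\<phi> \<in> tests_in (cube a l)" by (simp add: tests_in_def cube_cbox)
    show "(LBINT x. (F x - g x) * \<phi> x) = 0"
      using eq[OF \<phi>] integrable_times_test[OF F \<phi>] integrable_times_test[OF g \<phi>]
      by (simp add: left_diff_distrib)
  qed measurable
  then show ?thesis by eventually_elim auto
qed

text \<open>Subtracting from a test function its integral times a fixed \<open>\<theta>\<close> of
  integral 1 makes it mean-zero. So the two densities differ by the constant by which their pairings
  with \<open>\<theta>\<close> differ.\<close>

lemma AE_eq_density_mean_zero:
  fixes F g :: "real ^ 'n::finite \<Rightarrow> real"
  assumes [measurable]: "F \<in> borel_measurable borel" "g \<in> borel_measurable borel" and l: "l > 0"
    and F: "integrable lborel (\<lambda>x. indicator (cube a l) x * F x)" and g: "integrable lborel (\<lambda>x.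
        indicator (cube a l) x * g x)"
    and eq: "\<And>\<phi>. \<phi> \<in> tests_in (cube a l) \<Longrightarrow> (LBINT x. \<phi> x) = 0 \<Longrightarrow>
      (LBINT x. F x * \<phi> x) = (LBINT x. g x * \<phi> x)"
  obtains c where "AE x in lborel. x \<in> cube a l \<longrightarrow> F x = g x + c"
proof -
  let ?b = "\<chi> i. a $ i + l"
  define \<theta> where "\<theta> = (\<lambda>x. inverse (LBINT y. box_bump a ?b 1 y) * box_bump a ?b 1 x)"
  have "box_bump a ?b 1 \<in> tests_in (cube a l)"
    using box_bump_test[of 1 a ?b] box_bump_zero[of 1 _ a ?b] box_subset_cbox[of a ?b]
    unfolding tests_in_def cube_cbox by auto
  then have \<theta>: "\<theta> \<in> tests_in (cube a l)"
    unfolding \<theta>_def by (rule tests_in_cmult)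
  have "(LBINT y. box_bump a ?b 1 y) > 0"
  proof (rule test_functions_integral_pos[OF box_bump_test box_bump_nonneg])
    show "box_bump a ?b 1 (\<chi> i. a $ i + l / 2) > 0"
      by (subst box_bump_pos_iff) (use l in \<open>auto simp: mem_box_cart\<close>)
  qed simp
  then have \<theta>1: "(LBINT x. \<theta> x) = 1" by (simp add: \<theta>_def)
  define c where "c = (LBINT x. F x * \<theta> x) - (LBINT x. g x * \<theta> x)"
  have ci: "integrable lborel (\<lambda>x. indicator (cube a l) x * c)"
    using cube_fmeasurable[of a l] by (auto simp: fmeasurable_def)
  have "AE x in lborel. x \<in> cube a l \<longrightarrow> F x = g x + c"
  proof (rule AE_eq_density)
    show "integrable lborel (\<lambda>x. indicator (cube a l) x * (g x + c))"
      unfolding distrib_left by (rule Bochner_Integration.integrable_add[OF g ci])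
    fix \<phi> assume \<phi>: "\<phi> \<in> tests_in (cube a l)"
    define I where "I = (LBINT x. \<phi> x)"
    note i = integrable_times_test[OF F \<phi>] integrable_times_test[OF g \<phi>]
      integrable_times_test[OF F \<theta>] integrable_times_test[OF g \<theta>]
      test_functions_integrable[OF tests_in_test[OF \<phi>]] test_functions_integrable[OF
          tests_in_test[OF \<theta>]]
    have "(\<lambda>x. \<phi> x + - I * \<theta> x) \<in> tests_in (cube a l)"
      by (intro tests_in_add tests_in_cmult \<phi> \<theta>)
    then have "(LBINT x. F x * (\<phi> x + - I * \<theta> x)) = (LBINT x. g x * (\<phi> x + - I * \<theta> x))"
      by (rule eq) (use i \<theta>1 in \<open>simp add: I_def\<close>)
    moreover have "(LBINT x. F x * (\<phi> x + - I * \<theta> x)) = (LBINT x. F x * \<phi> x) - I * (LBINT x. F x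
        * \<theta> x)"
    proof -
      have "(\<lambda>x. F x * (\<phi> x + - I * \<theta> x)) = (\<lambda>x. F x * \<phi> x - I * (F x * \<theta> x))" by (auto simp:
          algebra_simps)
      then show ?thesis using i by simp
    qed
    moreover have "(LBINT x. g x * (\<phi> x + - I * \<theta> x)) = (LBINT x. g x * \<phi> x) - I * (LBINT x. g x
        * \<theta> x)"
    proof -
      have "(\<lambda>x. g x * (\<phi> x + - I * \<theta> x)) = (\<lambda>x. g x * \<phi> x - I * (g x * \<theta> x))" by (auto simp:
          algebra_simps)
      then show ?thesis using i by simp
    qed
    moreover have "(LBINT x. (g x + c) * \<phi> x) = (LBINT x. g x * \<phi> x) + c * I"
      using i by (simp add: distrib_right I_def)
    ultimately show "(LBINT x. F x * \<phi> x) = (LBINT x. (g x + c) * \<phi> x)"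
      by (simp add: c_def algebra_simps)
  qed (use F in measurable)
  then show thesis by (rule that)
qed

text \<open>Densities on an exhausting sequence of cubes agree almost everywhere on overlaps by
  uniqueness, and are glued to one function; a test function sees only one of the cubes.\<close>

lemma sobolev_bounded_density:
  fixes \<l> :: "(real ^ 'n::finite \<Rightarrow> real) \<Rightarrow> real"
  assumes \<l>: "sobolev_bounded \<l> M" and K: "K \<ge> 0"
    and bound: "\<And>a l \<phi>. l \<ge> 1 \<Longrightarrow> \<phi> \<in> tests_in (cube a l) \<Longrightarrow>
      \<bar>\<l> \<phi>\<bar> \<le> K * M * sqrt (l ^ CARD('n)) * L2 \<phi>"
  obtains F where "F \<in> borel_measurable borel"
    "\<And>a l. integrable lborel (\<lambda>x. indicator (cube a l) x * F x)"
    "\<And>\<phi>. \<phi> \<in> test_functions \<Longrightarrow> \<l> \<phi> = (LBINT x. F x * \<phi> x)"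
proof -
  interpret sobolev_bounded \<l> M by fact
  \<comment> \<open>With half-side \<open>Suc N\<close> the side is at least 1 already for
    \<open>N = 0\<close>, as \<open>bound\<close> requires.\<close>
  let ?Q = "\<lambda>N::nat. cube (\<chi> i. - real (Suc N)) (2 * real (Suc N)) :: (real ^ 'n) set"
  have mem_Q: "x \<in> ?Q N \<longleftrightarrow> (\<forall>i. \<bar>x $ i\<bar> \<le> real (Suc N))" for x N
    unfolding mem_cube by (simp add: abs_le_iff) (smt (verit))
  have mono: "?Q N \<subseteq> ?Q N'" if "N \<le> N'" for N N'
    using that unfolding subset_iff mem_Q by (meson Suc_le_mono of_nat_mono order_trans)
  have cover: "\<exists>N. S \<subseteq> ?Q N" if bS: "bounded S" for S
  proof -
    obtain R where R: "\<And>x. x \<in> S \<Longrightarrow> norm x \<le> R" using bS unfolding bounded_iff by blast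
    have "x \<in> ?Q (nat \<lceil>R\<rceil>)" if "x \<in> S" for x
      unfolding mem_Q
    proof
      fix i
      have "\<bar>x $ i\<bar> \<le> R" using component_le_norm_cart[of x i] R[OF that] by linarith
      then show "\<bar>x $ i\<bar> \<le> real (Suc (nat \<lceil>R\<rceil>))" by linarith
    qed
    then show ?thesis by blast
  qed
  have tests0: "(\<lambda>x. 0) \<in> tests_in S" for S :: "(real ^ 'n) set"
    by (simp add: tests_in_def test_functions_0)
  have "\<forall>N. \<exists>g. integrable lborel g \<and> (\<forall>\<phi>\<in>tests_in (?Q N). \<l> \<phi> = (LBINT x. g x * \<phi> x))"
  proof
    fix N
    show "\<exists>g. integrable lborel g \<and> (\<forall>\<phi>\<in>tests_in (?Q N). \<l> \<phi> = (LBINT x. g x * \<phi> x))"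
    proof (rule cube_density[where a = "\<chi> i. - real (Suc N)" and l = "2 * real (Suc N)",
          OF gradient_bounded_axioms _ K order_refl tests0 tests_in_add tests_in_cmult bound])
      fix g assume "integrable lborel g" "\<And>\<phi>. \<phi> \<in> tests_in (?Q N) \<Longrightarrow> \<l> \<phi> = (LBINT x. g x * \<phi> x)"
      then show ?thesis by blast
    qed auto
  qed
  from choice[OF this] obtain g where g: "\<And>N. integrable lborel (g N)"
    "\<And>N \<phi>. \<phi> \<in> tests_in (?Q N) \<Longrightarrow> \<l> \<phi> = (LBINT x. g N x * \<phi> x)" by blast
  have [measurable]: "g N \<in> borel_measurable borel" for N using g(1)[of N] by auto
  have gi: "integrable lborel (\<lambda>x. indicator (cube a l) x * g N x)" for a l N
    using integrable_mult_indicator[of "cube a l" lborel "g N"] g(1)[of N] cube_fmeasurable[of a l]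
    by (simp add: fmeasurable_def)
  have "AE x in lborel. x \<in> ?Q N \<longrightarrow> g N' x = g N x" if "N \<le> N'" for N N'
  proof (rule AE_eq_density[OF _ _ gi gi])
    fix \<phi> assume \<phi>: "\<phi> \<in> tests_in (?Q N)"
    then have "\<phi> \<in> tests_in (?Q N')" using mono[OF that] by (auto simp: tests_in_def)
    then show "(LBINT x. g N' x * \<phi> x) = (LBINT x. g N x * \<phi> x)"
      using g(2) \<phi> by metis
  qed measurable
  then have "AE x in lborel. \<forall>N N'. N \<le> N' \<longrightarrow> x \<in> ?Q N \<longrightarrow> g N' x = g N x"
    by (simp add: AE_all_countable)
  \<comment> \<open>Almost everywhere the sequence is eventually constant; \<open>lim\<close> picks
    the final value and is Borel measurable.\<close>
  define F where "F x = lim (\<lambda>N. g N x)" for x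
  have [measurable]: "F \<in> borel_measurable borel" unfolding F_def[abs_def] by measurable
  have F: "AE x in lborel. \<forall>N. x \<in> ?Q N \<longrightarrow> F x = g N x"
    using \<open>AE x in lborel. \<forall>N N'. N \<le> N' \<longrightarrow> x \<in> ?Q N \<longrightarrow> g N' x = g N x\<close>
  proof eventually_elim
    case (elim x)
    show ?case
    proof (intro allI impI)
      fix N assume "x \<in> ?Q N"
      with elim have "\<forall>\<^sub>F N' in sequentially. g N' x = g N x"
        unfolding eventually_sequentially by blast
      then have "(\<lambda>N'. g N' x) \<longlonglongrightarrow> g N x" by (rule tendsto_eventually)
      then show "F x = g N x" unfolding F_def by (rule limI)
    qed
  qed
  show thesis
  proof (rule that[of F])
    show "integrable lborel (\<lambda>x. indicator (cube a l) x * F x)" for a l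
    proof -
      obtain N where N: "cube a l \<subseteq> ?Q N"
        using cover[of "cube a l"] bounded_cbox unfolding cube_def by blast
      have "integrable lborel (\<lambda>x. indicator (cube a l) x * F x) \<longleftrightarrow> integrable lborel (\<lambda>x.
          indicator (cube a l) x * g N x)"
      proof (rule integrable_cong_AE)
        show "AE x in lborel. indicator (cube a l) x * F x = indicator (cube a l) x * g N x"
          using F by eventually_elim (use N in \<open>auto simp: indicator_def\<close>)
      qed (use gi[of a l N] cube_fmeasurable[of a l] in \<open>auto simp: fmeasurable_def\<close>)
      then show ?thesis using gi by blast
    qed
    show "\<l> \<phi> = (LBINT x. F x * \<phi> x)" if \<phi>: "\<phi> \<in> test_functions" for \<phi>
    proof -
      obtain R where R: "\<And>x. \<phi> x \<noteq> 0 \<Longrightarrow> norm x \<le> R"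
        using test_functionsE[OF \<phi>] by blast
      have "bounded {x. \<phi> x \<noteq> 0}" unfolding bounded_iff using R by blast
      then obtain N where N: "{x. \<phi> x \<noteq> 0} \<subseteq> ?Q N" using cover by blast
      then have "\<phi> \<in> tests_in (?Q N)" using \<phi> by (auto simp: tests_in_def)
      then have "\<l> \<phi> = (LBINT x. g N x * \<phi> x)" by (rule g(2))
      also have "\<dots> = (LBINT x. F x * \<phi> x)"
      proof (rule integral_cong_AE)
        show "AE x in lborel. g N x * \<phi> x = F x * \<phi> x"
          using F by eventually_elim (use N in auto)
      qed (use test_functions_borel_measurable[OF \<phi>] in measurable)
      finally show ?thesis .
    qed
  qed measurable
qed

text \<open>The real-valued, one-coordinate form of the conclusion. The oscillation is measured from
  some constant \<open>c\<close>, which is what duality with mean-zero functions supplies; the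
  average replaces it in \<open>cube_oscillation_le\<close>.\<close>

definition bmo_density :: "real \<Rightarrow> ((real ^ 'n::finite \<Rightarrow> real) \<Rightarrow> real) \<Rightarrow> (real ^ 'n \<Rightarrow> real) \<Rightarrow>
    bool" where
  "bmo_density B \<l> F \<longleftrightarrow> F \<in> borel_measurable borel \<and>
    (\<forall>a l. integrable lborel (\<lambda>x. indicator (cube a l) x * F x)) \<and>
    (\<forall>\<phi>\<in>test_functions. \<l> \<phi> = (LBINT x. F x * \<phi> x)) \<and>
    (\<forall>a. \<forall>l>0. \<exists>c. (LBINT x. indicator (cube a l) x * \<bar>F x - c\<bar>) \<le> B * l ^ CARD('n)) \<and>
    (\<forall>a. \<forall>l\<ge>1. (LBINT x. indicator (cube a l) x * \<bar>F x\<bar>) \<le> B * l ^ CARD('n))"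

text \<open>One density \<open>F\<close> serves all cubes. On each cube duality gives another
  density with good L1 norm, and uniqueness identifies it with \<open>F\<close>: up to a constant if
  only mean-zero functions are tested, exactly on cubes of side at least 1.\<close>

lemma sobolev_bounded_representation:
  "\<exists>K\<ge>0. \<forall>\<l> M. sobolev_bounded (\<l> :: (real ^ 'n::finite \<Rightarrow> real) \<Rightarrow> real) M \<longrightarrow>
    (\<exists>F. bmo_density (K * M) \<l> F)"
proof -
  obtain K1 where K1: "K1 \<ge> 0" "\<And>\<l> M \<phi> a l. \<lbrakk>gradient_bounded (\<l> :: (real ^ 'n \<Rightarrow> real) \<Rightarrow> real) M;
    \<phi> \<in> tests_in (cube a l); l > 0; (LBINT x. \<phi> x) = 0\<rbrakk> \<Longrightarrow> \<bar>\<l> \<phi>\<bar> \<le> K1 * M * sqrt (l ^ CARD('n)) *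
        L2 \<phi>"
    using mean_zero_bound unfolding tests_in_def by blast
  obtain K2 where K2: "K2 \<ge> 0" "\<And>\<l> M \<phi> a l. \<lbrakk>sobolev_bounded (\<l> :: (real ^ 'n \<Rightarrow> real) \<Rightarrow> real) M;
    \<phi> \<in> tests_in (cube a l); l \<ge> 1\<rbrakk> \<Longrightarrow> \<bar>\<l> \<phi>\<bar> \<le> K2 * M * sqrt (l ^ CARD('n)) * L2 \<phi>"
    using large_cube_bound unfolding tests_in_def by blast
  \<comment> \<open>Each 2 is the factor lost in \<open>cube_density\<close>; the sum dominates both
    constants.\<close>
  define K where "K = 2 * K1 + 2 * K2"
  have K: "K \<ge> 0" "2 * K1 \<le> K" "2 * K2 \<le> K" using K1 K2 by (auto simp: K_def)
  show ?thesis
  proof (intro exI[of _ K] conjI allI impI K(1))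
    fix \<l> :: "(real ^ 'n \<Rightarrow> real) \<Rightarrow> real" and M
    assume \<l>: "sobolev_bounded \<l> M"
    interpret sobolev_bounded \<l> M by fact
    note gb = gradient_bounded_axioms
    obtain F where F: "F \<in> borel_measurable borel"
      "\<And>a l. integrable lborel (\<lambda>x. indicator (cube a l) x * F x)"
      "\<And>\<phi>. \<phi> \<in> test_functions \<Longrightarrow> \<l> \<phi> = (LBINT x. F x * \<phi> x)"
      by (rule sobolev_bounded_density[OF \<l> K2(1) K2(2)[OF \<l>]]) blast+
    note [measurable] = F(1)
    have tests0: "(\<lambda>x. 0) \<in> tests_in S" for S :: "(real ^ 'n) set"
      by (simp add: tests_in_def test_functions_0)
    have gi: "integrable lborel (\<lambda>x. indicator (cube a l) x * g x)" if "integrable lborel g"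
      for a l and g :: "real ^ 'n \<Rightarrow> real"
      using integrable_mult_indicator[of "cube a l" lborel g] that cube_fmeasurable[of a l]
      by (simp add: fmeasurable_def)
    have mono: "(LBINT x. indicator (cube a l) x * \<bar>F x - c\<bar>) \<le> k * M * l ^ CARD('n)"
      if g: "integrable lborel g" "\<And>x. x \<notin> cube a l \<Longrightarrow> g x = 0"
        and le: "(LBINT x. \<bar>g x\<bar>) \<le> k' * M * l ^ CARD('n)" "k' \<le> k" and l: "l > 0"
        and eq: "AE x in lborel. x \<in> cube a l \<longrightarrow> F x = g x + c"
      for g :: "real ^ 'n \<Rightarrow> real" and a l c k k'
    proof -
      have [measurable]: "g \<in> borel_measurable borel" using g by auto
      have "(LBINT x. indicator (cube a l) x * \<bar>F x - c\<bar>) = (LBINT x. \<bar>g x\<bar>)"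
      proof (rule integral_cong_AE)
        show "AE x in lborel. indicator (cube a l) x * \<bar>F x - c\<bar> = \<bar>g x\<bar>"
          using eq by eventually_elim (use g(2) in \<open>auto simp: indicator_def\<close>)
        show "(\<lambda>x. indicator (cube a l) x * \<bar>F x - c\<bar>) \<in> borel_measurable lborel"
          using cube_fmeasurable[of a l] by (auto simp: fmeasurable_def)
      qed measurable
      also have "\<dots> \<le> k' * M * l ^ CARD('n)" by (rule le)
      also have "\<dots> \<le> k * M * l ^ CARD('n)"
        using le(2) l bound_nonneg by (intro mult_right_mono) auto
      finally show ?thesis .
    qed
    show "\<exists>F. bmo_density (K * M) \<l> F"
      unfolding bmo_density_def
    proof (intro exI[of _ F] conjI allI ballI impI F)
      fix a :: "real ^ 'n" and l :: real assume l: "l > 0"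
      let ?V = "{\<phi> \<in> tests_in (cube a l). (LBINT x. \<phi> x) = 0}"
      show "\<exists>c. (LBINT x. indicator (cube a l) x * \<bar>F x - c\<bar>) \<le> K * M * l ^ CARD('n)"
      proof (rule cube_density[OF gb l K1(1), of ?V a])
        show "\<bar>\<l> \<phi>\<bar> \<le> K1 * M * sqrt (l ^ CARD('n)) * L2 \<phi>" if "\<phi> \<in> ?V" for \<phi>
          using that by (intro K1(2)[OF gb _ l]) auto
        show "(\<lambda>x. \<phi> x + \<psi> x) \<in> ?V" if "\<phi> \<in> ?V" "\<psi> \<in> ?V" for \<phi> \<psi>
          using that by (simp add: tests_in_add test_functions_integrable[OF tests_in_test[of _
              "cube a l"]])
        show "(\<lambda>x. c * \<phi> x) \<in> ?V" if "\<phi> \<in> ?V" for \<phi> c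
          using that by (simp add: tests_in_cmult)
        fix g assume g: "integrable lborel g" "\<And>x. x \<notin> cube a l \<Longrightarrow> g x = 0"
          "\<And>\<phi>. \<phi> \<in> ?V \<Longrightarrow> \<l> \<phi> = (LBINT x. g x * \<phi> x)"
          "(LBINT x. \<bar>g x\<bar>) \<le> 2 * K1 * M * l ^ CARD('n)"
        have gb: "g \<in> borel_measurable borel" using g by auto
        obtain c where "AE x in lborel. x \<in> cube a l \<longrightarrow> F x = g x + c"
        proof (rule AE_eq_density_mean_zero[OF F(1) gb l F(2) gi[OF g(1)]])
          fix \<phi> assume \<phi>: "\<phi> \<in> tests_in (cube a l)" "(LBINT x. \<phi> x) = 0"
          show "(LBINT x. F x * \<phi> x) = (LBINT x. g x * \<phi> x)"
            using g(3)[of \<phi>] F(3)[OF tests_in_test[OF \<phi>(1)]] \<phi> by simp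
        qed
        from mono[OF g(1,2,4) K(2) l this]
        show "\<exists>c. (LBINT x. indicator (cube a l) x * \<bar>F x - c\<bar>) \<le> K * M * l ^ CARD('n)" by blast
      qed (use tests0 in auto)
    next
      fix a :: "real ^ 'n" and l :: real assume l: "l \<ge> 1"
      then have l0: "l > 0" by simp
      show "(LBINT x. indicator (cube a l) x * \<bar>F x\<bar>) \<le> K * M * l ^ CARD('n)"
      proof (rule cube_density[OF gb l0 K2(1) order_refl tests0 tests_in_add tests_in_cmult
          K2(2)[OF \<l> _ l]])
        fix g assume g: "integrable lborel g" "\<And>x. x \<notin> cube a l \<Longrightarrow> g x = 0"
          "\<And>\<phi>. \<phi> \<in> tests_in (cube a l) \<Longrightarrow> \<l> \<phi> = (LBINT x. g x * \<phi> x)"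
          "(LBINT x. \<bar>g x\<bar>) \<le> 2 * K2 * M * l ^ CARD('n)"
        have gb: "g \<in> borel_measurable borel" using g by auto
        have "AE x in lborel. x \<in> cube a l \<longrightarrow> F x = g x"
          by (rule AE_eq_density[OF F(1) gb F(2) gi[OF g(1)]])
            (use g(3) F(3) tests_in_test in metis)
        then have "AE x in lborel. x \<in> cube a l \<longrightarrow> F x = g x + 0" by simp
        from mono[OF g(1,2,4) K(3) l0 this]
        show "(LBINT x. indicator (cube a l) x * \<bar>F x\<bar>) \<le> K * M * l ^ CARD('n)" by simp
      qed
    qed
  qed
qed

section \<open>Differential forms\<close>

abbreviation ext_sign :: "'n::{finite,linorder} set \<Rightarrow> 'n \<Rightarrow> real" where
  "ext_sign J j \<equiv> (-1) ^ card {i\<in>J. i < j}"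

text \<open>Removing the smaller index lowers by one the number of elements below the larger;
  removing the larger leaves the count of the smaller unchanged. So exactly one sign flips.\<close>

lemma ext_sign_swap:
  assumes "i \<in> K" "j \<in> K" "i \<noteq> j"
  shows "ext_sign K j * ext_sign (K - {j}) i = - (ext_sign K i * ext_sign (K - {i}) j)"
proof -
  have *: "ext_sign K j * ext_sign (K - {j}) i = - (ext_sign K i * ext_sign (K - {i}) j)"
    if "i \<in> K" "j \<in> K" "i < j" for i j
  proof -
    have "{a\<in>K - {j}. a < i} = {a\<in>K. a < i}" using that by auto
    moreover have "{a\<in>K. a < j} = insert i {a\<in>K - {i}. a < j}" using that by auto
    then have "card {a\<in>K. a < j} = Suc (card {a\<in>K - {i}. a < j})" by simp
    ultimately show ?thesis by simp
  qed
  show ?thesis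
    using *[OF assms(1,2)] *[OF assms(2,1)] assms(3) by (cases "i < j") (auto simp: not_less)
qed

text \<open>The terms are indexed by ordered pairs of distinct removed indices. Swapping a pair
  flips the sign by \<open>ext_sign_swap\<close> and keeps the derivative by
  \<open>partial_commute\<close>, so the sum equals its negative.\<close>

lemma ext_deriv_ext_deriv:
  fixes \<eta> :: "'n set \<Rightarrow> real ^ 'n::{finite,linorder} \<Rightarrow> real"
  assumes \<eta>: "\<And>I. smooth (\<eta> I)"
  shows "ext_deriv (ext_deriv \<eta>) K x = 0"
proof -
  define T where "T = (\<lambda>(j, i). ext_sign K j * ext_sign (K - {j}) i * partial j (partial i (\<eta> (K
      - {j} - {i}))) x)"
  have inner: "partial j (ext_deriv \<eta> J) x
      = (\<Sum>i\<in>J. ext_sign J i * partial j (partial i (\<eta> (J - {i}))) x)" for j J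
  proof -
    have sm: "smooth (partial i (\<eta> (J - {i})))" for i by (rule smooth_partial[OF \<eta>])
    have "partial j (\<lambda>x. \<Sum>i\<in>J. ext_sign J i * partial i (\<eta> (J - {i})) x) x
        = (\<Sum>i\<in>J. partial j (\<lambda>x. ext_sign J i * partial i (\<eta> (J - {i})) x) x)"
      by (rule partial_sum)
        (rule smooth_differentiable[OF smooth_mult[OF smooth_const sm]])
    then show ?thesis
      unfolding partial_cmult[OF sm] by (simp add: ext_deriv_def[abs_def])
  qed
  let ?P = "SIGMA j:K. K - {j}"
  have "ext_deriv (ext_deriv \<eta>) K x = (\<Sum>j\<in>K. ext_sign K j * partial j (ext_deriv \<eta> (K - {j})) x)"
    by (simp add: ext_deriv_def)
  also have "\<dots> = (\<Sum>j\<in>K. \<Sum>i\<in>K - {j}. T (j, i))"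
    unfolding inner by (simp add: T_def sum_distrib_left mult.assoc)
  also have "\<dots> = sum T ?P"
    by (subst sum.Sigma) auto
  finally have eq: "ext_deriv (ext_deriv \<eta>) K x = sum T ?P" .
  have "sum T ?P = sum (\<lambda>p. T (prod.swap p)) ?P"
    by (rule sum.reindex_bij_witness[of _ prod.swap prod.swap]) auto
  also have "\<dots> = sum (\<lambda>p. - T p) ?P"
  proof (rule sum.cong[OF refl])
    fix p assume "p \<in> ?P"
    then obtain j i where p: "p = (j, i)" "j \<in> K" "i \<in> K" "i \<noteq> j" by auto
    have "K - {i} - {j} = K - {j} - {i}" by auto
    then show "T (prod.swap p) = - T p"
      unfolding p(1) T_def using ext_sign_swap[OF p(2,3) p(4)[symmetric]] partial_commute[OF \<eta>,
          of i j "K - {j} - {i}"]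
      by simp
  qed
  finally show ?thesis unfolding eq by (simp add: sum_negf)
qed

lemma ext_deriv_test:
  fixes \<psi> :: "'n set \<Rightarrow> real ^ 'n::{finite,linorder} \<Rightarrow> real"
  assumes "\<And>I. \<psi> I \<in> test_functions"
  shows "ext_deriv \<psi> J \<in> test_functions"
  unfolding ext_deriv_def[abs_def]
  by (intro test_functions_sum test_functions_cmult test_functions_partial assms) simp

lemma ext_deriv_cmult:
  fixes \<psi> :: "'n set \<Rightarrow> real ^ 'n::{finite,linorder} \<Rightarrow> real"
  assumes "\<And>I. smooth (\<psi> I)"
  shows "ext_deriv (\<lambda>I x. c * \<psi> I x) J = (\<lambda>x. c * ext_deriv \<psi> J x)"
  unfolding ext_deriv_def[abs_def] partial_cmult[OF assms]
  by (simp add: sum_distrib_left mult_ac)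

lemma ext_deriv_of_real:
  fixes \<psi> :: "'n set \<Rightarrow> real ^ 'n::{finite,linorder} \<Rightarrow> real"
  assumes "\<And>I. smooth (\<psi> I)"
  shows "ext_deriv (\<lambda>I x. of_real (\<psi> I x) :: 'a::real_normed_field) J = (\<lambda>x. of_real (ext_deriv \<psi>
      J x))"
  unfolding ext_deriv_def[abs_def] smooth_bounded_linear(2)[OF bounded_linear_of_real assms]
  by simp

lemma L1_norm_of_real:
  assumes "f \<in> test_functions"
  shows "L1_norm (\<lambda>x. of_real (f x) :: 'a::real_normed_field) = ennreal (L1 f)"
  unfolding L1_norm_def L1_def
  using test_functions_integrable[OF assms]
  by (simp add: nn_integral_completion nn_integral_eq_integral)

lemma ext_deriv_single:
  fixes \<phi> :: "real ^ 'n::{finite,linorder} \<Rightarrow> real"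
  shows "ext_deriv (\<lambda>K. if K = I then \<phi> else (\<lambda>x. 0)) J x
    = (\<Sum>j\<in>J. if J - {j} = I then ext_sign J j * partial j \<phi> x else 0)"
  unfolding ext_deriv_def by (rule sum.cong) (auto simp: partial_const)

lemma single_test:
  "\<phi> \<in> test_functions \<Longrightarrow> (if K = I then \<phi> else (\<lambda>x. 0)) \<in> test_functions"
  by (simp add: test_functions_0)

lemma L1_ext_deriv_single:
  fixes \<phi> :: "real ^ 'n::{finite,linorder} \<Rightarrow> real"
  assumes \<phi>: "\<phi> \<in> test_functions"
  shows "L1 (ext_deriv (\<lambda>K. if K = I then \<phi> else (\<lambda>x. 0)) J) \<le> (\<Sum>j\<in>UNIV. L1 (partial j \<phi>))"
proof -
  have int: "integrable lborel (\<lambda>x. \<bar>partial j \<phi> x\<bar>)" for j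
    by (intro integrable_abs test_functions_integrable test_functions_partial \<phi>)
  have "L1 (ext_deriv (\<lambda>K. if K = I then \<phi> else (\<lambda>x. 0)) J) \<le> (LBINT x. (\<Sum>j\<in>UNIV. \<bar>partial j \<phi> x\<bar>))"
    unfolding L1_def
  proof (rule integral_mono)
    show "integrable lborel (\<lambda>x. \<bar>ext_deriv (\<lambda>K. if K = I then \<phi> else (\<lambda>x. 0)) J x\<bar>)"
      by (intro integrable_abs test_functions_integrable ext_deriv_test single_test \<phi>)
    show "integrable lborel (\<lambda>x. \<Sum>j\<in>UNIV. \<bar>partial j \<phi> x\<bar>)" using int by simp
    fix x
    have "\<bar>ext_deriv (\<lambda>K. if K = I then \<phi> else (\<lambda>x. 0)) J x\<bar>
        \<le> (\<Sum>j\<in>J. \<bar>if J - {j} = I then ext_sign J j * partial j \<phi> x else 0\<bar>)"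
      unfolding ext_deriv_single by (rule sum_abs)
    also have "\<dots> \<le> (\<Sum>j\<in>J. \<bar>partial j \<phi> x\<bar>)"
      by (rule sum_mono) (simp add: abs_mult power_abs)
    also have "\<dots> \<le> (\<Sum>j\<in>UNIV. \<bar>partial j \<phi> x\<bar>)"
      by (rule sum_mono2) auto
    finally show "\<bar>ext_deriv (\<lambda>K. if K = I then \<phi> else (\<lambda>x. 0)) J x\<bar> \<le> (\<Sum>j\<in>UNIV. \<bar>partial j \<phi> x\<bar>)" .
  qed
  also have "\<dots> = (\<Sum>j\<in>UNIV. L1 (partial j \<phi>))"
    using int by (simp add: L1_def)
  finally show ?thesis .
qed

text \<open>Counting all subsets in place of those of size \<open>k\<close> gives a factor
  independent of \<open>k\<close>, hence one constant for all degrees.\<close>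

lemma sum_multi_indices_le:
  fixes f :: "'n::finite set \<Rightarrow> real"
  assumes "\<And>I. f I \<le> r" "r \<ge> 0"
  shows "(\<Sum>I\<in>multi_indices k. f I) \<le> 2 ^ CARD('n) * r"
proof -
  have "card (multi_indices k :: 'n set set) \<le> card (Pow (UNIV :: 'n set))"
    by (rule card_mono) auto
  then have "card (multi_indices k :: 'n set set) \<le> 2 ^ CARD('n)" by (simp add: card_Pow)
  then have "real (card (multi_indices k :: 'n set set)) \<le> real (2 ^ CARD('n))" by (rule
      of_nat_mono)
  then have le: "real (card (multi_indices k :: 'n set set)) \<le> 2 ^ CARD('n)" by simp
  have "(\<Sum>I\<in>multi_indices k. f I) \<le> real (card (multi_indices k :: 'n set set)) * r"
    by (rule sum_bounded_above) (rule assms)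
  also have "\<dots> \<le> 2 ^ CARD('n) * r" by (rule mult_right_mono[OF le assms(2)])
  finally show ?thesis .
qed

section \<open>From the norm on \<open>d_space k\<close> to the gradient and Sobolev
  estimates\<close>

lemma of_real_test:
  "\<phi> \<in> test_functions \<Longrightarrow> (\<lambda>x. of_real (\<phi> x) :: 'a::real_normed_field) \<in> test_functions"
  by (rule test_functions_bounded_linear[OF bounded_linear_of_real])

lemma distributions_add:
  "\<lbrakk>u \<in> distributions; \<phi> \<in> test_functions; \<psi> \<in> test_functions\<rbrakk> \<Longrightarrow> u (\<lambda>x. \<phi> x + \<psi> x) = u \<phi> + u \<psi>"
  by (simp add: distributions_def)

lemma distributions_scale:
  "\<lbrakk>u \<in> distributions; \<phi> \<in> test_functions\<rbrakk> \<Longrightarrow> u (\<lambda>x. c * \<phi> x) = c * u \<phi>"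
  by (simp add: distributions_def)

text \<open>Homogeneity turns the supremum over forms of norm at most 1 into an inequality for all
  real-valued forms. Membership in \<open>d_space k\<close> makes the norm finite, so
  \<open>enn2real\<close> loses nothing.\<close>

lemma d_norm_bound:
  fixes u :: "(real ^ 'n::{finite,linorder} \<Rightarrow> 'a::{real_normed_field,euclidean_space}) \<Rightarrow> 'a"
    and \<psi> :: "'n set \<Rightarrow> real ^ 'n::{finite,linorder} \<Rightarrow> real"
  assumes u: "u \<in> d_space k" and \<psi>: "\<And>I. \<psi> I \<in> test_functions" "\<And>I. I \<notin> multi_indices k \<Longrightarrow> \<psi> I =
      (\<lambda>x. 0)"
    and r: "(\<Sum>I\<in>multi_indices k. L1 (\<psi> I)) + (\<Sum>J\<in>multi_indices (k + 1). L1 (ext_deriv \<psi> J)) \<le> r"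
    and I: "I \<in> multi_indices k"
  shows "norm (u (\<lambda>x. of_real (\<psi> I x))) \<le> enn2real (d_norm k u) * r"
proof -
  define D where "D = enn2real (d_norm k u)"
  define s where "s = (\<Sum>I\<in>multi_indices k. L1 (\<psi> I)) + (\<Sum>J\<in>multi_indices (k + 1). L1 (ext_deriv \<psi>
      J))"
  have uD: "u \<in> distributions" and D: "d_norm k u = ennreal D" and D0: "D \<ge> 0"
    using u by (auto simp: d_space_def D_def top.not_eq_extremum)
  have s0: "s \<ge> 0" by (simp add: s_def sum_nonneg L1_nonneg)
  \<comment> \<open>The form is divided by \<open>t\<close>. Its norm \<open>s\<close> may be 0, so
    a positive \<open>t\<close> above \<open>s\<close> is used and lowered to \<open>s\<close>
    afterwards.\<close>
  have main: "norm (u (\<lambda>x. of_real (\<psi> I x))) \<le> D * t" if t: "t > 0" "s \<le> t" for t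
  proof -
    define \<psi>' where "\<psi>' = (\<lambda>I x. (1 / t) * \<psi> I x)"
    define \<Phi> where "\<Phi> = (\<lambda>I x. of_real (\<psi>' I x) :: 'a)"
    have \<psi>': "\<psi>' I \<in> test_functions" for I
      unfolding \<psi>'_def by (rule test_functions_cmult[OF \<psi>(1)])
    have L1: "L1 (\<lambda>x. (1 / t) * f x) = (1 / t) * L1 f" for f :: "real ^ 'n::{finite,linorder} \<Rightarrow>
        real"
      unfolding L1_def abs_mult using t by simp
    have ed: "ext_deriv \<Phi> J = (\<lambda>x. of_real ((1 / t) * ext_deriv \<psi> J x))" for J
      unfolding \<Phi>_def ext_deriv_of_real[OF test_functions_smooth[OF \<psi>']]
      unfolding \<psi>'_def ext_deriv_cmult[OF test_functions_smooth[OF \<psi>(1)]] ..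
    have "\<Phi> \<in> test_forms k"
      unfolding test_forms_def
    proof (intro CollectI conjI ballI allI impI)
      show "\<Phi> I \<in> test_functions" for I
        unfolding \<Phi>_def by (rule test_functions_bounded_linear[OF bounded_linear_of_real \<psi>'])
      show "\<Phi> I = (\<lambda>x. 0)" if "I \<notin> multi_indices k" for I
        by (simp add: \<Phi>_def \<psi>'_def \<psi>(2)[OF that])
    qed
    moreover have "Upsilon_norm k \<Phi> \<le> 1"
    proof -
      have a: "L1_norm (\<Phi> I) = ennreal ((1 / t) * L1 (\<psi> I))" for I
        unfolding \<Phi>_def L1_norm_of_real[OF \<psi>'] unfolding \<psi>'_def L1 ..
      have b: "L1_norm (ext_deriv \<Phi> J) = ennreal ((1 / t) * L1 (ext_deriv \<psi> J))" for J
        unfolding ed L1_norm_of_real[OF test_functions_cmult[OF ext_deriv_test[OF \<psi>(1)]]] L1 ..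
      have n: "0 \<le> (1 / t) * L1 f" for f :: "real ^ 'n::{finite,linorder} \<Rightarrow> real"
        using t L1_nonneg[of f] by simp
      have "Upsilon_norm k \<Phi> = ennreal ((1 / t) * s)"
        unfolding Upsilon_norm_def L1_form_norm_def a b s_def distrib_left sum_distrib_left
        using n by (simp add: sum_nonneg del: times_divide_eq_left)
      also have "\<dots> \<le> 1" using t s0 by (simp add: ennreal_le_1)
      finally show ?thesis .
    qed
    ultimately have "Max ((\<lambda>I. ennreal (norm (u (\<Phi> I)))) ` multi_indices k) \<le> d_norm k u"
      unfolding d_norm_def by (intro SUP_upper) simp
    moreover have "ennreal (norm (u (\<Phi> I))) \<le> Max ((\<lambda>I. ennreal (norm (u (\<Phi> I)))) ` multi_indices
        k)"
      using I by (intro Max_ge) auto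
    ultimately have "ennreal (norm (u (\<Phi> I))) \<le> ennreal D"
      unfolding D by (rule order_trans[rotated])
    then have "norm (u (\<Phi> I)) \<le> D" using D0 by simp
    moreover have "u (\<Phi> I) = of_real (1 / t) * u (\<lambda>x. of_real (\<psi> I x))"
    proof -
      have "\<Phi> I = (\<lambda>x. of_real (1 / t) * of_real (\<psi> I x))"
        by (simp only: \<Phi>_def \<psi>'_def of_real_mult)
      then show ?thesis
        by (simp only: distributions_scale[OF uD of_real_test[OF \<psi>(1)]])
    qed
    ultimately show ?thesis using t by (simp add: norm_mult norm_divide pos_divide_le_eq)
  qed
  have "norm (u (\<lambda>x. of_real (\<psi> I x))) \<le> D * r"
  proof (rule field_le_epsilon)
    fix e :: real assume e: "e > 0"
    \<comment> \<open>The 1 in the denominator keeps the choice meaningful for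
      \<open>D = 0\<close>.\<close>
    have "norm (u (\<lambda>x. of_real (\<psi> I x))) \<le> D * (s + e / (D + 1))"
      using e D0 s0 by (intro main) (auto intro: add_nonneg_pos)
    also have "\<dots> \<le> D * r + e"
    proof -
      have "D * (e / (D + 1)) \<le> e" using D0 e by (simp add: field_simps)
      moreover have "D * s \<le> D * r" using r D0 by (intro mult_left_mono) (simp_all add: s_def)
      ultimately show ?thesis by (simp add: distrib_left)
    qed
    finally show "norm (u (\<lambda>x. of_real (\<psi> I x))) \<le> D * r + e" .
  qed
  then show ?thesis by (simp add: D_def)
qed

text \<open>The form \<open>\<phi>\<close> \<open>dx^J\<close> with \<open>j\<close> outside
  \<open>J\<close> has the exterior derivative whose component at \<open>insert j J\<close> is
  \<open>partial j \<phi>\<close> up to sign. Being closed, this derivative has only its own L1 norm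
  in \<open>Upsilon_norm\<close>, so second derivatives of \<open>\<phi>\<close> do not
  appear.\<close>

lemma d_space_derivative_bound:
  fixes u :: "(real ^ 'n::{finite,linorder} \<Rightarrow> 'a::{real_normed_field,euclidean_space}) \<Rightarrow> 'a"
  assumes u: "u \<in> d_space k" and k: "k \<in> {1..CARD('n)}" and \<phi>: "\<phi> \<in> test_functions"
  shows "norm (u (\<lambda>x. of_real (partial j \<phi> x))) \<le> enn2real (d_norm k u) * (2 ^ CARD('n) *
      (\<Sum>i\<in>UNIV. L1 (partial i \<phi>)))"
proof -
  \<comment> \<open>Both bounds on \<open>k\<close> matter: \<open>k \<le> CARD('n)\<close> leaves
    room for \<open>k - 1\<close> indices other than \<open>j\<close>, and \<open>k \<ge> 1\<close>
    makes the subtraction exact.\<close>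
  have "k - 1 \<le> card (UNIV - {j})" using k by (auto simp: card_Diff_singleton intro: diff_le_mono)
  from obtain_subset_with_card_n[OF this] obtain J where J: "J \<subseteq> UNIV - {j}" "card J = k - 1" .
  then have j: "j \<notin> J" by auto
  define \<eta> where "\<eta> = (\<lambda>K. if K = J then \<phi> else (\<lambda>x. 0))"
  have \<eta>: "\<eta> K \<in> test_functions" for K unfolding \<eta>_def by (rule single_test[OF \<phi>])
  have S: "(\<Sum>i\<in>UNIV. L1 (partial i \<phi>)) \<ge> 0" by (simp add: sum_nonneg L1_nonneg)
  have "norm (u (\<lambda>x. of_real (ext_deriv \<eta> (insert j J) x)))
      \<le> enn2real (d_norm k u) * (2 ^ CARD('n) * (\<Sum>i\<in>UNIV. L1 (partial i \<phi>)))"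
  proof (rule d_norm_bound[OF u])
    show "ext_deriv \<eta> I \<in> test_functions" for I by (rule ext_deriv_test[OF \<eta>])
    show "ext_deriv \<eta> I = (\<lambda>x. 0)" if "I \<notin> multi_indices k" for I
    proof
      fix x
      have "I - {i} \<noteq> J" if "i \<in> I" for i
      proof
        assume "I - {i} = J"
        then have "I = insert i J" "i \<notin> J" using that by auto
        then have "card I = k" using J(2) k by simp
        with \<open>I \<notin> multi_indices k\<close> show False by (simp add: multi_indices_def)
      qed
      then show "ext_deriv \<eta> I x = 0" unfolding \<eta>_def ext_deriv_single by simp
    qed
    have "ext_deriv (ext_deriv \<eta>) K = (\<lambda>x. 0)" for K
      using ext_deriv_ext_deriv[OF test_functions_smooth[OF \<eta>]] by (simp add: fun_eq_iff)
    then have "(\<Sum>K\<in>multi_indices (k + 1). L1 (ext_deriv (ext_deriv \<eta>) K)) = 0"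
      by (simp add: L1_def)
    moreover have "(\<Sum>I\<in>multi_indices k. L1 (ext_deriv \<eta> I)) \<le> 2 ^ CARD('n) * (\<Sum>i\<in>UNIV. L1
        (partial i \<phi>))"
      unfolding \<eta>_def by (rule sum_multi_indices_le[OF L1_ext_deriv_single[OF \<phi>] S])
    ultimately show "(\<Sum>I\<in>multi_indices k. L1 (ext_deriv \<eta> I)) + (\<Sum>J\<in>multi_indices (k + 1). L1
        (ext_deriv (ext_deriv \<eta>) J))
        \<le> 2 ^ CARD('n) * (\<Sum>i\<in>UNIV. L1 (partial i \<phi>))" by simp
    show "insert j J \<in> multi_indices k"
      using J k j by (simp add: multi_indices_def)
  qed
  moreover have "ext_deriv \<eta> (insert j J) = (\<lambda>x. ext_sign (insert j J) j * partial j \<phi> x)"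
  proof
    fix x
    have "insert j J - {i} = J \<longleftrightarrow> i = j" if "i \<in> insert j J" for i
      using that j by auto
    then have "ext_deriv \<eta> (insert j J) x
        = (\<Sum>i\<in>insert j J. if i = j then ext_sign (insert j J) j * partial j \<phi> x else 0)"
      unfolding \<eta>_def ext_deriv_single by (intro sum.cong) auto
    then show "ext_deriv \<eta> (insert j J) x = ext_sign (insert j J) j * partial j \<phi> x" by simp
  qed
  moreover have "norm (u (\<lambda>x. of_real (ext_sign (insert j J) j * partial j \<phi> x))) = norm (u (\<lambda>x.
      of_real (partial j \<phi> x)))"
    unfolding of_real_mult
    using distributions_scale[OF _ of_real_test[OF test_functions_partial[OF \<phi>, of j]], of u] u
    by (simp add: d_space_def norm_mult norm_power)
  ultimately show ?thesis by simp
qed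

lemma d_space_sobolev_bound:
  fixes u :: "(real ^ 'n::{finite,linorder} \<Rightarrow> 'a::{real_normed_field,euclidean_space}) \<Rightarrow> 'a"
  assumes u: "u \<in> d_space k" and k: "k \<in> {1..CARD('n)}" and \<phi>: "\<phi> \<in> test_functions"
  shows "norm (u (\<lambda>x. of_real (\<phi> x))) \<le> enn2real (d_norm k u) * (2 ^ CARD('n) * (L1 \<phi> + (\<Sum>i\<in>UNIV.
      L1 (partial i \<phi>))))"
proof -
  have "k \<le> card (UNIV :: 'n set)" using k by simp
  from obtain_subset_with_card_n[OF this] obtain I :: "'n set" where I: "card I = k" .
  define \<eta> where "\<eta> = (\<lambda>K. if K = I then \<phi> else (\<lambda>x. 0))"
  have \<eta>: "\<eta> K \<in> test_functions" for K unfolding \<eta>_def by (rule single_test[OF \<phi>])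
  have S: "(\<Sum>i\<in>UNIV. L1 (partial i \<phi>)) \<ge> 0" by (simp add: sum_nonneg L1_nonneg)
  have "norm (u (\<lambda>x. of_real (\<eta> I x))) \<le> enn2real (d_norm k u) * (2 ^ CARD('n) * (L1 \<phi> +
      (\<Sum>i\<in>UNIV. L1 (partial i \<phi>))))"
  proof (rule d_norm_bound[OF u \<eta>])
    show "\<eta> K = (\<lambda>x. 0)" if "K \<notin> multi_indices k" for K
      using that I by (auto simp: \<eta>_def multi_indices_def)
    have "(\<Sum>K\<in>multi_indices k. L1 (\<eta> K)) \<le> 2 ^ CARD('n) * L1 \<phi>"
    proof (rule sum_multi_indices_le[OF _ L1_nonneg])
      show "L1 (\<eta> K) \<le> L1 \<phi>" for K
        using L1_nonneg[of \<phi>] by (simp add: \<eta>_def) (simp add: L1_def)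
    qed
    moreover have "(\<Sum>J\<in>multi_indices (k + 1). L1 (ext_deriv \<eta> J)) \<le> 2 ^ CARD('n) * (\<Sum>i\<in>UNIV. L1
        (partial i \<phi>))"
      unfolding \<eta>_def by (rule sum_multi_indices_le[OF L1_ext_deriv_single[OF \<phi>] S])
    ultimately show "(\<Sum>K\<in>multi_indices k. L1 (\<eta> K)) + (\<Sum>J\<in>multi_indices (k + 1). L1 (ext_deriv \<eta> J))
        \<le> 2 ^ CARD('n) * (L1 \<phi> + (\<Sum>i\<in>UNIV. L1 (partial i \<phi>)))" by (simp add: distrib_left)
    show "I \<in> multi_indices k" using I by (simp add: multi_indices_def)
  qed
  then show ?thesis by (simp add: \<eta>_def)
qed

text \<open>Restricting to real-valued test functions and taking the coordinate along
  \<open>b\<close> gives a real functional. Real scalars pass through the inner product, and a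
  coordinate is bounded by the norm, so real and complex values are handled alike.\<close>

lemma d_space_sobolev_bounded:
  fixes u :: "(real ^ 'n::{finite,linorder} \<Rightarrow> 'a::{real_normed_field,euclidean_space}) \<Rightarrow> 'a"
  assumes u: "u \<in> d_space k" and k: "k \<in> {1..CARD('n)}" and b: "b \<in> Basis"
  shows "sobolev_bounded (\<lambda>\<phi>. u (\<lambda>x. of_real (\<phi> x)) \<bullet> b) (2 ^ CARD('n) * enn2real (d_norm k u))"
proof
  have uD: "u \<in> distributions" using u by (simp add: d_space_def)
  show "u (\<lambda>x. of_real (\<phi> x + \<psi> x)) \<bullet> b = u (\<lambda>x. of_real (\<phi> x)) \<bullet> b + u (\<lambda>x. of_real (\<psi> x)) \<bullet> b"
    if "\<phi> \<in> test_functions" "\<psi> \<in> test_functions" for \<phi> \<psi> :: "real ^ 'n::{finite,linorder} \<Rightarrow> real"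
    unfolding of_real_add distributions_add[OF uD of_real_test[OF that(1)] of_real_test[OF that(2)]]
    by (rule inner_add_left)
  show "u (\<lambda>x. of_real (c * \<phi> x)) \<bullet> b = c * (u (\<lambda>x. of_real (\<phi> x)) \<bullet> b)"
    if "\<phi> \<in> test_functions" for \<phi> :: "real ^ 'n::{finite,linorder} \<Rightarrow> real" and c
    unfolding of_real_mult distributions_scale[OF uD of_real_test[OF that]]
    by (simp flip: scaleR_conv_of_real)
  show "\<bar>u (\<lambda>x. of_real (partial j \<phi> x)) \<bullet> b\<bar> \<le> 2 ^ CARD('n) * enn2real (d_norm k u) * (\<Sum>i\<in>UNIV.
      L1 (partial i \<phi>))"
    if "\<phi> \<in> test_functions" for \<phi> :: "real ^ 'n::{finite,linorder} \<Rightarrow> real" and j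
    using order_trans[OF Basis_le_norm[OF b] d_space_derivative_bound[OF u k that]] by (simp add:
        mult_ac)
  show "\<bar>u (\<lambda>x. of_real (\<phi> x)) \<bullet> b\<bar> \<le> 2 ^ CARD('n) * enn2real (d_norm k u) * (L1 \<phi> + (\<Sum>i\<in>UNIV. L1
      (partial i \<phi>)))"
    if "\<phi> \<in> test_functions" for \<phi> :: "real ^ 'n::{finite,linorder} \<Rightarrow> real"
    using order_trans[OF Basis_le_norm[OF b] d_space_sobolev_bound[OF u k that]] by (simp add:
        mult_ac)
  show "0 \<le> 2 ^ CARD('n) * enn2real (d_norm k u)" by simp
qed

section \<open>The embedding into bmo\<close>

lemma emeasure_cube:
  fixes a :: "real ^ 'n::finite"
  assumes "l \<ge> 0"
  shows "emeasure lebesgue (cube a l) = ennreal (l ^ CARD('n))"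
proof -
  have "emeasure lborel (cube a l) = ennreal (measure lborel (cube a l))"
    using cube_fmeasurable[of a l] by (intro emeasure_eq_ennreal_measure) (auto simp:
        fmeasurable_def)
  then show ?thesis
    using cube_fmeasurable[of a l] assms by (simp add: measure_cube fmeasurable_def)
qed

lemma cube_mean_le:
  fixes f :: "real ^ 'n::finite \<Rightarrow> 'a::euclidean_space"
  assumes f: "f \<in> borel_measurable borel" and int: "integrable lborel (\<lambda>x. indicator (cube a l) x
      * norm (f x - c))"
    and l: "l > 0" and le: "(LBINT x. indicator (cube a l) x * norm (f x - c)) \<le> B * l ^ CARD('n)"
  shows "(\<integral>\<^sup>+x\<in>cube a l. norm (f x - c) \<partial>lebesgue) / emeasure lebesgue (cube a l) \<le> ennreal B"
proof -
  let ?I = "LBINT x. indicator (cube a l) x * norm (f x - c)"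
  have "(\<integral>\<^sup>+x\<in>cube a l. norm (f x - c) \<partial>lebesgue) = (\<integral>\<^sup>+x. ennreal (indicator (cube a l) x * norm
      (f x - c)) \<partial>lborel)"
    unfolding nn_integral_completion by (intro nn_integral_cong) (simp split: split_indicator)
  also have "\<dots> = ennreal ?I"
    using int by (intro nn_integral_eq_integral) auto
  finally have "(\<integral>\<^sup>+x\<in>cube a l. norm (f x - c) \<partial>lebesgue) / emeasure lebesgue (cube a l) =
      ennreal (?I / l ^ CARD('n))"
    using l by (simp add: emeasure_cube divide_ennreal Bochner_Integration.integral_nonneg)
  also have "\<dots> \<le> ennreal B"
    using le l by (intro ennreal_leI) (simp add: pos_divide_le_eq)
  finally show ?thesis .
qed

lemma integrable_indicator_const:
  fixes c :: "'a::euclidean_space"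
  shows "integrable lborel (\<lambda>x. indicator (cube a l) x *\<^sub>R c)"
  using cube_fmeasurable[of a l] by (auto simp: fmeasurable_def)

text \<open>The average differs from \<open>c\<close> by at most the mean of the norm of
  \<open>f - c\<close>, hence by at most \<open>B\<close>; replacing \<open>c\<close> by the average
  therefore doubles the bound.\<close>

lemma cube_oscillation_le:
  fixes f :: "real ^ 'n::finite \<Rightarrow> 'a::euclidean_space"
  assumes [measurable]: "f \<in> borel_measurable borel" and int: "integrable lborel (\<lambda>x. indicator
      (cube a l) x *\<^sub>R f x)"
    and l: "l > 0" and le: "(LBINT x. indicator (cube a l) x * norm (f x - c)) \<le> B * l ^ CARD('n)"
  shows "(\<integral>\<^sup>+x\<in>cube a l. norm (f x - average (cube a l) f) \<partial>lebesgue) / emeasure lebesgue (cube a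
      l) \<le> ennreal (2 * B)"
proof -
  define m where "m = average (cube a l) f"
  have Q[measurable]: "cube a l \<in> sets borel" using cube_fmeasurable[of a l] by (auto simp:
      fmeasurable_def)
  have V: "l ^ CARD('n) > 0" "l \<noteq> 0" using l by simp_all
  have diff: "integrable lborel (\<lambda>x. indicator (cube a l) x *\<^sub>R (f x - d))" for d
    unfolding scaleR_diff_right by (rule Bochner_Integration.integrable_diff[OF int
        integrable_indicator_const])
  have norm: "integrable lborel (\<lambda>x. indicator (cube a l) x * norm (f x - d))" for d
    using integrable_norm[OF diff[of d]] by simp
  have "m = (LBINT x. indicator (cube a l) x *\<^sub>R f x) /\<^sub>R l ^ CARD('n)"
    using l Q by (simp add: m_def average_def set_lebesgue_integral_def integral_completion
        measure_cube)
  then have "l ^ CARD('n) *\<^sub>R m = (LBINT x. indicator (cube a l) x *\<^sub>R f x)"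
    using V(2) by simp
  moreover have "(LBINT x. indicator (cube a l) x *\<^sub>R c) = l ^ CARD('n) *\<^sub>R c"
    using cube_fmeasurable[of a l] l by (simp add: measure_cube fmeasurable_def)
  ultimately have "l ^ CARD('n) *\<^sub>R (m - c) = (LBINT x. indicator (cube a l) x *\<^sub>R (f x - c))"
    unfolding scaleR_diff_right Bochner_Integration.integral_diff[OF int
        integrable_indicator_const] by simp
  then have "l ^ CARD('n) * norm (m - c) = norm (LBINT x. indicator (cube a l) x *\<^sub>R (f x - c))"
    using V(1) by (metis abs_of_pos norm_scaleR)
  also have "\<dots> \<le> (LBINT x. norm (indicator (cube a l) x *\<^sub>R (f x - c)))"
    by (rule integral_norm_bound)
  also have "\<dots> \<le> B * l ^ CARD('n)" using le by simp
  finally have mc: "norm (m - c) \<le> B" using V(1) by (simp add: mult.commute)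
  have "(LBINT x. indicator (cube a l) x * norm (f x - m))
      \<le> (LBINT x. indicator (cube a l) x * norm (f x - c) + indicator (cube a l) x *\<^sub>R B)"
  proof (rule integral_mono)
    show "integrable lborel (\<lambda>x. indicator (cube a l) x * norm (f x - c) + indicator (cube a l) x
        *\<^sub>R B)"
      by (rule Bochner_Integration.integrable_add[OF norm integrable_indicator_const])
    fix x
    have "norm (f x - m) \<le> norm (f x - c) + norm (m - c)"
      using norm_triangle_ineq4[of "f x - c" "m - c"] by simp
    then show "indicator (cube a l) x * norm (f x - m) \<le> indicator (cube a l) x * norm (f x - c)
        + indicator (cube a l) x *\<^sub>R B"
      using mc by (simp split: split_indicator)
  qed (rule norm)
  also have "\<dots> \<le> 2 * B * l ^ CARD('n)"
    unfolding Bochner_Integration.integral_add[OF norm integrable_indicator_const]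
    using le cube_fmeasurable[of a l] l by (simp add: measure_cube fmeasurable_def)
  finally show ?thesis unfolding m_def by (intro cube_mean_le norm l) auto
qed

text \<open>The 3 is 2 for the small cubes, where a constant is replaced by the average, plus 1 for
  the large ones.\<close>

lemma bmo_norm_le:
  fixes u :: "(real ^ 'n::finite \<Rightarrow> 'a::{real_normed_field,euclidean_space}) \<Rightarrow> 'a"
  assumes f: "represents f u" "f \<in> borel_measurable borel" and B: "B \<ge> 0"
    and int: "\<And>a l. integrable lborel (\<lambda>x. indicator (cube a l) x *\<^sub>R f x)"
    and small: "\<And>a l. l > 0 \<Longrightarrow> \<exists>c. (LBINT x. indicator (cube a l) x * norm (f x - c)) \<le> B * l ^
        CARD('n)"
    and large: "\<And>a l. l \<ge> 1 \<Longrightarrow> (LBINT x. indicator (cube a l) x * norm (f x)) \<le> B * l ^ CARD('n)"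
  shows "bmo_norm u \<le> ennreal (3 * B)"
proof -
  have "bmo_norm u \<le> bmo_fun_norm f"
    unfolding bmo_norm_def using f(1) by (intro INF_lower) simp
  also have "\<dots> \<le> ennreal (2 * B) + ennreal B"
    unfolding bmo_fun_norm_def
  proof (intro add_mono SUP_least)
    fix p :: "(real ^ 'n) \<times> real" assume "p \<in> UNIV \<times> {0<..1}"
    then obtain a l where p: "p = (a, l)" "l > 0" by auto
    obtain c where "(LBINT x. indicator (cube a l) x * norm (f x - c)) \<le> B * l ^ CARD('n)"
      using small[OF p(2)] by blast
    then show "(case p of (a, l) \<Rightarrow> (\<integral>\<^sup>+x\<in>cube a l. norm (f x - average (cube a l) f) \<partial>lebesgue)
        / emeasure lebesgue (cube a l)) \<le> ennreal (2 * B)"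
      using cube_oscillation_le[OF f(2) int p(2)] by (simp add: p)
  next
    fix p :: "(real ^ 'n) \<times> real" assume "p \<in> UNIV \<times> {1..}"
    then obtain a l where p: "p = (a, l)" "l \<ge> 1" by auto
    have "integrable lborel (\<lambda>x. indicator (cube a l) x * norm (f x - 0))"
      using integrable_norm[OF int[of a l]] by simp
    from cube_mean_le[OF f(2) this] large[OF p(2), of a] p(2)
    show "(case p of (a, l) \<Rightarrow> (\<integral>\<^sup>+x\<in>cube a l. norm (f x) \<partial>lebesgue) / emeasure lebesgue (cube a
        l)) \<le> ennreal B"
      by (simp add: p)
  qed
  also have "\<dots> = ennreal (3 * B)" using B by (simp flip: ennreal_plus)
  finally show ?thesis .
qed

text \<open>A test function is the sum of its real coordinates times basis vectors. Read as scalars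
  of the field, the basis vectors pass through \<open>u\<close> by homogeneity, so the values on
  real-valued test functions determine \<open>u\<close>; their coordinates are given by the
  densities \<open>F b\<close>.\<close>

lemma representsI:
  fixes u :: "(real ^ 'n::finite \<Rightarrow> 'a::{real_normed_field,euclidean_space}) \<Rightarrow> 'a"
  assumes u: "u \<in> distributions"
    and F: "\<And>b. b \<in> Basis \<Longrightarrow> F b \<in> borel_measurable borel"
    and int: "\<And>b a l. b \<in> Basis \<Longrightarrow> integrable lborel (\<lambda>x. indicator (cube a l) x * F b x)"
    and rep: "\<And>b \<phi>. b \<in> Basis \<Longrightarrow> \<phi> \<in> test_functions \<Longrightarrow> u (\<lambda>x. of_real (\<phi> x)) \<bullet> b = (LBINT x. F b x
        * \<phi> x)"
  shows "represents (\<lambda>x. \<Sum>b\<in>Basis. F b x *\<^sub>R b) u"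
proof -
  let ?f = "\<lambda>x. \<Sum>b\<in>Basis. F b x *\<^sub>R b"
  have [measurable]: "?f \<in> borel_measurable borel"
    using F by (intro borel_measurable_sum borel_measurable_scaleR) auto
  have ball: "\<exists>a l. S \<subseteq> cube a l" if bS: "bounded S" for S :: "(real ^ 'n) set"
  proof -
    obtain R where R: "\<And>x. x \<in> S \<Longrightarrow> norm x \<le> R" using bS unfolding bounded_iff by blast
    have "x \<in> cube (\<chi> i. - R) (2 * R)" if "x \<in> S" for x
      unfolding mem_cube
    proof
      fix i
      show "(\<chi> i. - R) $ i \<le> x $ i \<and> x $ i \<le> (\<chi> i. - R) $ i + 2 * R"
        using component_le_norm_cart[of x i] R[OF that] by (simp add: abs_le_iff)
    qed
    then show ?thesis by blast
  qed
  have "locally_integrable ?f"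
    unfolding locally_integrable_def set_integrable_def
  proof (intro allI impI)
    fix S :: "(real ^ 'n) set" assume S: "compact S"
    then have [measurable]: "S \<in> sets borel" by (rule borel_compact)
    obtain a l where Q: "S \<subseteq> cube a l" using ball compact_imp_bounded[OF S] by blast
    have "integrable lborel (\<lambda>x. indicator S x * F b x)" if b: "b \<in> Basis" for b
    proof -
      have "integrable lborel (\<lambda>x. indicator S x *\<^sub>R (indicator (cube a l) x * F b x))"
        by (rule integrable_mult_indicator[OF _ int[OF b]]) simp
      also have "(\<lambda>x. indicator S x *\<^sub>R (indicator (cube a l) x * F b x)) = (\<lambda>x. indicator S x *
          F b x)"
        using Q by (auto simp: fun_eq_iff split: split_indicator)
      finally show ?thesis .
    qed
    then have "integrable lborel (\<lambda>x. \<Sum>b\<in>Basis. (indicator S x * F b x) *\<^sub>R b)"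
      by (intro Bochner_Integration.integrable_sum integrable_scaleR_left) auto
    then have "integrable lborel (\<lambda>x. indicator S x *\<^sub>R ?f x)"
      by (simp add: scaleR_sum_right)
    then show "integrable lebesgue (\<lambda>x. indicator S x *\<^sub>R ?f x)"
      by (subst integrable_completion) auto
  qed
  moreover have "u \<phi> = (LINT x|lebesgue. ?f x * \<phi> x)" if \<phi>: "\<phi> \<in> test_functions" for \<phi>
  proof -
    have [measurable]: "\<phi> \<in> borel_measurable borel" by (rule test_functions_borel_measurable[OF \<phi>])
    define g where "g b x = \<phi> x \<bullet> b" for b x
    have g: "g b \<in> test_functions" for b
      unfolding g_def[abs_def] by (rule test_functions_bounded_linear[OF
          bounded_linear_inner_left \<phi>])
    have gt: "(\<lambda>x. b * of_real (g b x)) \<in> test_functions" for b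
      by (rule test_functions_bounded_linear[OF _ g]) (intro bounded_linear_const_mult
          bounded_linear_of_real)
    have int2: "integrable lborel (\<lambda>x. F b x * g b' x)" if "b \<in> Basis" for b b'
    proof -
      obtain R where R: "\<And>x. g b' x \<noteq> 0 \<Longrightarrow> norm x \<le> R" using test_functionsE[OF g] by blast
      have "bounded {x. g b' x \<noteq> 0}" unfolding bounded_iff using R by blast
      then obtain a l where "{x. g b' x \<noteq> 0} \<subseteq> cube a l" using ball by blast
      then have "g b' \<in> tests_in (cube a l)" using g by (auto simp: tests_in_def)
      then show ?thesis by (rule integrable_times_test[OF int[OF that]])
    qed
    have \<phi>_eq: "\<phi> = (\<lambda>x. \<Sum>b'\<in>Basis. b' * of_real (g b' x))"
      using euclidean_representation[of "\<phi> _"]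
      by (simp add: g_def fun_eq_iff scaleR_conv_of_real mult.commute)
    have u0: "u (\<lambda>x. 0) = 0"
      using distributions_scale[OF u \<phi>, of 0] by simp
    have sum: "u (\<lambda>x. \<Sum>b'\<in>A. b' * of_real (g b' x)) = (\<Sum>b'\<in>A. b' * u (\<lambda>x. of_real (g b' x)))" if
        "finite A" for A
      using that
    proof induction
      case (insert b A)
      have "(\<lambda>x. \<Sum>b'\<in>A. b' * of_real (g b' x)) \<in> test_functions"
        using insert(1) gt by (rule test_functions_sum)
      from distributions_add[OF u gt this]
      have "u (\<lambda>x. b * of_real (g b x) + (\<Sum>b'\<in>A. b' * of_real (g b' x)))
          = b * u (\<lambda>x. of_real (g b x)) + (\<Sum>b'\<in>A. b' * u (\<lambda>x. of_real (g b' x)))"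
        by (simp only: distributions_scale[OF u of_real_test[OF g]] insert(3))
      then show ?case using insert(1,2) by simp
    qed (simp add: u0)
    have "u \<phi> = (\<Sum>b'\<in>Basis. b' * u (\<lambda>x. of_real (g b' x)))"
      by (subst \<phi>_eq) (rule sum[OF finite_Basis])
    also have "\<dots> = (\<Sum>b'\<in>Basis. b' * (\<Sum>b\<in>Basis. (LBINT x. F b x * g b' x) *\<^sub>R b))"
    proof (rule sum.cong[OF refl])
      fix b' :: 'a
      have "u (\<lambda>x. of_real (g b' x)) = (\<Sum>b\<in>Basis. (LBINT x. F b x * g b' x) *\<^sub>R b)"
        by (subst euclidean_representation[symmetric]) (simp add: rep[OF _ g])
      then show "b' * u (\<lambda>x. of_real (g b' x)) = b' * (\<Sum>b\<in>Basis. (LBINT x. F b x * g b' x) *\<^sub>R b)"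
        by simp
    qed
    also have "\<dots> = (\<Sum>b'\<in>Basis. \<Sum>b\<in>Basis. LBINT x. (F b x * g b' x) *\<^sub>R (b * b'))"
      using int2 by (simp add: sum_distrib_left mult.commute)
    also have "\<dots> = (LBINT x. (\<Sum>b'\<in>Basis. \<Sum>b\<in>Basis. (F b x * g b' x) *\<^sub>R (b * b')))"
      using int2 by (simp add: Bochner_Integration.integral_sum Bochner_Integration.integrable_sum)
    also have "\<dots> = (LBINT x. ?f x * \<phi> x)"
    proof (rule Bochner_Integration.integral_cong[OF refl])
      fix x
      have "?f x * \<phi> x = ?f x * (\<Sum>b'\<in>Basis. g b' x *\<^sub>R b')"
        by (simp add: g_def euclidean_representation)
      then show "(\<Sum>b'\<in>Basis. \<Sum>b\<in>Basis. (F b x * g b' x) *\<^sub>R (b * b')) = ?f x * \<phi> x"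
        by (simp add: sum_distrib_left sum_distrib_right mult.commute)
    qed
    also have "\<dots> = (LINT x|lebesgue. ?f x * \<phi> x)"
      by (rule integral_completion[symmetric]) measurable
    finally show ?thesis .
  qed
  ultimately show ?thesis by (simp add: represents_def)
qed

lemma d_space_bmo_bound:
  "\<exists>C>0::real. \<forall>k\<in>{1..CARD('n)}.
    \<forall>u \<in> (d_space k :: ((real ^ 'n::{finite,linorder} \<Rightarrow> 'a::{real_normed_field,euclidean_space})
        \<Rightarrow> 'a) set).
      bmo_norm u \<le> ennreal C * d_norm k u"
proof -
  obtain K where K: "K \<ge> 0" "\<And>\<l> M. sobolev_bounded (\<l> :: (real ^ 'n::{finite,linorder} \<Rightarrow> real) \<Rightarrow>
      real) M \<Longrightarrow>
    (\<exists>F. bmo_density (K * M) \<l> F)"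
    using sobolev_bounded_representation by blast
  \<comment> \<open>The 3 comes from \<open>bmo_norm_le\<close>, \<open>DIM('a)\<close> from summing
    the coordinates, \<open>2 ^ CARD('n)\<close> from counting index sets; the added 1 makes
    \<open>C\<close> positive even if \<open>K\<close> is 0.\<close>
  define C where "C = 3 * (real DIM('a) * (K * 2 ^ CARD('n))) + 1"
  have C: "C > 0" using K(1) unfolding C_def by (intro add_nonneg_pos) auto
  show ?thesis
  proof (intro exI[of _ C] conjI C ballI)
    fix k and u :: "(real ^ 'n::{finite,linorder} \<Rightarrow> 'a) \<Rightarrow> 'a"
    assume k: "k \<in> {1..CARD('n)}" and u: "u \<in> d_space k"
    define D where "D = enn2real (d_norm k u)"
    have uD: "u \<in> distributions" and D: "d_norm k u = ennreal D" and D0: "D \<ge> 0"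
      using u by (auto simp: d_space_def D_def top.not_eq_extremum)
    define M where "M = 2 ^ CARD('n) * D"
    have M0: "M \<ge> 0" using D0 by (simp add: M_def)
    have "\<forall>b\<in>Basis. \<exists>F. bmo_density (K * M) (\<lambda>\<phi>. u (\<lambda>x. of_real (\<phi> x)) \<bullet> b) F"
      using K(2)[OF d_space_sobolev_bounded[OF u k]] unfolding M_def D_def by blast
    from bchoice[OF this] obtain F where
      F: "\<And>b. b \<in> Basis \<Longrightarrow> F b \<in> borel_measurable borel"
      "\<And>b a l. b \<in> Basis \<Longrightarrow> integrable lborel (\<lambda>x. indicator (cube a l) x * F b x)"
      "\<And>b \<phi>. b \<in> Basis \<Longrightarrow> \<phi> \<in> test_functions \<Longrightarrow> u (\<lambda>x. of_real (\<phi> x)) \<bullet> b = (LBINT x. F b x * \<phi> x)"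
      and small: "\<And>b a l. b \<in> Basis \<Longrightarrow> l > 0 \<Longrightarrow>
        \<exists>c. (LBINT x. indicator (cube a l) x * \<bar>F b x - c\<bar>) \<le> K * M * l ^ CARD('n)"
      and large: "\<And>b a l. b \<in> Basis \<Longrightarrow> l \<ge> 1 \<Longrightarrow>
        (LBINT x. indicator (cube a l) x * \<bar>F b x\<bar>) \<le> K * M * l ^ CARD('n)"
      unfolding bmo_density_def by blast
    let ?f = "\<lambda>x. \<Sum>b\<in>Basis. F b x *\<^sub>R b"
    have fb: "?f \<in> borel_measurable borel"
      using F(1) by (intro borel_measurable_sum borel_measurable_scaleR) auto
    have intd: "integrable lborel (\<lambda>x. indicator (cube a l) x * (F b x - c))" if "b \<in> Basis" for
        a l b c
      using Bochner_Integration.integrable_diff[OF F(2)[OF that] integrable_indicator_const[of a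
          l c]]
      by (simp add: right_diff_distrib)
    have osc: "(LBINT x. indicator (cube a l) x * norm (?f x - (\<Sum>b\<in>Basis. c b *\<^sub>R b))) \<le> real
        DIM('a) * (K * M) * l ^ CARD('n)"
      if c: "\<And>b. b \<in> Basis \<Longrightarrow> (LBINT x. indicator (cube a l) x * \<bar>F b x - c b\<bar>) \<le> K * M * l ^
          CARD('n)" for a l c
    proof -
      have abs: "integrable lborel (\<lambda>x. indicator (cube a l) x * \<bar>F b x - c b\<bar>)" if "b \<in> Basis"
          for b
        using integrable_abs[OF intd[OF that, of a l "c b"]] by (simp add: abs_mult)
      have "(LBINT x. indicator (cube a l) x * norm (?f x - (\<Sum>b\<in>Basis. c b *\<^sub>R b)))
          \<le> (LBINT x. (\<Sum>b\<in>Basis. indicator (cube a l) x * \<bar>F b x - c b\<bar>))"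
      proof (rule integral_mono')
        show "integrable lborel (\<lambda>x. \<Sum>b\<in>Basis. indicator (cube a l) x * \<bar>F b x - c b\<bar>)"
          by (intro Bochner_Integration.integrable_sum abs)
        fix x
        have "norm (?f x - (\<Sum>b\<in>Basis. c b *\<^sub>R b)) = norm (\<Sum>b\<in>Basis. (F b x - c b) *\<^sub>R b)"
          by (simp add: sum_subtractf scaleR_diff_left)
        also have "\<dots> \<le> (\<Sum>b\<in>Basis. norm ((F b x - c b) *\<^sub>R b))" by (rule norm_sum)
        also have "\<dots> = (\<Sum>b\<in>Basis. \<bar>F b x - c b\<bar>)" by simp
        finally show "indicator (cube a l) x * norm (?f x - (\<Sum>b\<in>Basis. c b *\<^sub>R b)) \<le> (\<Sum>b\<in>Basis.
            indicator (cube a l) x * \<bar>F b x - c b\<bar>)"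
          unfolding sum_distrib_left[symmetric] by (rule mult_left_mono) simp
        show "0 \<le> (\<Sum>b\<in>Basis. indicator (cube a l) x * \<bar>F b x - c b\<bar>)" by (simp add: sum_nonneg)
      qed
      also have "\<dots> = (\<Sum>b\<in>Basis. LBINT x. indicator (cube a l) x * \<bar>F b x - c b\<bar>)"
        by (rule Bochner_Integration.integral_sum) (rule abs)
      also have "\<dots> \<le> real DIM('a) * (K * M * l ^ CARD('n))"
        by (rule sum_bounded_above) (rule c)
      finally show ?thesis by (simp add: mult_ac)
    qed
    have "bmo_norm u \<le> ennreal (3 * (real DIM('a) * (K * M)))"
    proof (rule bmo_norm_le[OF representsI[OF uD F] fb])
      show "0 \<le> real DIM('a) * (K * M)" using K(1) M0 by simp
      show "integrable lborel (\<lambda>x. indicator (cube a l) x *\<^sub>R ?f x)" for a l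
      proof -
        have "integrable lborel (\<lambda>x. \<Sum>b\<in>Basis. (indicator (cube a l) x * F b x) *\<^sub>R b)"
          by (intro Bochner_Integration.integrable_sum integrable_scaleR_left F(2))
        then show ?thesis by (simp add: scaleR_sum_right)
      qed
      show "\<exists>c. (LBINT x. indicator (cube a l) x * norm (?f x - c)) \<le> real DIM('a) * (K * M) * l
          ^ CARD('n)"
        if l: "l > 0" for a l
      proof -
        have "\<forall>b\<in>Basis. \<exists>c. (LBINT x. indicator (cube a l) x * \<bar>F b x - c\<bar>) \<le> K * M * l ^ CARD('n)"
          using small l by blast
        from bchoice[OF this] obtain c where
          "\<And>b. b \<in> Basis \<Longrightarrow> (LBINT x. indicator (cube a l) x * \<bar>F b x - c b\<bar>) \<le> K * M * l ^
              CARD('n)" by blast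
        from osc[OF this] show ?thesis by blast
      qed
      show "(LBINT x. indicator (cube a l) x * norm (?f x)) \<le> real DIM('a) * (K * M) * l ^ CARD('n)"
        if l: "l \<ge> 1" for a l
        using osc[of a l "\<lambda>_. 0"] large[OF _ l] by simp
    qed
    also have "\<dots> \<le> ennreal (C * D)"
    proof (rule ennreal_leI)
      have "3 * (real DIM('a) * (K * M)) = (C - 1) * D" by (simp add: C_def M_def)
      also have "\<dots> \<le> C * D" using D0 by (simp add: mult_right_mono)
      finally show "3 * (real DIM('a) * (K * M)) \<le> C * D" .
    qed
    also have "\<dots> = ennreal C * d_norm k u" using C D0 by (simp add: D ennreal_mult)
    finally show "bmo_norm u \<le> ennreal C * d_norm k u" .
  qed
qed

theorem theorem1p4:
  shows "continuously_embedded
      (d_space 1 :: ((real ^ 'n::{finite,linorder} \<Rightarrow> 'a::{real_normed_field,euclidean_space}) \<Rightarrow>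
          'a) set)
      (d_norm 1) bmo bmo_norm \<and>
    (\<exists>C>0::real. \<forall>k\<in>{1..CARD('n)}.
      \<forall>u \<in> (d_space k :: ((real ^ 'n::{finite,linorder} \<Rightarrow> 'a) \<Rightarrow> 'a) set).
        bmo_norm u \<le> ennreal C * d_norm k u)"
proof -
  obtain C where C: "C > 0" "\<forall>k\<in>{1..CARD('n)}.
      \<forall>u \<in> (d_space k :: ((real ^ 'n::{finite,linorder} \<Rightarrow> 'a) \<Rightarrow> 'a) set). bmo_norm u \<le> ennreal C
          * d_norm k u"
    using d_space_bmo_bound by blast
  have 1: "1 \<in> {1..CARD('n)}" by (simp add: Suc_leI)
  have "u \<in> bmo" if u: "u \<in> (d_space 1 :: ((real ^ 'n::{finite,linorder} \<Rightarrow> 'a) \<Rightarrow> 'a) set)" for u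
  proof -
    have "ennreal C * d_norm 1 u < \<infinity>"
      using u by (simp add: d_space_def ennreal_mult_less_top)
    moreover have "bmo_norm u \<le> ennreal C * d_norm 1 u" using C(2) 1 u by blast
    ultimately have "bmo_norm u < \<infinity>" by (rule le_less_trans[rotated])
    then show ?thesis using u by (simp add: bmo_def d_space_def)
  qed
  then have "continuously_embedded
      (d_space 1 :: ((real ^ 'n::{finite,linorder} \<Rightarrow> 'a::{real_normed_field,euclidean_space}) \<Rightarrow>
          'a) set)
      (d_norm 1) bmo bmo_norm"
    unfolding continuously_embedded_def using C(2) 1 by blast
  then show ?thesis using C by blast
qed

end
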